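(* Let $\{f_1,\dots,f_n\}$ and $\{g_1,\dots,g_m\}$ be fixed finite sets of elements of $A$, with a fixed compatible system of $p$-power roots in $A_\infty$ for each $f_i$ and each $g_j$, and let $t,s\ge 0$ be real numbers. Then $$\tau^\sharp([\underline f]^t[\underline g]^s)\subseteq \tau^\sharp([\underline f]^t)\,\tau^\sharp([\underline g]^s),$$ and so also $$\tau([\underline f]^t[\underline g]^s)\subseteq\tau([\underline f]^t)\,\tau([\underline g]^s).$$ In particular, $$\tau([\underline f^{\bullet N}]^t)=\tau([\underline f]^{tN})\subseteq\tau([\underline f]^t)^N$$ for all real $t\ge0$ and all positive integers $N$.
   Context: Fix a prime $p$. $K^\circ$ denotes the $p$-adic completion of $\mathbb Z_p[p^{1/p^\infty}]$. A $K^\circ$-algebra $S$ is integral perfectoid if it is $p$-adically complete, $p$-torsion free, and Frobenius induces an isomorphism $S/p^{1/p}\to S/p$; by convention every integral perfectoid $S$ is also assumed integrally closed in $S[1/p]$. An element $z$ of a $K^\circ$-module (or a module) is almost zero if it is annihilated by $p^{1/p^k}$ for all $k>0$; "$p^{1/p^\infty}z=0$" means $z$ is almost zero. A compatible system of $p$-power roots of $g$ in $S$ is a sequence $\{g^{1/p^e}\}_{e\ge 0}$ with $g^{1/p^0}=g$ and $(g^{1/p^{e+1}})^p=g^{1/p^e}$. A ring map $A\to S$ with $S$ a $K^\circ$-algebra is almost flat if $\operatorname{Tor}_i^A(M,S)$ is almost zero for all $A$-modules $M$ and $i>0$. $(A,\mathfrak m)$ is a complete regular local ring of mixed characteristic $(0,p)$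 and dimension $d$. $A\to A_\infty$ is a fixed map to an integral perfectoid $K^\circ$-algebra such that: (a) every element of $A$ has a compatible system of $p$-power roots in $A_\infty$; (b) $A\to A_\infty$ is almost flat (so it is injective, and nonzero elements of $A$ are nonzerodivisors on $A_\infty$); (c) if $M$ is an $A$-module with $M\otimes_AA_\infty$ almost zero, then $M=0$. For $f_1,\dots,f_n\in A$ with a fixed compatible system $\{f_i^{1/p^e}\}_e$ for each $i$ (these data are denoted $[\underline f]=[f_1,\dots,f_n]$) and real $t\ge0$, let $0^{\diamondsuit[\underline f]^t}_{H^d_{\mathfrak m}(A)}$ be the set of $\eta\in H^d_{\mathfrak m}(A)$ such that for all $e>0$, $p^{1/p^\infty}f\eta=0$ in $H^d_{\mathfrak m}(A_\infty)$ for every product $f=\prod_{i=1}^af_{j_i}^{1/p^e}$ of the chosen roots (repetitions allowed) with integer $a\ge tp^e$. Put $\tau^\sharp([\underline f]^t)=\operatorname{Ann}_A\big(0^{\diamondsuit[\underline f]^t}_{H^d_{\mathfrak m}(A)}\big)$, and $\tau([\underline f]^t)=\tau^\sharp([\underline f]^{t+\epsilon})$ for $0<\epsilon\ll1$ (this stabilizes). Mixed version: $0^{\diamondsuit[\underline f]^t[\underline g]^s}_{H^d_{\mathfrak m}(A)}$ is the set of $\eta\in H^d_{\mathfrak m}(A)$ such that for all $e>0$, $p^{1/p^\infty}fg\cdot\eta=0$ in $H^d_{\mathfrak m}(A_\infty)$ for all $f=\prod_{i=1}^af_{j_i}^{1/p^e}$ and all $g=\prod_{i=1}^bg_{k_i}^{1/p^e}$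 with $a\ge tp^e$, $b\ge sp^e$. Put $\tau^\sharp([\underline f]^t[\underline g]^s)=\operatorname{Ann}_A$ of this set and $\tau([\underline f]^t[\underline g]^s)=\tau^\sharp([\underline f]^{t+\epsilon}[\underline g]^{s+\epsilon})$ for $0<\epsilon\ll1$. $\underline f^{\bullet N}$ denotes the set of degree $N$ monomials in the $f_i$, with compatible systems of $p$-power roots given by the products of the fixed compatible systems of the $f_i$. *)

theory Defs
  imports
    Complex_Main
    "HOL-Library.Extended_Nat"
    "HOL-Library.Poly_Mapping"
    "HOL-Computational_Algebra.Polynomial"
begin

section \<open>Commutative rings and ideals\<close>

text \<open>A commutative ring is a type of class \<open>comm_ring_1\<close>; its ideals are the submodules of the
  ring regarded as a module over itself, in the sense of the locale \<open>module\<close> of \<^theory>\<open>HOL.Modules\<close>.\<close>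

definition is_ring_hom :: "('a::comm_ring_1 \<Rightarrow> 'b::comm_ring_1) \<Rightarrow> bool" where
  "is_ring_hom h \<longleftrightarrow> h 1 = 1 \<and> (\<forall>x y. h (x + y) = h x + h y) \<and> (\<forall>x y. h (x * y) = h x * h y)"

definition is_ideal :: "'a::comm_ring_1 set \<Rightarrow> bool" where
  "is_ideal I \<longleftrightarrow> module.subspace (*) I"

definition ideal_gen :: "'a::comm_ring_1 set \<Rightarrow> 'a set" where
  "ideal_gen X = module.span (*) X"

definition ideal_mult :: "'a::comm_ring_1 set \<Rightarrow> 'a set \<Rightarrow> 'a set" where
  "ideal_mult I J = ideal_gen {x * y | x y. x \<in> I \<and> y \<in> J}"

primrec ideal_pow :: "'a::comm_ring_1 set \<Rightarrow> nat \<Rightarrow> 'a set" where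
  "ideal_pow I 0 = UNIV"
| "ideal_pow I (Suc n) = ideal_mult I (ideal_pow I n)"

definition is_prime_ideal :: "'a::comm_ring_1 set \<Rightarrow> bool" where
  "is_prime_ideal P \<longleftrightarrow> is_ideal P \<and> P \<noteq> UNIV \<and> (\<forall>x y. x * y \<in> P \<longrightarrow> x \<in> P \<or> y \<in> P)"

definition is_noetherian :: "'a::comm_ring_1 itself \<Rightarrow> bool" where
  "is_noetherian _ \<longleftrightarrow> (\<forall>I::'a set. is_ideal I \<longrightarrow> (\<exists>X. finite X \<and> I = ideal_gen X))"

definition krull_dim :: "'a::comm_ring_1 itself \<Rightarrow> enat" where
  "krull_dim _ = Sup {enat n | n. \<exists>P::nat \<Rightarrow> 'a set.
     (\<forall>i\<le>n. is_prime_ideal (P i)) \<and> (\<forall>i<n. P i \<subset> P (Suc i))}"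

definition is_local_ring :: "'a::comm_ring_1 set \<Rightarrow> bool" where
  "is_local_ring m \<longleftrightarrow>
     is_ideal m \<and> m \<noteq> UNIV \<and> (\<forall>I. is_ideal I \<and> I \<noteq> UNIV \<longrightarrow> I \<subseteq> m)"

definition is_regular_local_ring :: "'a::comm_ring_1 set \<Rightarrow> nat \<Rightarrow> bool" where
  "is_regular_local_ring m d \<longleftrightarrow>
     is_noetherian TYPE('a) \<and> is_local_ring m \<and> krull_dim TYPE('a) = enat d \<and>
     (\<exists>xs. length xs = d \<and> m = ideal_gen (set xs))"

text \<open>Completeness includes separatedness.\<close>

definition adically_complete :: "'a::comm_ring_1 set \<Rightarrow> bool" where
  "adically_complete I \<longleftrightarrow>
     (\<Inter>n. ideal_pow I n) = {0} \<and>
     (\<forall>x::nat \<Rightarrow> 'a. (\<forall>n. x (Suc n) - x n \<in> ideal_pow I n) \<longrightarrow>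
        (\<exists>y. \<forall>n. y - x n \<in> ideal_pow I n))"

text \<open>The residue field \<open>A/m\<close> has characteristic \<open>p\<close> and \<open>A\<close> has characteristic 0.\<close>

definition mixed_char :: "nat \<Rightarrow> 'a::comm_ring_1 set \<Rightarrow> bool" where
  "mixed_char p m \<longleftrightarrow>
     (\<forall>n. (of_nat n :: 'a) = 0 \<longrightarrow> n = 0) \<and> (\<forall>n. (of_nat n :: 'a) \<in> m \<longleftrightarrow> p dvd n)"


section \<open>The ring \<open>K\<degree>\<close> and integral perfectoid algebras\<close>

definition compatible_roots :: "nat \<Rightarrow> (nat \<Rightarrow> 'b::comm_ring_1) \<Rightarrow> 'b \<Rightarrow> bool" where
  "compatible_roots p r g \<longleftrightarrow> r 0 = g \<and> (\<forall>e. r (Suc e) ^ p = r e)"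

text \<open>\<open>h : R \<rightarrow> S\<close> exhibits \<open>S\<close> as the \<open>p\<close>-adic completion \<open>lim R/p\<^sup>nR\<close> of \<open>R\<close>: the ring \<open>S\<close> is
  \<open>p\<close>-adically complete and \<open>R/p\<^sup>nR \<rightarrow> S/p\<^sup>nS\<close> is bijective for all \<open>n\<close>. This determines \<open>S\<close> up to
  unique isomorphism over \<open>R\<close>. For \<open>R = \<int>\<close> it says that \<open>S\<close> is the ring \<open>\<int>\<^sub>p\<close> of \<open>p\<close>-adic integers.\<close>

definition is_p_completion :: "nat \<Rightarrow> ('r::comm_ring_1 \<Rightarrow> 's::comm_ring_1) \<Rightarrow> bool" where
  "is_p_completion p h \<longleftrightarrow>
     is_ring_hom h \<and> adically_complete (ideal_gen {of_nat p :: 's}) \<and>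
     (\<forall>n. (\<forall>x. of_nat p ^ n dvd h x \<longrightarrow> of_nat p ^ n dvd x) \<and>
          (\<forall>y. \<exists>x. of_nat p ^ n dvd y - h x))"

text \<open>\<open>h : Z \<rightarrow> R\<close> exhibits \<open>R\<close> as \<open>Z[p\<^bsup>1/p^\<infinity>\<^esup>]\<close>: \<open>R\<close> is a domain containing \<open>Z\<close>, generated over \<open>Z\<close> by
  the members \<open>w e = p\<^bsup>1/p^e\<^esup>\<close> of a compatible system of \<open>p\<close>-power roots of \<open>p\<close> (each element is a
  polynomial in a single \<open>w e\<close> because \<open>w e\<close> is a power of \<open>w (Suc e)\<close>). For \<open>Z = \<int>\<^sub>p\<close> this determines
  \<open>R\<close> up to isomorphism, since all \<open>X\<^bsup>p^e\<^esup> - p\<close> are irreducible over \<open>\<int>\<^sub>p\<close>.\<close>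

definition is_p_root_extension :: "nat \<Rightarrow> ('z::comm_ring_1 \<Rightarrow> 'r::idom) \<Rightarrow> (nat \<Rightarrow> 'r) \<Rightarrow> bool" where
  "is_p_root_extension p h w \<longleftrightarrow>
     is_ring_hom h \<and> inj h \<and> compatible_roots p w (of_nat p) \<and>
     (\<forall>y. \<exists>e q. y = poly (map_poly h q) (w e))"

text \<open>For a \<open>K\<degree>\<close>-algebra \<open>S\<close>, the argument \<open>\<pi>\<close> below is the system \<open>\<pi> k = p\<^bsup>1/p^k\<^esup>\<close> of images in \<open>S\<close>
  of the roots of \<open>p\<close> in \<open>K\<degree>\<close>.

  The third condition of \<open>is_integral_perfectoid\<close> says that Frobenius \<open>S/p\<^bsup>1/p\<^esup> \<rightarrow> S/p\<close> is bijective.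
  The last one says that \<open>S\<close> is integrally closed in \<open>S[1/p]\<close>: since \<open>S\<close> is \<open>p\<close>-torsion free, the
  equation is \<open>q(s/p\<^sup>n) = 0\<close> in \<open>S[1/p]\<close>, multiplied by \<open>p\<^sup>n\<close> to the power \<open>degree q\<close>.\<close>

definition is_integral_perfectoid :: "nat \<Rightarrow> (nat \<Rightarrow> 'b::comm_ring_1) \<Rightarrow> bool" where
  "is_integral_perfectoid p \<pi> \<longleftrightarrow>
     adically_complete (ideal_gen {of_nat p :: 'b}) \<and>
     (\<forall>x::'b. of_nat p * x = 0 \<longrightarrow> x = 0) \<and>
     ((\<forall>x y::'b. of_nat p dvd x ^ p - y ^ p \<longrightarrow> \<pi> 1 dvd x - y) \<and>
      (\<forall>y::'b. \<exists>x. of_nat p dvd y - x ^ p)) \<and>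
     (\<forall>(s::'b) n (q::'b poly).
        lead_coeff q = 1 \<and>
        (\<Sum>i\<le>degree q. coeff q i * s ^ i * (of_nat p ^ n) ^ (degree q - i)) = 0 \<longrightarrow>
        of_nat p ^ n dvd s)"


section \<open>Tensor products, Tor and almost flatness\<close>

text \<open>\<^typ>\<open>nat \<Rightarrow>\<^sub>0 'a\<close> is the free module with countable basis over the ring \<open>'a\<close>. Modules over \<open>A\<close> are
  presented as \<open>A\<^bsup>(\<nat>)\<^esup>/N\<close> with \<open>N\<close> a submodule; up to isomorphism these are all countably generated
  \<open>A\<close>-modules. The restriction is harmless for noetherian \<open>A\<close>: each of these modules has a resolution by
  countable free modules, and Tor commutes with filtered colimits, so vanishing up to almost zero for
  finitely generated modules gives it for all modules; and for almost flat \<open>S\<close>, if \<open>M \<otimes>\<^sub>A S\<close> is almost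
  zero then so is \<open>M' \<otimes>\<^sub>A S\<close> for every cyclic submodule \<open>M'\<close> of \<open>M\<close>.\<close>

definition free_scale :: "'a::comm_ring_1 \<Rightarrow> (nat \<Rightarrow>\<^sub>0 'a) \<Rightarrow> (nat \<Rightarrow>\<^sub>0 'a)" where
  "free_scale a v = Poly_Mapping.map ((*) a) v"

text \<open>A free resolution \<open>\<dots> \<rightarrow> F\<^sub>2 \<rightarrow> F\<^sub>1 \<rightarrow> F\<^sub>0\<close> of \<open>M = A\<^bsup>(\<nat>)\<^esup>/N\<close>, where all \<open>F\<^sub>k\<close> are \<open>A\<^bsup>(\<nat>)\<^esup>\<close> and \<open>D k\<close> is the map
  from \<open>F\<close> in degree \<open>Suc k\<close> to \<open>F\<close> in degree \<open>k\<close>.\<close>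

definition is_free_resolution ::
  "(nat \<Rightarrow>\<^sub>0 'a::comm_ring_1) set \<Rightarrow> (nat \<Rightarrow> (nat \<Rightarrow>\<^sub>0 'a) \<Rightarrow> (nat \<Rightarrow>\<^sub>0 'a)) \<Rightarrow> bool" where
  "is_free_resolution N D \<longleftrightarrow>
     (\<forall>k. module_hom free_scale free_scale (D k)) \<and>
     range (D 0) = N \<and>
     (\<forall>k. {v. D k v = 0} = range (D (Suc k)))"

text \<open>The \<open>S\<close>-linear map \<open>u \<otimes> S : S\<^bsup>(\<nat>)\<^esup> \<rightarrow> S\<^bsup>(\<nat>)\<^esup>\<close> for an \<open>A\<close>-linear map \<open>u : A\<^bsup>(\<nat>)\<^esup> \<rightarrow> A\<^bsup>(\<nat>)\<^esup>\<close> and a ring map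
  \<open>\<phi> : A \<rightarrow> S\<close>.\<close>

definition base_change ::
  "('a::comm_ring_1 \<Rightarrow> 'b::comm_ring_1) \<Rightarrow> ((nat \<Rightarrow>\<^sub>0 'a) \<Rightarrow> (nat \<Rightarrow>\<^sub>0 'a)) \<Rightarrow> (nat \<Rightarrow>\<^sub>0 'b) \<Rightarrow> (nat \<Rightarrow>\<^sub>0 'b)" where
  "base_change \<phi> u v =
     (\<Sum>i\<in>Poly_Mapping.keys v.
        free_scale (Poly_Mapping.lookup v i)
          (Poly_Mapping.map \<phi> (u (Poly_Mapping.single i 1))))"

text \<open>\<open>Tor\<close> in degree \<open>Suc i\<close> of \<open>M\<close> and \<open>S\<close> is the kernel of \<open>D i \<otimes> S\<close> modulo the image of
  \<open>D (Suc i) \<otimes> S\<close>.\<close>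

definition is_almost_flat :: "('a::comm_ring_1 \<Rightarrow> 'b::comm_ring_1) \<Rightarrow> (nat \<Rightarrow> 'b) \<Rightarrow> bool" where
  "is_almost_flat \<phi> \<pi> \<longleftrightarrow>
     (\<forall>N D. module.subspace free_scale N \<and> is_free_resolution N D \<longrightarrow>
        (\<forall>i v. base_change \<phi> (D i) v = 0 \<longrightarrow>
           (\<forall>k>0. free_scale (\<pi> k) v \<in> range (base_change \<phi> (D (Suc i))))))"

text \<open>For \<open>M = A\<^bsup>(\<nat>)\<^esup>/N\<close> the module \<open>M \<otimes>\<^sub>A S\<close> is \<open>S\<^bsup>(\<nat>)\<^esup>\<close> modulo the \<open>S\<close>-span of the image of \<open>N\<close>.\<close>

definition almost_zero_tensor_imp_zero ::
  "('a::comm_ring_1 \<Rightarrow> 'b::comm_ring_1) \<Rightarrow> (nat \<Rightarrow> 'b) \<Rightarrow> bool" where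
  "almost_zero_tensor_imp_zero \<phi> \<pi> \<longleftrightarrow>
     (\<forall>N. module.subspace free_scale N \<and>
        (\<forall>v. \<forall>k>0. free_scale (\<pi> k) v \<in> module.span free_scale (Poly_Mapping.map \<phi> ` N)) \<longrightarrow>
        N = UNIV)"


section \<open>Local cohomology\<close>

text \<open>Local cohomology of a module with scalar multiplication \<open>s\<close>, with respect to the ideal generated
  by the list \<open>xs\<close>, is the cohomology of the Cech complex whose term \<open>C\<^sup>i\<close> is the direct sum, over
  all \<open>S \<subseteq> {..<length xs}\<close> with \<open>i\<close> elements, of the localizations of the module at \<open>x\<^sub>S = \<Prod>j\<in>S. xs ! j\<close>.

  The pair \<open>(c, n)\<close> represents the cochain with components \<open>c S / x\<^sub>S\<^sup>n\<close>; every cochain has such a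
  common exponent \<open>n\<close>, because the direct sum is finite. Only the values \<open>c S\<close> at the \<open>S\<close> above
  matter.\<close>

type_synonym 'm cochain = "(nat set \<Rightarrow> 'm) \<times> nat"

definition cech_denom :: "'a::comm_ring_1 list \<Rightarrow> nat set \<Rightarrow> 'a" where
  "cech_denom xs S = (\<Prod>j\<in>S. xs ! j)"

text \<open>Equality in \<open>C\<^sup>i\<close>.\<close>

definition cech_eq ::
  "('a::comm_ring_1 \<Rightarrow> 'm::ab_group_add \<Rightarrow> 'm) \<Rightarrow> 'a list \<Rightarrow> nat \<Rightarrow> 'm cochain \<Rightarrow> 'm cochain \<Rightarrow> bool" where
  "cech_eq s xs i = (\<lambda>(c, n) (c', n').
     \<forall>S. S \<subseteq> {..<length xs} \<and> card S = i \<longrightarrow>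
       (\<exists>k. s (cech_denom xs S ^ k)
              (s (cech_denom xs S ^ n') (c S) - s (cech_denom xs S ^ n) (c' S)) = 0))"

definition cech_zero :: "'m::ab_group_add cochain" where
  "cech_zero = ((\<lambda>_. 0), 0)"

definition cech_minus ::
  "('a::comm_ring_1 \<Rightarrow> 'm::ab_group_add \<Rightarrow> 'm) \<Rightarrow> 'a list \<Rightarrow> 'm cochain \<Rightarrow> 'm cochain \<Rightarrow> 'm cochain" where
  "cech_minus s xs = (\<lambda>(c, n) (c', n').
     ((\<lambda>S. s (cech_denom xs S ^ n') (c S) - s (cech_denom xs S ^ n) (c' S)), n + n'))"

text \<open>The differential: in the localization at \<open>x\<^sub>T\<close>, the fraction \<open>c (T - {j}) / x\<^sub>S\<^sup>n\<close> with \<open>S = T - {j}\<close>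
  equals \<open>x\<^sub>j\<^sup>n c (T - {j}) / x\<^sub>T\<^sup>n\<close>.\<close>

definition cech_diff ::
  "('a::comm_ring_1 \<Rightarrow> 'm::ab_group_add \<Rightarrow> 'm) \<Rightarrow> 'a list \<Rightarrow> 'm cochain \<Rightarrow> 'm cochain" where
  "cech_diff s xs = (\<lambda>(c, n).
     ((\<lambda>T. \<Sum>j\<in>T. s ((- 1) ^ card {l \<in> T. l < j} * (xs ! j) ^ n) (c (T - {j}))), n))"

definition cech_cocycles ::
  "('a::comm_ring_1 \<Rightarrow> 'm::ab_group_add \<Rightarrow> 'm) \<Rightarrow> 'a list \<Rightarrow> nat \<Rightarrow> 'm cochain set" where
  "cech_cocycles s xs i = {z. cech_eq s xs (Suc i) (cech_diff s xs z) cech_zero}"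

text \<open>For \<open>i = 0\<close> the coboundaries vanish, as \<open>cech_diff\<close> is an empty sum at the empty set.\<close>

definition cech_cohomologous ::
  "('a::comm_ring_1 \<Rightarrow> 'm::ab_group_add \<Rightarrow> 'm) \<Rightarrow> 'a list \<Rightarrow> nat \<Rightarrow> ('m cochain \<times> 'm cochain) set" where
  "cech_cohomologous s xs i =
     {(z, z'). z \<in> cech_cocycles s xs i \<and> z' \<in> cech_cocycles s xs i \<and>
        (\<exists>b. cech_eq s xs i (cech_minus s xs z z') (cech_diff s xs b))}"

definition local_cohomology ::
  "('a::comm_ring_1 \<Rightarrow> 'm::ab_group_add \<Rightarrow> 'm) \<Rightarrow> 'a list \<Rightarrow> nat \<Rightarrow> 'm cochain set set" where
  "local_cohomology s xs i = cech_cocycles s xs i // cech_cohomologous s xs i"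

definition lc_zero ::
  "('a::comm_ring_1 \<Rightarrow> 'm::ab_group_add \<Rightarrow> 'm) \<Rightarrow> 'a list \<Rightarrow> nat \<Rightarrow> 'm cochain set" where
  "lc_zero s xs i = cech_cohomologous s xs i `` {cech_zero}"

text \<open>The map induced by a linear map \<open>u\<close> into a module with scalar multiplication \<open>s\<close>. With \<open>u\<close> the
  multiplication by a ring element this is the multiplication by that element on local cohomology.\<close>

definition lc_map ::
  "('a::comm_ring_1 \<Rightarrow> 'n::ab_group_add \<Rightarrow> 'n) \<Rightarrow> 'a list \<Rightarrow> nat \<Rightarrow> ('m \<Rightarrow> 'n) \<Rightarrow> 'm cochain set \<Rightarrow> 'n cochain set" where
  "lc_map s xs i u \<eta> = cech_cohomologous s xs i `` ((\<lambda>(c, n). (u \<circ> c, n)) ` \<eta>)"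

text \<open>The annihilator in \<open>A\<close> of a set of elements of the local cohomology of \<open>A\<close>.\<close>

definition lc_annihilator :: "'a::comm_ring_1 list \<Rightarrow> nat \<Rightarrow> 'a cochain set set \<Rightarrow> 'a set" where
  "lc_annihilator xs i N = {a. \<forall>\<eta>\<in>N. lc_map (*) xs i ((*) a) \<eta> = lc_zero (*) xs i}"

text \<open>For \<open>\<eta>\<close> in the local cohomology of \<open>A\<close>, a ring map \<open>\<phi> : A \<rightarrow> S\<close> and \<open>b\<close> in \<open>S\<close>: the element \<open>b \<eta>\<close> of the
  local cohomology of the \<open>A\<close>-module \<open>S\<close> is almost zero.\<close>

definition almost_kills ::
  "('a::comm_ring_1 \<Rightarrow> 'b::comm_ring_1) \<Rightarrow> (nat \<Rightarrow> 'b) \<Rightarrow> 'a list \<Rightarrow> nat \<Rightarrow> 'b \<Rightarrow> 'a cochain set \<Rightarrow> bool" where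
  "almost_kills \<phi> \<pi> xs i b \<eta> \<longleftrightarrow>
     (let s = (\<lambda>a z. \<phi> a * z) in
      \<forall>k>0. lc_map s xs i ((*) (\<pi> k)) (lc_map s xs i ((*) b) (lc_map s xs i \<phi> \<eta>)) = lc_zero s xs i)"


section \<open>Perfectoid test ideals\<close>

text \<open>The data \<open>[f\<^sub>1, \<dots>, f\<^sub>n]\<close> enter through the finite set \<open>F\<close> of the chosen systems of \<open>p\<close>-power roots:
  a member \<open>r\<close> of \<open>F\<close> has \<open>r e = f\<^sub>i\<^bsup>1/p^e\<^esup>\<close>, in particular \<open>r 0\<close> is the image of \<open>f\<^sub>i\<close>.
  \<open>root_products F e a\<close> consists of the products of \<open>a\<close> of the chosen \<open>p\<^sup>e\<close>-th roots.\<close>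

definition root_products :: "(nat \<Rightarrow> 'b::comm_ring_1) set \<Rightarrow> nat \<Rightarrow> nat \<Rightarrow> 'b set" where
  "root_products F e a = {(\<Prod>i<a. h i e) | h. \<forall>i<a. h i \<in> F}"

text \<open>The systems of roots attached to the monomials of degree \<open>N\<close>.\<close>

definition bullet_power :: "(nat \<Rightarrow> 'b::comm_ring_1) set \<Rightarrow> nat \<Rightarrow> (nat \<Rightarrow> 'b) set" where
  "bullet_power F N = {(\<lambda>e. \<Prod>i<N. h i e) | h. \<forall>i<N. h i \<in> F}"

definition zero_diamond ::
  "nat \<Rightarrow> ('a::comm_ring_1 \<Rightarrow> 'b::comm_ring_1) \<Rightarrow> (nat \<Rightarrow> 'b) \<Rightarrow> 'a list \<Rightarrow> nat \<Rightarrow>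
   (nat \<Rightarrow> 'b) set \<Rightarrow> real \<Rightarrow> 'a cochain set set" where
  "zero_diamond p \<phi> \<pi> xs d F t =
     {\<eta> \<in> local_cohomology (*) xs d.
        \<forall>e>0. \<forall>a. real a \<ge> t * real p ^ e \<longrightarrow>
          (\<forall>b \<in> root_products F e a. almost_kills \<phi> \<pi> xs d b \<eta>)}"

definition zero_diamond_mixed ::
  "nat \<Rightarrow> ('a::comm_ring_1 \<Rightarrow> 'b::comm_ring_1) \<Rightarrow> (nat \<Rightarrow> 'b) \<Rightarrow> 'a list \<Rightarrow> nat \<Rightarrow>
   (nat \<Rightarrow> 'b) set \<Rightarrow> real \<Rightarrow> (nat \<Rightarrow> 'b) set \<Rightarrow> real \<Rightarrow> 'a cochain set set" where
  "zero_diamond_mixed p \<phi> \<pi> xs d F t G u =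
     {\<eta> \<in> local_cohomology (*) xs d.
        \<forall>e>0. \<forall>a a'. real a \<ge> t * real p ^ e \<and> real a' \<ge> u * real p ^ e \<longrightarrow>
          (\<forall>b \<in> root_products F e a. \<forall>b' \<in> root_products G e a'.
             almost_kills \<phi> \<pi> xs d (b * b') \<eta>)}"

definition tau_sharp ::
  "nat \<Rightarrow> ('a::comm_ring_1 \<Rightarrow> 'b::comm_ring_1) \<Rightarrow> (nat \<Rightarrow> 'b) \<Rightarrow> 'a list \<Rightarrow> nat \<Rightarrow>
   (nat \<Rightarrow> 'b) set \<Rightarrow> real \<Rightarrow> 'a set" where
  "tau_sharp p \<phi> \<pi> xs d F t = lc_annihilator xs d (zero_diamond p \<phi> \<pi> xs d F t)"

definition tau_sharp_mixed ::
  "nat \<Rightarrow> ('a::comm_ring_1 \<Rightarrow> 'b::comm_ring_1) \<Rightarrow> (nat \<Rightarrow> 'b) \<Rightarrow> 'a list \<Rightarrow> nat \<Rightarrow>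
   (nat \<Rightarrow> 'b) set \<Rightarrow> real \<Rightarrow> (nat \<Rightarrow> 'b) set \<Rightarrow> real \<Rightarrow> 'a set" where
  "tau_sharp_mixed p \<phi> \<pi> xs d F t G u =
     lc_annihilator xs d (zero_diamond_mixed p \<phi> \<pi> xs d F t G u)"

text \<open>\<open>tau\<close> is the common value of \<open>tau_sharp\<close> at \<open>t + \<epsilon>\<close> for all sufficiently small \<open>\<epsilon> > 0\<close>. Such a value
  exists when \<open>A\<close> is noetherian, since \<open>tau_sharp\<close> is decreasing in the exponent.\<close>

definition tau ::
  "nat \<Rightarrow> ('a::comm_ring_1 \<Rightarrow> 'b::comm_ring_1) \<Rightarrow> (nat \<Rightarrow> 'b) \<Rightarrow> 'a list \<Rightarrow> nat \<Rightarrow>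
   (nat \<Rightarrow> 'b) set \<Rightarrow> real \<Rightarrow> 'a set" where
  "tau p \<phi> \<pi> xs d F t =
     (THE J. \<forall>\<^sub>F \<epsilon> in at_right 0. tau_sharp p \<phi> \<pi> xs d F (t + \<epsilon>) = J)"

definition tau_mixed ::
  "nat \<Rightarrow> ('a::comm_ring_1 \<Rightarrow> 'b::comm_ring_1) \<Rightarrow> (nat \<Rightarrow> 'b) \<Rightarrow> 'a list \<Rightarrow> nat \<Rightarrow>
   (nat \<Rightarrow> 'b) set \<Rightarrow> real \<Rightarrow> (nat \<Rightarrow> 'b) set \<Rightarrow> real \<Rightarrow> 'a set" where
  "tau_mixed p \<phi> \<pi> xs d F t G u =
     (THE J. \<forall>\<^sub>F \<epsilon> in at_right 0. tau_sharp_mixed p \<phi> \<pi> xs d F (t + \<epsilon>) G (u + \<epsilon>) = J)"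

end

theory Submission
  imports Defs "HOL-Library.Countable_Set"
begin

text \<open>
  Let \<open>E\<close> be the top local cohomology of \<open>A\<close> and \<open>I\<close>, \<open>J\<close> the annihilators of the submodules \<open>N\<^sub>f\<close>, \<open>N\<^sub>g\<close>
  of \<open>E\<close> attached to \<open>f\<close> and \<open>g\<close>. By Matlis duality it suffices that every \<open>\<eta>\<close> killed by \<open>I J\<close> lies in
  the mixed submodule. Each multiple \<open>y \<eta>\<close> with \<open>y \<in> J\<close> is killed by \<open>I\<close>, hence lies in \<open>N\<^sub>f\<close>; so a product
  of roots of the \<open>f\<^sub>i\<close> sends \<open>\<eta>\<close> to an element almost killed by \<open>J\<close>, which by almost flatness almost
  comes from \<open>Ann\<^sub>E(J) \<otimes> A\<^sub>\<infinity> = N\<^sub>g \<otimes> A\<^sub>\<infinity>\<close> and is therefore almost killed by the products of roots of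
  the \<open>g\<^sub>i\<close>.

  Since all top Cech cochains are cocycles, \<open>E\<close> is the union of the quotients of \<open>A\<close> by the ideals
  \<open>Q n\<close> generated by the \<open>n\<close>-th powers of the regular parameters. Matlis duality becomes the double
  annihilator property of these Gorenstein quotients, together with Chevalley's theorem and Krull's
  intersection theorem. That the parameters form a regular sequence follows from Krull's principal
  ideal theorem.
\<close>

section \<open>Ideals\<close>

text \<open>The annihilators are taken over all of \<open>E\<close>, but duality is available only
  on one level \<open>A / Q n\<close> at a time. Intersecting the annihilators of all levels could
  lose too much; Chevalley's theorem, which is where completeness enters, shows that modulo a fixed
  \<open>Q n\<close> a single level already cuts out the whole intersection. Krull's intersection
  theorem then recovers an ideal from its sums with all \<open>Q n\<close>. Every application of
  flatness loses a factor \<open>\<pi> i\<close>. As \<open>\<pi> k\<close> is the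
  \<open>p\<close>-th power of \<open>\<pi> (Suc k)\<close> and \<open>p\<close> is at least 2,
  finitely many such factors can be merged into one. The containment for powers needs more than the
  mixed one, since a product of \<open>a\<close> roots can be cut into two parts only at an integer.
  Going to deeper roots makes this rounding error small against \<open>\<epsilon> * p ^ e\<close>,
  so the slack built into \<open>tau\<close> absorbs it.\<close>

lemma module_self: "module ((*) :: 'a::comm_ring_1 \<Rightarrow> 'a \<Rightarrow> 'a)"
  by unfold_locales (auto simp: algebra_simps)

lemma is_ideal_iff:
  "is_ideal I \<longleftrightarrow> 0 \<in> I \<and> (\<forall>x\<in>I. \<forall>y\<in>I. x + y \<in> I) \<and> (\<forall>c. \<forall>x\<in>I. c * x \<in> I)"
  unfolding is_ideal_def module.subspace_def[OF module_self] ..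

lemma is_idealI:
  assumes "0 \<in> I" and "\<And>x y. x \<in> I \<Longrightarrow> y \<in> I \<Longrightarrow> x + y \<in> I" and "\<And>c x. x \<in> I \<Longrightarrow> c * x \<in> I"
  shows "is_ideal I"
  using assms by (auto simp: is_ideal_iff)

lemma ideal_0: "is_ideal I \<Longrightarrow> 0 \<in> I"
  and ideal_add: "is_ideal I \<Longrightarrow> x \<in> I \<Longrightarrow> y \<in> I \<Longrightarrow> x + y \<in> I"
  and ideal_times: "is_ideal I \<Longrightarrow> x \<in> I \<Longrightarrow> c * x \<in> I"
  by (auto simp: is_ideal_iff)

lemma ideal_times_right: "is_ideal I \<Longrightarrow> x \<in> I \<Longrightarrow> x * c \<in> I"
  using ideal_times[of I x c] by (simp add: mult.commute)

lemma ideal_minus: "is_ideal I \<Longrightarrow> x \<in> I \<Longrightarrow> - x \<in> I"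
  using ideal_times[of I x "- 1"] by simp

lemma ideal_diff: "is_ideal I \<Longrightarrow> x \<in> I \<Longrightarrow> y \<in> I \<Longrightarrow> x - y \<in> I"
  using ideal_add[of I x "- y"] ideal_minus[of I y] by simp

lemma ideal_sum: "is_ideal I \<Longrightarrow> (\<And>i. i \<in> A \<Longrightarrow> f i \<in> I) \<Longrightarrow> sum f A \<in> I"
  unfolding is_ideal_def by (rule module.subspace_sum[OF module_self])

lemma ideal_diff_cancel: "is_ideal I \<Longrightarrow> x - y \<in> I \<Longrightarrow> y \<in> I \<Longrightarrow> x \<in> I"
  using ideal_add[of I "x - y" y] by simp

lemma ideal_diff_cancel2: "is_ideal I \<Longrightarrow> x - y \<in> I \<Longrightarrow> x \<in> I \<Longrightarrow> y \<in> I"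
  using ideal_diff[of I x "x - y"] by simp

lemma ideal_eq_UNIV: "is_ideal I \<Longrightarrow> 1 \<in> I \<Longrightarrow> I = UNIV"
  using ideal_times[of I 1] by auto

lemma is_ideal_UNIV [simp]: "is_ideal UNIV"
  and is_ideal_zero [simp]: "is_ideal {0}"
  by (auto simp: is_ideal_iff)

lemma is_ideal_Inter: "(\<And>i. i \<in> A \<Longrightarrow> is_ideal (I i)) \<Longrightarrow> is_ideal (\<Inter>i\<in>A. I i)"
  by (auto simp: is_ideal_iff)

lemma is_ideal_Int: "is_ideal I \<Longrightarrow> is_ideal J \<Longrightarrow> is_ideal (I \<inter> J)"
  by (auto simp: is_ideal_iff)

lemma is_ideal_gen [simp]: "is_ideal (ideal_gen X)"
  unfolding is_ideal_def ideal_gen_def by (rule module.subspace_span[OF module_self])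

lemma ideal_gen_base: "x \<in> X \<Longrightarrow> x \<in> ideal_gen X"
  unfolding ideal_gen_def by (rule module.span_base[OF module_self])

lemma ideal_gen_least: "is_ideal I \<Longrightarrow> X \<subseteq> I \<Longrightarrow> ideal_gen X \<subseteq> I"
  unfolding is_ideal_def ideal_gen_def by (rule module.span_minimal[OF module_self])

lemma ideal_gen_mono: "X \<subseteq> Y \<Longrightarrow> ideal_gen X \<subseteq> ideal_gen Y"
  by (rule ideal_gen_least) (auto intro: ideal_gen_base)

lemma ideal_gen_self: "is_ideal I \<Longrightarrow> ideal_gen I = I"
  using ideal_gen_least[of I I] ideal_gen_base[of _ I] by auto

lemma ideal_gen_insert: "u \<in> ideal_gen (insert y X) \<longleftrightarrow> (\<exists>a. u - a * y \<in> ideal_gen X)"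
  unfolding ideal_gen_def module.span_insert[OF module_self] by simp

lemma ideal_gen_insert_ideal:
  "is_ideal I \<Longrightarrow> u \<in> ideal_gen (insert y I) \<longleftrightarrow> (\<exists>a. u - a * y \<in> I)"
  by (simp add: ideal_gen_insert ideal_gen_self)

lemma ideal_gen_finite:
  assumes "finite X" and "u \<in> ideal_gen X"
  obtains c where "u = (\<Sum>x\<in>X. c x * x)"
  using assms unfolding ideal_gen_def by (auto simp: module.span_finite[OF module_self])

text \<open>Coefficients are indexed by \<open>T\<close> and not by the values \<open>x i\<close>,
  so repeated values cause no trouble; the Cech differential and the linear systems below need this
  form.\<close>

lemma ideal_gen_image_finite:
  assumes "finite T"
  shows "u \<in> ideal_gen (x ` T) \<longleftrightarrow> (\<exists>c. u = (\<Sum>i\<in>T. c i * x i))"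
proof
  assume "u \<in> ideal_gen (x ` T)"
  with assms show "\<exists>c. u = (\<Sum>i\<in>T. c i * x i)"
  proof (induction T arbitrary: u rule: finite_induct)
    case empty
    then show ?case
      using ideal_gen_finite[of "{}" u] by simp
  next
    case (insert i T)
    then obtain a where "u - a * x i \<in> ideal_gen (x ` T)"
      by (auto simp: ideal_gen_insert)
    then obtain c where c: "u - a * x i = (\<Sum>i\<in>T. c i * x i)"
      using insert.IH by blast
    have "(\<Sum>k\<in>T. (c(i := a)) k * x k) = (\<Sum>k\<in>T. c k * x k)"
      using insert.hyps by (intro sum.cong) auto
    then have "u = (\<Sum>k\<in>insert i T. (c(i := a)) k * x k)"
      using c insert.hyps by (simp add: algebra_simps)
    then show ?case by blast
  qed
next
  assume "\<exists>c. u = (\<Sum>i\<in>T. c i * x i)"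
  then show "u \<in> ideal_gen (x ` T)"
    by (auto intro!: ideal_sum[OF is_ideal_gen] intro: ideal_times[OF is_ideal_gen] ideal_gen_base)
qed

text \<open>Moves one generator from the list into the ideal, for inductions that divide out the
  parameters one at a time.\<close>

lemma ideal_gen_absorb:
  "ideal_gen (ideal_gen (insert y J) \<union> X) = ideal_gen (J \<union> insert y X)"
proof (rule antisym)
  have "ideal_gen (insert y J) \<subseteq> ideal_gen (J \<union> insert y X)"
    by (intro ideal_gen_mono) auto
  then show "ideal_gen (ideal_gen (insert y J) \<union> X) \<subseteq> ideal_gen (J \<union> insert y X)"
    by (intro ideal_gen_least is_ideal_gen) (auto intro: ideal_gen_base)
  show "ideal_gen (J \<union> insert y X) \<subseteq> ideal_gen (ideal_gen (insert y J) \<union> X)"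
    by (intro ideal_gen_mono) (auto intro: ideal_gen_base)
qed

lemma ideal_gen_insert_gen: "ideal_gen (insert y (ideal_gen X)) = ideal_gen (insert y X)"
  by (auto simp: ideal_gen_insert ideal_gen_self)

lemma is_ideal_ideal_mult [simp]: "is_ideal (ideal_mult I J)"
  by (simp add: ideal_mult_def)

lemma ideal_mult_base: "x \<in> I \<Longrightarrow> y \<in> J \<Longrightarrow> x * y \<in> ideal_mult I J"
  unfolding ideal_mult_def by (rule ideal_gen_base) blast

lemma ideal_mult_least:
  "is_ideal K \<Longrightarrow> (\<And>x y. x \<in> I \<Longrightarrow> y \<in> J \<Longrightarrow> x * y \<in> K) \<Longrightarrow> ideal_mult I J \<subseteq> K"
  unfolding ideal_mult_def by (rule ideal_gen_least) auto

lemma is_ideal_ideal_pow [simp]: "is_ideal (ideal_pow I n)"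
  by (cases n) auto

lemma ideal_pow_Suc_subset: "ideal_pow I (Suc n) \<subseteq> ideal_pow I n"
  unfolding ideal_pow.simps by (intro ideal_mult_least is_ideal_ideal_pow ideal_times)

lemma ideal_pow_antimono: "i \<le> j \<Longrightarrow> ideal_pow I j \<subseteq> ideal_pow I i"
  by (induction j rule: dec_induct) (use ideal_pow_Suc_subset in blast)+

lemma power_in_ideal_pow: "x \<in> I \<Longrightarrow> x ^ n \<in> ideal_pow I n"
  by (induction n) (auto intro: ideal_mult_base)

section \<open>Sums of ideals and colon ideals\<close>

definition isum :: "'a::comm_ring_1 set \<Rightarrow> 'a set \<Rightarrow> 'a set" where
  "isum I J = {x + y | x y. x \<in> I \<and> y \<in> J}"

lemma is_ideal_isum:
  assumes "is_ideal I" and "is_ideal J"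
  shows "is_ideal (isum I J)"
proof (rule is_idealI)
  show "0 \<in> isum I J"
    unfolding isum_def using assms ideal_0 by force
next
  fix u v assume "u \<in> isum I J" and "v \<in> isum I J"
  then obtain a b c e where "u = a + b" "v = c + e" "a \<in> I" "c \<in> I" "b \<in> J" "e \<in> J"
    unfolding isum_def by blast
  then have "u + v = (a + c) + (b + e)" "a + c \<in> I" "b + e \<in> J"
    using assms by (auto intro: ideal_add)
  then show "u + v \<in> isum I J" unfolding isum_def by blast
next
  fix r u assume "u \<in> isum I J"
  then obtain a b where "u = a + b" "a \<in> I" "b \<in> J"
    unfolding isum_def by blast
  then have "r * u = r * a + r * b" "r * a \<in> I" "r * b \<in> J"
    using assms by (auto intro: ideal_times simp: distrib_left)
  then show "r * u \<in> isum I J" unfolding isum_def by blast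
qed

lemma isum_left: "is_ideal J \<Longrightarrow> I \<subseteq> isum I J"
  unfolding isum_def using ideal_0 by force

lemma isum_right: "is_ideal I \<Longrightarrow> J \<subseteq> isum I J"
  unfolding isum_def using ideal_0 by force

text \<open>Modulo an ideal \<open>I\<close> this is the annihilator of \<open>J\<close>. Allowing
  arbitrary sets \<open>J\<close> covers single elements and sets of generators.\<close>

definition colon :: "'a::comm_ring_1 set \<Rightarrow> 'a set \<Rightarrow> 'a set" where
  "colon I J = {c. \<forall>y\<in>J. y * c \<in> I}"

lemma is_ideal_colon: "is_ideal I \<Longrightarrow> is_ideal (colon I J)"
  by (rule is_idealI) (auto simp: colon_def ideal_0 ideal_add ideal_times distrib_left mult.left_commute)

lemma colon_superset: "is_ideal I \<Longrightarrow> I \<subseteq> colon I J"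
  by (auto simp: colon_def ideal_times)

lemma colon_antimono: "J \<subseteq> J' \<Longrightarrow> colon I J' \<subseteq> colon I J"
  by (auto simp: colon_def)

lemma colon_colon: "J \<subseteq> colon I (colon I J)"
  by (auto simp: colon_def mult.commute)

text \<open>For fixed \<open>c\<close>, the condition says that \<open>X\<close> lies in the ideal
  \<open>colon I {c}\<close>, and then so does the ideal generated by \<open>X\<close>.\<close>

lemma colon_ideal_gen: "is_ideal I \<Longrightarrow> colon I (ideal_gen X) = colon I X"
proof
  assume I: "is_ideal I"
  show "colon I X \<subseteq> colon I (ideal_gen X)"
  proof
    fix c assume "c \<in> colon I X"
    then have "X \<subseteq> colon I {c}" by (auto simp: colon_def mult.commute)
    then have "ideal_gen X \<subseteq> colon I {c}" by (intro ideal_gen_least is_ideal_colon I)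
    then show "c \<in> colon I (ideal_gen X)" by (auto simp: colon_def mult.commute)
  qed
qed (intro colon_antimono subsetI ideal_gen_base)

lemma prime_idealD:
  assumes "is_prime_ideal P"
  shows "is_ideal P" and "1 \<notin> P" and "x * y \<in> P \<Longrightarrow> x \<in> P \<or> y \<in> P"
  using assms ideal_eq_UNIV unfolding is_prime_ideal_def by blast+

lemma prime_ideal_power: "is_prime_ideal P \<Longrightarrow> x ^ n \<in> P \<Longrightarrow> x \<in> P"
  by (induction n) (auto dest: prime_idealD)

section \<open>Noetherian rings\<close>

text \<open>Zorn's lemma applies because the union of a chain is an ideal with finitely many
  generators, all of which already lie in one member of the chain.\<close>

lemma noetherian_maximal:
  fixes F :: "'a::comm_ring_1 set set"
  assumes noeth: "is_noetherian TYPE('a)" and F: "F \<noteq> {}" "\<And>I. I \<in> F \<Longrightarrow> is_ideal I"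
  obtains M where "M \<in> F" and "\<And>I. I \<in> F \<Longrightarrow> M \<subseteq> I \<Longrightarrow> I = M"
proof -
  have "\<exists>M\<in>F. \<forall>I\<in>F. M \<subseteq> I \<longrightarrow> I = M"
  proof (rule subset_Zorn_nonempty)
    fix C assume C: "C \<noteq> {}" "subset.chain F C"
    then have CF: "C \<subseteq> F" and cmp: "\<And>I J. I \<in> C \<Longrightarrow> J \<in> C \<Longrightarrow> I \<subseteq> J \<or> J \<subseteq> I"
      by (auto simp: subset_chain_def)
    have U: "is_ideal (\<Union>C)"
    proof (rule is_idealI)
      show "0 \<in> \<Union>C" using C CF F ideal_0 by blast
    next
      fix x y assume "x \<in> \<Union>C" "y \<in> \<Union>C"
      then obtain I where "I \<in> C" "x \<in> I" "y \<in> I" using cmp by blast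
      then show "x + y \<in> \<Union>C" using CF F ideal_add by blast
    next
      fix c x assume "x \<in> \<Union>C"
      then show "c * x \<in> \<Union>C" using CF F ideal_times by blast
    qed
    then obtain X where X: "finite X" "\<Union>C = ideal_gen X"
      using noeth unfolding is_noetherian_def by blast
    then have "X \<subseteq> \<Union>C" using ideal_gen_base by blast
    then obtain I where I: "I \<in> C" "X \<subseteq> I"
      using finite_subset_Union_chain[OF X(1) _ C(1), of F] C(2) by blast
    then have "\<Union>C \<subseteq> I" using X CF F ideal_gen_least by blast
    then have "\<Union>C = I" using I by blast
    then show "\<Union>C \<in> F" using I CF by blast
  qed (use F in auto)
  then show ?thesis using that by blast
qed

text \<open>An ideal maximal among those containing \<open>I\<close> and disjoint from
  \<open>M\<close> is prime: if it contained neither \<open>x\<close> nor \<open>y\<close>,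
  adjoining each of them would reach an element of \<open>M\<close>, and the product of these two
  elements would lie in the ideal once \<open>x * y\<close> does.\<close>

lemma prime_ideal_disjoint:
  fixes I :: "'a::comm_ring_1 set"
  assumes noeth: "is_noetherian TYPE('a)" and I: "is_ideal I" "I \<inter> M = {}"
    and M: "1 \<in> M" "\<And>x y. x \<in> M \<Longrightarrow> y \<in> M \<Longrightarrow> x * y \<in> M"
  obtains P where "is_prime_ideal P" and "I \<subseteq> P" and "P \<inter> M = {}"
proof -
  obtain P where "P \<in> {P. is_ideal P \<and> I \<subseteq> P \<and> P \<inter> M = {}}"
    and max: "\<And>Q. Q \<in> {P. is_ideal P \<and> I \<subseteq> P \<and> P \<inter> M = {}} \<Longrightarrow> P \<subseteq> Q \<Longrightarrow> Q = P"
    using I by (elim noetherian_maximal[OF noeth, rotated 2, of "{P. is_ideal P \<and> I \<subseteq> P \<and> P \<inter> M = {}}"]) auto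
  then have P: "is_ideal P" "I \<subseteq> P" "P \<inter> M = {}" by auto
  have meet: "\<exists>m\<in>M. \<exists>a. m - a * x \<in> P" if "x \<notin> P" for x
  proof (rule ccontr)
    assume "\<not> ?thesis"
    then have "ideal_gen (insert x P) \<inter> M = {}"
      by (auto simp: ideal_gen_insert_ideal P)
    moreover have "P \<subseteq> ideal_gen (insert x P)" "x \<in> ideal_gen (insert x P)"
      by (auto intro: ideal_gen_base)
    ultimately show False using max[of "ideal_gen (insert x P)"] P that by auto
  qed
  have "x \<in> P \<or> y \<in> P" if xy: "x * y \<in> P" for x y
  proof (rule ccontr)
    assume "\<not> ?thesis"
    then obtain m a m' b where m: "m \<in> M" "m - a * x \<in> P" "m' \<in> M" "m' - b * y \<in> P"
      using meet by blast
    have "m * m' = m * (m' - b * y) + (b * y) * (m - a * x) + (a * b) * (x * y)"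
      by (simp add: algebra_simps)
    then have "m * m' \<in> P" using m xy P by (metis ideal_add ideal_times)
    then show False using M m P by blast
  qed
  then have "is_prime_ideal P" using P M by (auto simp: is_prime_ideal_def)
  then show ?thesis using that P by blast
qed

section \<open>Saturation at a prime and Nakayama's lemma\<close>

text \<open>Ideals saturated at \<open>P\<close> correspond to the ideals of the localization at \<open>P\<close>; working with them
  avoids forming the localization as a type.\<close>

definition saturation :: "'a::comm_ring_1 set \<Rightarrow> 'a set \<Rightarrow> 'a set" where
  "saturation P I = {u. \<exists>s. s \<notin> P \<and> s * u \<in> I}"

definition saturated :: "'a::comm_ring_1 set \<Rightarrow> 'a set \<Rightarrow> bool" where
  "saturated P I \<longleftrightarrow> (\<forall>s u. s \<notin> P \<longrightarrow> s * u \<in> I \<longrightarrow> u \<in> I)"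

lemma saturatedD: "saturated P I \<Longrightarrow> s \<notin> P \<Longrightarrow> s * u \<in> I \<Longrightarrow> u \<in> I"
  by (auto simp: saturated_def)

lemma is_ideal_saturation:
  assumes P: "is_prime_ideal P" and I: "is_ideal I"
  shows "is_ideal (saturation P I)"
proof (rule is_idealI)
  show "0 \<in> saturation P I"
    unfolding saturation_def using prime_idealD(2)[OF P] ideal_0[OF I] by auto
next
  fix u v assume "u \<in> saturation P I" "v \<in> saturation P I"
  then obtain s t where st: "s \<notin> P" "t \<notin> P" "s * u \<in> I" "t * v \<in> I"
    by (auto simp: saturation_def)
  have "(s * t) * (u + v) = t * (s * u) + s * (t * v)" by (simp add: algebra_simps)
  then have "(s * t) * (u + v) \<in> I" using st I by (auto intro: ideal_add ideal_times)
  moreover have "s * t \<notin> P" using st prime_idealD(3)[OF P] by blast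
  ultimately show "u + v \<in> saturation P I" by (auto simp: saturation_def)
next
  fix c u assume "u \<in> saturation P I"
  then obtain s where "s \<notin> P" "s * u \<in> I" by (auto simp: saturation_def)
  then have "s \<notin> P" "s * (c * u) \<in> I" using ideal_times[OF I, of "s * u" c] by (auto simp: mult.left_commute)
  then show "c * u \<in> saturation P I" unfolding saturation_def by blast
qed

lemma saturation_superset: "is_prime_ideal P \<Longrightarrow> I \<subseteq> saturation P I"
  using prime_idealD(2) by (force simp: saturation_def)

lemma saturated_saturation: "is_prime_ideal P \<Longrightarrow> saturated P (saturation P I)"
  unfolding saturated_def
proof (intro allI impI)
  fix s u assume P: "is_prime_ideal P" and "s \<notin> P" "s * u \<in> saturation P I"
  then obtain t where "t \<notin> P" "(t * s) * u \<in> I" by (auto simp: saturation_def mult.assoc)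
  moreover have "t * s \<notin> P" using P \<open>s \<notin> P\<close> \<open>t \<notin> P\<close> prime_idealD(3) by blast
  ultimately show "u \<in> saturation P I" unfolding saturation_def by blast
qed

lemma saturation_mono: "I \<subseteq> J \<Longrightarrow> saturation P I \<subseteq> saturation P J"
  by (auto simp: saturation_def)

lemma saturation_least: "I \<subseteq> J \<Longrightarrow> saturated P J \<Longrightarrow> saturation P I \<subseteq> J"
  by (auto simp: saturation_def saturated_def)

text \<open>Nakayama's lemma for the localization at \<open>P\<close>, by eliminating generators: in
  the relation for \<open>y\<close> the coefficient \<open>s - c y\<close> stays outside
  \<open>P\<close>, so \<open>y\<close> can be substituted into the other relations, which keep the
  required form.\<close>

lemma nakayama_saturation:
  assumes P: "is_prime_ideal P" and M: "is_ideal M" and "finite Y"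
    and "\<And>y. y \<in> Y \<Longrightarrow> \<exists>s c. s \<notin> P \<and> (\<forall>z\<in>Y. c z \<in> P) \<and> s * y - (\<Sum>z\<in>Y. c z * z) \<in> M"
  shows "Y \<subseteq> saturation P M"
  using assms(3,4)
proof (induction Y rule: finite_induct)
  case (insert y Y)
  obtain s c where sc: "s \<notin> P" "\<forall>z\<in>insert y Y. c z \<in> P" "s * y - (\<Sum>z\<in>insert y Y. c z * z) \<in> M"
    using insert.prems[of y] by auto
  define u where "u = s - c y"
  have u: "u \<notin> P" using sc ideal_diff_cancel[OF prime_idealD(1)[OF P]] by (auto simp: u_def)
  have uy: "u * y - (\<Sum>z\<in>Y. c z * z) \<in> M"
    using sc(3) insert.hyps by (simp add: u_def algebra_simps)
  have Y: "Y \<subseteq> saturation P M"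
  proof (rule insert.IH)
    fix v assume "v \<in> Y"
    then obtain t e where te: "t \<notin> P" "\<forall>z\<in>insert y Y. e z \<in> P" "t * v - (\<Sum>z\<in>insert y Y. e z * z) \<in> M"
      using insert.prems[of v] by auto
    have "(u * t) * v - (\<Sum>z\<in>Y. (e y * c z + u * e z) * z)
        = u * (t * v - (\<Sum>z\<in>insert y Y. e z * z)) + e y * (u * y - (\<Sum>z\<in>Y. c z * z))"
      using insert.hyps by (simp add: algebra_simps sum.distrib sum_distrib_left)
    then have "(u * t) * v - (\<Sum>z\<in>Y. (e y * c z + u * e z) * z) \<in> M"
      using te uy M by (simp add: ideal_add ideal_times)
    moreover have "u * t \<notin> P" using u te prime_idealD(3)[OF P] by blast
    moreover have "\<forall>z\<in>Y. e y * c z + u * e z \<in> P"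
      using sc te prime_idealD(1)[OF P] by (auto intro: ideal_add ideal_times)
    ultimately show "\<exists>s c. s \<notin> P \<and> (\<forall>z\<in>Y. c z \<in> P) \<and> s * v - (\<Sum>z\<in>Y. c z * z) \<in> M"
      by (intro exI[of _ "u * t"] exI[of _ "\<lambda>z. e y * c z + u * e z"]) auto
  qed
  have sat: "is_ideal (saturation P M)" by (rule is_ideal_saturation[OF P M])
  have "(\<Sum>z\<in>Y. c z * z) \<in> saturation P M"
    using Y sat by (intro ideal_sum ideal_times) auto
  then have "u * y \<in> saturation P M"
    using uy saturation_superset[OF P, of M] by (auto intro: ideal_diff_cancel[OF sat])
  then have "y \<in> saturation P M"
    using u saturated_saturation[OF P] by (auto dest: saturatedD)
  then show ?case using Y by auto
qed auto

text \<open>The form of Nakayama's lemma in use: locally at \<open>P\<close>, the ideal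
  \<open>N\<close> is contained in \<open>x * N + M\<close> with \<open>x\<close> in
  \<open>P\<close>.\<close>

lemma nakayama_principal:
  fixes N :: "'a::comm_ring_1 set"
  assumes noeth: "is_noetherian TYPE('a)" and P: "is_prime_ideal P" and "is_ideal M" "is_ideal N" "x \<in> P"
    and step: "\<And>u. u \<in> N \<Longrightarrow> \<exists>s a. s \<notin> P \<and> a \<in> N \<and> s * u - a * x \<in> M"
  shows "N \<subseteq> saturation P M"
proof -
  obtain Y where Y: "finite Y" "N = ideal_gen Y"
    using noeth \<open>is_ideal N\<close> unfolding is_noetherian_def by blast
  have "Y \<subseteq> saturation P M"
  proof (rule nakayama_saturation[OF P \<open>is_ideal M\<close> Y(1)])
    fix y assume "y \<in> Y"
    then obtain s a where sa: "s \<notin> P" "a \<in> N" "s * y - a * x \<in> M"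
      using step[of y] Y ideal_gen_base by blast
    then obtain c where "a = (\<Sum>z\<in>Y. c z * z)" using ideal_gen_finite[OF Y(1), of a] Y(2) by blast
    then have "a * x = (\<Sum>z\<in>Y. (c z * x) * z)" by (simp add: sum_distrib_left sum_distrib_right mult_ac)
    then show "\<exists>s c. s \<notin> P \<and> (\<forall>z\<in>Y. c z \<in> P) \<and> s * y - (\<Sum>z\<in>Y. c z * z) \<in> M"
      using sa \<open>x \<in> P\<close> prime_idealD(1)[OF P]
      by (intro exI[of _ s] exI[of _ "\<lambda>z. c z * x"]) (auto intro: ideal_times)
  qed
  then show ?thesis
    unfolding Y(2) by (intro ideal_gen_least is_ideal_saturation[OF P \<open>is_ideal M\<close>])
qed

section \<open>Composition series\<close>

text \<open>\<open>simple_step P D E\<close>: after localization at \<open>P\<close>, the quotient \<open>E/D\<close> is zero or simple.\<close>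

definition simple_step :: "'a::comm_ring_1 set \<Rightarrow> 'a set \<Rightarrow> 'a set \<Rightarrow> bool" where
  "simple_step P D E \<longleftrightarrow>
     D \<subseteq> E \<and> (\<forall>u\<in>E - D. \<forall>v\<in>E. \<exists>s a. s \<notin> P \<and> s * v - a * u \<in> D)"

definition comp_series :: "'a::comm_ring_1 set \<Rightarrow> 'a set \<Rightarrow> (nat \<Rightarrow> 'a set) \<Rightarrow> nat \<Rightarrow> bool" where
  "comp_series P I K l \<longleftrightarrow>
     K 0 = I \<and> K l = UNIV \<and> (\<forall>i\<le>l. is_ideal (K i) \<and> saturated P (K i)) \<and>
     (\<forall>i<l. simple_step P (K i) (K (Suc i)) \<and> \<not> K (Suc i) \<subseteq> K i)"

text \<open>The number of jumps of an ideal \<open>C\<close> along a composition series from \<open>I\<close> is the length of \<open>C/I\<close>.\<close>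

definition jumps :: "(nat \<Rightarrow> 'a set) \<Rightarrow> nat \<Rightarrow> 'a set \<Rightarrow> nat set" where
  "jumps K l C = {i. i < l \<and> \<not> C \<inter> K (Suc i) \<subseteq> K i}"

lemma finite_jumps [simp]: "finite (jumps K l C)"
  by (simp add: jumps_def)

lemma jumps_mono: "C \<subseteq> C' \<Longrightarrow> jumps K l C \<subseteq> jumps K l C'"
  by (auto simp: jumps_def)

text \<open>Induction along the series: for \<open>v\<close> in \<open>C'\<close> at a jump, the
  inclusion of jumps supplies \<open>u\<close> in \<open>C\<close> at the same place. Simplicity of
  the step moves some \<open>s * v - a * u\<close> one place down, where the induction hypothesis
  puts it into \<open>C\<close>.\<close>

lemma jumps_strict:
  assumes K: "comp_series P I K l" and C: "is_ideal C" "saturated P C" "I \<subseteq> C"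
    and C': "is_ideal C'" "C \<subseteq> C'" and j: "jumps K l C' \<subseteq> jumps K l C"
  shows "C' \<subseteq> C"
proof -
  have "C' \<inter> K i \<subseteq> C" if "i \<le> l" for i
    using that
  proof (induction i)
    case 0
    then show ?case using K C by (auto simp: comp_series_def)
  next
    case (Suc i)
    show ?case
    proof
      fix v assume v: "v \<in> C' \<inter> K (Suc i)"
      have Ki: "is_ideal (K i)" using K Suc by (simp add: comp_series_def)
      show "v \<in> C"
      proof (cases "v \<in> K i")
        case False
        then have "i \<in> jumps K l C'" using v Suc by (auto simp: jumps_def)
        then obtain u where u: "u \<in> C" "u \<in> K (Suc i)" "u \<notin> K i"
          using j by (auto simp: jumps_def)
        have "simple_step P (K i) (K (Suc i))" using K Suc by (simp add: comp_series_def)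
        then obtain s a where sa: "s \<notin> P" "s * v - a * u \<in> K i"
          using u v unfolding simple_step_def by blast
        have "s * v - a * u \<in> C'" using u v C' by (auto intro: ideal_diff ideal_times)
        then have "s * v - a * u \<in> C" using sa Suc by auto
        then have "s * v \<in> C" using u C by (auto intro: ideal_diff_cancel ideal_times)
        then show ?thesis using sa C by (auto dest: saturatedD)
      qed (use v Suc in auto)
    qed
  qed
  from this[of l] show ?thesis using K by (auto simp: comp_series_def)
qed

text \<open>Suppose two jumps \<open>i < i'\<close> were new, with witnesses \<open>u\<close> and
  \<open>u'\<close>. As \<open>C' / C\<close> is locally simple, some \<open>s * u' - a * u\<close>
  lies in \<open>C\<close>; since \<open>C\<close> does not jump at \<open>i'\<close> and
  \<open>u\<close> lies in \<open>K i'\<close>, so would \<open>u'\<close>.\<close>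

lemma card_jumps_simple_step:
  assumes P: "is_prime_ideal P" and K: "comp_series P I K l"
    and C: "is_ideal C" "is_ideal C'" "simple_step P C C'"
  shows "card (jumps K l C') \<le> card (jumps K l C) + 1"
proof -
  have "i = i'" if i: "i \<in> jumps K l C' - jumps K l C" "i' \<in> jumps K l C' - jumps K l C" "i \<le> i'" for i i'
  proof (rule ccontr)
    assume "i \<noteq> i'"
    then have less: "i < i'" using i by simp
    obtain u u' where u: "u \<in> C'" "u \<in> K (Suc i)" "u \<notin> K i" "u' \<in> C'" "u' \<in> K (Suc i')" "u' \<notin> K i'"
      using i by (auto simp: jumps_def)
    have il: "i' < l" using i by (auto simp: jumps_def)
    have chain: "K (Suc i) \<subseteq> K (Suc i + n)" if "Suc i + n \<le> l" for n
      using that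
    proof (induction n)
      case (Suc n)
      have "K (Suc i + n) \<subseteq> K (Suc (Suc i + n))"
        using K Suc.prems by (simp add: comp_series_def simple_step_def)
      then show ?case using Suc by simp
    qed simp
    have "u \<in> K i'" using chain[of "i' - Suc i"] less il u by auto
    have "u \<notin> C" using i u by (auto simp: jumps_def)
    then obtain s a where sa: "s \<notin> P" "s * u' - a * u \<in> C"
      using C(3) u unfolding simple_step_def by blast
    have K': "is_ideal (K i')" "saturated P (K i')" "is_ideal (K (Suc i'))" "K i' \<subseteq> K (Suc i')"
      using K il by (auto simp: comp_series_def simple_step_def)
    have "s * u' - a * u \<in> K (Suc i')"
      using K' u \<open>u \<in> K i'\<close> by (auto intro: ideal_diff ideal_times)
    then have "s * u' - a * u \<in> K i'" using sa i by (auto simp: jumps_def)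
    then have "s * u' \<in> K i'" using \<open>u \<in> K i'\<close> K' by (auto intro: ideal_diff_cancel ideal_times)
    then show False using u sa K' by (auto dest: saturatedD)
  qed
  then have "\<forall>i\<in>jumps K l C' - jumps K l C. \<forall>i'\<in>jumps K l C' - jumps K l C. i = i'"
    by (metis nle_le)
  then have "card (jumps K l C' - jumps K l C) \<le> 1"
    by (simp add: card_le_Suc0_iff_eq)
  moreover have "card (jumps K l C') \<le> card (jumps K l C \<union> (jumps K l C' - jumps K l C))"
    by (intro card_mono) auto
  ultimately show ?thesis
    using card_Un_le[of "jumps K l C" "jumps K l C' - jumps K l C"] by linarith
qed

text \<open>Among the products \<open>x ^ n * y\<close> take the last one outside \<open>K\<close>.
  The result is a socle element of the quotient by \<open>K\<close>, from which composition series
  are built.\<close>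

lemma annihilated_element:
  assumes K: "is_ideal K" "1 \<notin> K" and "finite X" and "\<And>x. x \<in> X \<Longrightarrow> \<exists>k. x ^ k \<in> K"
  shows "\<exists>y. y \<notin> K \<and> (\<forall>x\<in>X. x * y \<in> K)"
  using assms(3,4)
proof (induction X rule: finite_induct)
  case (insert x X)
  then obtain y where y: "y \<notin> K" "\<forall>x\<in>X. x * y \<in> K" by auto
  obtain k where "x ^ k \<in> K" using insert.prems by blast
  then have k: "x ^ k * y \<in> K" using K by (auto intro: ideal_times_right)
  define n where "n = (LEAST n. x ^ n * y \<in> K)"
  have n: "x ^ n * y \<in> K" unfolding n_def using k by (rule LeastI)
  then obtain n' where n': "n = Suc n'" using y by (cases n) auto
  have "x ^ n' * y \<notin> K" using not_less_Least[of n' "\<lambda>n. x ^ n * y \<in> K"] n' n_def by auto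
  moreover have "x * (x ^ n' * y) \<in> K" using n n' by (simp add: mult_ac)
  moreover have "z * (x ^ n' * y) \<in> K" if "z \<in> X" for z
    using ideal_times[OF K(1), of "z * y" "x ^ n'"] y that by (simp add: mult.left_commute)
  ultimately show ?case by auto
qed (use K in auto)

text \<open>Noetherian induction: above a maximal counterexample \<open>M\<close>, a socle element
  \<open>y\<close> generates an ideal \<open>N\<close> whose quotient by \<open>M\<close> is locally
  simple, and a series starting at \<open>N\<close> is prolonged by \<open>M\<close>.\<close>

lemma comp_series_exists:
  fixes P :: "'a::comm_ring_1 set"
  assumes noeth: "is_noetherian TYPE('a)" and P: "is_prime_ideal P" and I: "is_ideal I" "saturated P I"
    and X: "finite X" "P = ideal_gen X" "\<And>x. x \<in> X \<Longrightarrow> \<exists>k. x ^ k \<in> I"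
  obtains K l where "comp_series P I K l"
proof -
  define F where "F = {M. is_ideal M \<and> saturated P M \<and> I \<subseteq> M \<and> \<not> (\<exists>K l. comp_series P M K l)}"
  have "F = {}"
  proof (rule ccontr)
    assume "F \<noteq> {}"
    then obtain M where "M \<in> F" and max: "\<And>N. N \<in> F \<Longrightarrow> M \<subseteq> N \<Longrightarrow> N = M"
      by (elim noetherian_maximal[OF noeth, of F]) (auto simp: F_def)
    then have M: "is_ideal M" "saturated P M" "I \<subseteq> M" "\<nexists>K l. comp_series P M K l"
      by (auto simp: F_def)
    have "1 \<notin> M"
    proof
      assume "1 \<in> M"
      then have "comp_series P M (\<lambda>_. M) 0"
        using M ideal_eq_UNIV[of M] by (simp add: comp_series_def)
      then show False using M by blast
    qed
    moreover have "\<exists>k. x ^ k \<in> M" if "x \<in> X" for x using that X(3) M(3) by blast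
    ultimately obtain y where y: "y \<notin> M" "\<forall>x\<in>X. x * y \<in> M"
      using annihilated_element[OF M(1) _ X(1)] by blast
    have "P \<subseteq> colon M {y}"
      unfolding X(2) using y M by (intro ideal_gen_least is_ideal_colon) (auto simp: colon_def mult.commute)
    then have Py: "a * y \<in> M" if "a \<in> P" for a using that by (auto simp: colon_def mult.commute)
    define N where "N = saturation P (ideal_gen (insert y M))"
    have "insert y M \<subseteq> N"
      unfolding N_def using ideal_gen_base by (intro order_trans[OF _ saturation_superset[OF P]]) blast
    then have N: "is_ideal N" "saturated P N" "M \<subseteq> N" "y \<in> N"
      unfolding N_def using P by (auto intro!: is_ideal_saturation saturated_saturation)
    have "simple_step P M N"
      unfolding simple_step_def
    proof (intro conjI ballI N)
      fix u v assume "u \<in> N - M" "v \<in> N"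
      then obtain s a t b where *: "s \<notin> P" "s * u - a * y \<in> M" "t \<notin> P" "t * v - b * y \<in> M" "u \<notin> M"
        by (auto simp: N_def saturation_def ideal_gen_insert_ideal M)
      \<comment> \<open>Otherwise \<open>a * y\<close> would lie in \<open>M\<close>, hence so would
        \<open>s * u\<close> and, by saturation, \<open>u\<close>.\<close>
      have "a \<notin> P"
        using * Py[of a] M ideal_diff_cancel[of M "s * u" "a * y"] saturatedD[OF M(2)] by blast
      moreover have "(a * t) * v - (b * s) * u = a * (t * v - b * y) - b * (s * u - a * y)"
        by (simp add: algebra_simps)
      then have "(a * t) * v - (b * s) * u \<in> M"
        using * M by (simp add: ideal_diff ideal_times)
      ultimately show "\<exists>s a. s \<notin> P \<and> s * v - a * u \<in> M"
        using * prime_idealD(3)[OF P] by blast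
    qed
    moreover have "N \<notin> F" using max[of N] N y by blast
    then obtain K l where K: "comp_series P N K l" using N M by (auto simp: F_def)
    moreover have "\<not> N \<subseteq> M" using N y by blast
    ultimately have "comp_series P M (case_nat M K) (Suc l)"
      using M K unfolding comp_series_def less_Suc_eq_le[symmetric] All_less_Suc2 by auto
    then show False using M by blast
  qed
  then show ?thesis using that I by (auto simp: F_def)
qed

text \<open>Finite length gives the descending chain condition: a member with the fewest jumps
  cannot shrink any further.\<close>

lemma descending_chain_stabilizes:
  assumes K: "comp_series P I K l" and C: "\<And>n. is_ideal (C n)" "\<And>n. saturated P (C n)" "\<And>n. I \<subseteq> C n"
    and dec: "\<And>i j. i \<le> j \<Longrightarrow> C j \<subseteq> C i"
  shows "\<exists>n. \<forall>k\<ge>n. C k = C n"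
proof -
  define n where "n = (ARG_MIN (\<lambda>n. card (jumps K l (C n))) n. True)"
  have min: "card (jumps K l (C n)) \<le> card (jumps K l (C k))" for k
    unfolding n_def by (rule arg_min_nat_le) simp
  have "C k = C n" if "k \<ge> n" for k
  proof -
    have "jumps K l (C k) \<subseteq> jumps K l (C n)" using dec[OF that] by (rule jumps_mono)
    then have "jumps K l (C k) = jumps K l (C n)" using min by (intro card_seteq) auto
    then have "C n \<subseteq> C k" using jumps_strict[OF K C(1) C(2) C(3) C(1)] dec[OF that] by simp
    then show ?thesis using dec[OF that] by blast
  qed
  then show ?thesis by blast
qed

section \<open>Krull's principal ideal theorem\<close>

text \<open>If no such prime existed, \<open>P2\<close> would be minimal over \<open>P0\<close> and
  \<open>x\<close>, so the quotient by them would be artinian at \<open>P2\<close>. Then the ideals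
  \<open>D n\<close> below, enlarged by \<open>x\<close>, become stationary, and Nakayama's lemma
  removes \<open>x\<close>, which contradicts the strict inclusion of \<open>P0\<close> in
  \<open>P1\<close>.\<close>

lemma krull_principal_ideal:
  fixes P0 :: "'a::comm_ring_1 set"
  assumes noeth: "is_noetherian TYPE('a)"
    and P: "is_prime_ideal P0" "is_prime_ideal P1" "is_prime_ideal P2" "P0 \<subset> P1" "P1 \<subset> P2"
    and x: "x \<in> P2"
  obtains P where "is_prime_ideal P" and "P0 \<subset> P" and "P \<subset> P2" and "x \<in> P"
proof (rule ccontr)
  assume "\<not> thesis"
  then have no: "\<not> (is_prime_ideal P \<and> P0 \<subset> P \<and> P \<subset> P2 \<and> x \<in> P)" for P
    using that by blast
  have x1: "x \<notin> P1" using no[of P1] P by blast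
  define I0 where "I0 = ideal_gen (insert x P0)"
  have I0: "is_ideal I0" "P0 \<subseteq> I0" "x \<in> I0" by (auto simp: I0_def intro: ideal_gen_base)
  have powers: "\<exists>k. y ^ k \<in> saturation P2 I0" if y: "y \<in> P2" for y
  proof (rule ccontr)
    assume *: "\<not> ?thesis"
    \<comment> \<open>A prime disjoint from this multiplicative set lies inside \<open>P2\<close>
      and omits \<open>y\<close>, so it is strictly smaller than \<open>P2\<close>.\<close>
    define M where "M = {s * y ^ k | s k. s \<notin> P2}"
    have inM: "s * y ^ k \<in> M" if "s \<notin> P2" for s k using that unfolding M_def by blast
    have one: "1 \<notin> P2" using prime_idealD(2)[OF P(3)] .
    have "I0 \<inter> M = {}" using * by (auto simp: M_def saturation_def)
    moreover have "1 \<in> M"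
      using inM[OF one, of 0] by simp
    moreover have "u * v \<in> M" if uv: "u \<in> M" "v \<in> M" for u v
    proof -
      obtain s k t l where "u = s * y ^ k" "v = t * y ^ l" "s \<notin> P2" "t \<notin> P2"
        using uv unfolding M_def by blast
      then have "u * v = (s * t) * y ^ (k + l)" "s * t \<notin> P2"
        using prime_idealD(3)[OF P(3)] by (auto simp: power_add mult_ac)
      then show ?thesis unfolding M_def by blast
    qed
    ultimately obtain Q where Q: "is_prime_ideal Q" "I0 \<subseteq> Q" "Q \<inter> M = {}"
      using prime_ideal_disjoint[OF noeth I0(1)] by blast
    have "s \<in> M" if "s \<notin> P2" for s
      using inM[OF that, of 0] by simp
    then have "Q \<subseteq> P2" using Q by blast
    moreover have "y \<in> M"
      using inM[OF one, of 1] by simp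
    then have "y \<notin> Q" using Q by blast
    ultimately show False using no[of Q] Q I0 P x1 y by blast
  qed
  define I where "I = saturation P2 I0"
  have I: "is_ideal I" "saturated P2 I"
    unfolding I_def using P I0 by (auto intro: is_ideal_saturation saturated_saturation)
  obtain X where X: "finite X" "P2 = ideal_gen X"
    using noeth prime_idealD(1)[OF P(3)] unfolding is_noetherian_def by blast
  obtain K l where K: "comp_series P2 I K l"
    using comp_series_exists[OF noeth P(3) I X] powers X ideal_gen_base[of _ X] unfolding I_def by blast
  obtain q where q: "q \<in> P1" "q \<notin> P0" using P by blast
  \<comment> \<open>The usual proof has the symbolic powers of \<open>P1\<close> here. Powers of a
    single \<open>q\<close> suffice: \<open>q ^ n\<close> in \<open>D (Suc n)\<close> means that
    some \<open>(s - a * q) * q ^ n\<close> with \<open>s\<close> outside \<open>P1\<close> lies in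
    \<open>P0\<close>.\<close>
  define D where "D n = saturation P1 (ideal_gen (insert (q ^ n) P0))" for n :: nat
  define C where "C n = saturation P2 (ideal_gen (insert x (D n)))" for n :: nat
  have D: "is_ideal (D n)" "saturated P1 (D n)" "P0 \<subseteq> D n" "q ^ n \<in> D n" for n
  proof -
    have "insert (q ^ n) P0 \<subseteq> D n"
      unfolding D_def using ideal_gen_base by (intro order_trans[OF _ saturation_superset[OF P(2)]]) blast
    then show "is_ideal (D n)" "saturated P1 (D n)" "P0 \<subseteq> D n" "q ^ n \<in> D n"
      unfolding D_def using P by (auto intro!: is_ideal_saturation saturated_saturation)
  qed
  have Dstep: "D (Suc n) \<subseteq> D n" for n
    unfolding D_def
  proof (intro saturation_mono ideal_gen_least)
    show "insert (q ^ Suc n) P0 \<subseteq> ideal_gen (insert (q ^ n) P0)"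
    proof
      fix v assume "v \<in> insert (q ^ Suc n) P0"
      then consider "v = q * q ^ n" | "v \<in> P0" by auto
      then show "v \<in> ideal_gen (insert (q ^ n) P0)"
      proof cases
        case 1
        then show ?thesis by (simp only:) (intro ideal_times is_ideal_gen ideal_gen_base insertI1)
      next
        case 2
        then show ?thesis by (intro ideal_gen_base insertI2)
      qed
    qed
  qed simp
  have C: "is_ideal (C n)" "saturated P2 (C n)" "I \<subseteq> C n" for n
  proof -
    show "is_ideal (C n)" "saturated P2 (C n)"
      unfolding C_def using P(3) by (simp_all add: is_ideal_saturation saturated_saturation)
    show "I \<subseteq> C n"
      unfolding C_def I_def I0_def using D(3)[of n] by (intro saturation_mono ideal_gen_mono) blast
  qed
  have dec: "C j \<subseteq> C i" if "i \<le> j" for i j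
    using that
  proof (induction j rule: dec_induct)
    case (step j)
    have "C (Suc j) \<subseteq> C j"
      unfolding C_def using Dstep[of j] by (intro saturation_mono ideal_gen_mono) auto
    then show ?case using step by blast
  qed simp
  obtain n where stable: "\<forall>k\<ge>n. C k = C n"
    using descending_chain_stabilizes[where C = C, OF K C dec] by blast
  have n: "C (Suc n) = C n" by (rule stable[rule_format]) simp
  \<comment> \<open>The cofactor \<open>a\<close> of \<open>x\<close> lies in \<open>D n\<close>
    because \<open>x\<close> is outside \<open>P1\<close> and \<open>D n\<close> is saturated at
    \<open>P1\<close>; so \<open>D n\<close> is locally contained in
    \<open>x * D n + D (Suc n)\<close>.\<close>
  have "D n \<subseteq> saturation P2 (D (Suc n))"
  proof (rule nakayama_principal[OF noeth P(3) D(1) D(1) x])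
    fix u assume u: "u \<in> D n"
    then have "u \<in> C n"
      unfolding C_def using saturation_superset[OF P(3)] ideal_gen_base[of u "insert x (D n)"] by blast
    then obtain s a where sa: "s \<notin> P2" "s * u - a * x \<in> D (Suc n)"
      unfolding n[symmetric] by (auto simp: C_def saturation_def ideal_gen_insert_ideal D)
    then have "x * a \<in> D n"
      using Dstep[of n] u D by (metis ideal_diff_cancel2 ideal_times mult.commute subsetD)
    then have "a \<in> D n" using D(2) x1 by (rule saturatedD[rotated 2])
    then show "\<exists>s a. s \<notin> P2 \<and> a \<in> D n \<and> s * u - a * x \<in> D (Suc n)" using sa by blast
  qed
  also have "\<dots> \<subseteq> D (Suc n)"
    using D(2)[of "Suc n"] P by (auto simp: saturation_def saturated_def)
  finally have "q ^ n \<in> D (Suc n)" using D(4) by blast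
  then obtain s a where sa: "s \<notin> P1" "s * q ^ n - a * q ^ Suc n \<in> P0"
    by (auto simp: D_def saturation_def ideal_gen_insert_ideal[OF prime_idealD(1)[OF P(1)]])
  have "s * q ^ n - a * q ^ Suc n = (s - a * q) * q ^ n" by (simp add: algebra_simps)
  then have "s - a * q \<in> P0" using sa q P prime_idealD(3) prime_ideal_power by metis
  then have "s \<in> P1"
    using P q by (meson ideal_diff_cancel ideal_times prime_idealD(1) psubsetD)
  then show False using sa by blast
qed

section \<open>Chains of prime ideals\<close>

inductive prime_chain :: "'a::comm_ring_1 set \<Rightarrow> 'a set \<Rightarrow> nat \<Rightarrow> bool" where
  refl: "is_prime_ideal P \<Longrightarrow> prime_chain P P 0"
| step: "prime_chain P Q k \<Longrightarrow> is_prime_ideal R \<Longrightarrow> Q \<subset> R \<Longrightarrow> prime_chain P R (Suc k)"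

lemma prime_chain_0: "prime_chain P Q 0 \<longleftrightarrow> is_prime_ideal P \<and> Q = P"
  by (subst prime_chain.simps) auto

lemma prime_chain_Suc:
  "prime_chain P R (Suc k) \<longleftrightarrow> (\<exists>Q. prime_chain P Q k \<and> is_prime_ideal R \<and> Q \<subset> R)"
  by (subst prime_chain.simps) auto

lemma prime_chain_primes: "prime_chain P Q k \<Longrightarrow> is_prime_ideal P \<and> is_prime_ideal Q"
  by (induction rule: prime_chain.induct) auto

lemma prime_chain_first: "prime_chain P R (Suc k) \<Longrightarrow> \<exists>Q. P \<subset> Q \<and> prime_chain Q R k"
proof (induction k arbitrary: R)
  case 0
  then show ?case by (auto simp: prime_chain_Suc prime_chain_0)
next
  case (Suc k)
  from Suc.prems obtain Q where "prime_chain P Q (Suc k)" "is_prime_ideal R" "Q \<subset> R"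
    unfolding prime_chain_Suc by blast
  then show ?case using Suc.IH[of Q] by (blast intro: prime_chain.step)
qed

text \<open>Exchange downwards from the top: Krull's theorem replaces the prime just below
  \<open>R\<close> by one containing \<open>x\<close>, and the induction hypothesis treats the chain
  that ends there.\<close>

lemma prime_chain_through:
  fixes P :: "'a::comm_ring_1 set"
  assumes noeth: "is_noetherian TYPE('a)"
  shows "prime_chain P R (Suc k) \<Longrightarrow> x \<in> R \<Longrightarrow> \<exists>Q. P \<subset> Q \<and> x \<in> Q \<and> prime_chain Q R k"
proof (induction k arbitrary: R)
  case 0
  then show ?case by (auto simp: prime_chain_Suc prime_chain_0)
next
  case (Suc k)
  from Suc.prems obtain Q where Q: "prime_chain P Q (Suc k)" "is_prime_ideal R" "Q \<subset> R"
    unfolding prime_chain_Suc by blast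
  from Q(1) obtain Q' where Q': "prime_chain P Q' k" "is_prime_ideal Q" "Q' \<subset> Q"
    unfolding prime_chain_Suc by blast
  obtain Q'' where Q'': "is_prime_ideal Q''" "Q' \<subset> Q''" "Q'' \<subset> R" "x \<in> Q''"
    using krull_principal_ideal[OF noeth _ Q'(2) Q(2) Q'(3) Q(3) Suc.prems(2)] prime_chain_primes[OF Q'(1)]
    by blast
  then have "prime_chain P Q'' (Suc k)" using Q'(1) by (blast intro: prime_chain.step)
  then obtain S where "P \<subset> S" "x \<in> S" "prime_chain S Q'' k" using Suc.IH Q''(4) by blast
  then show ?case using prime_chain.step[of S Q'' k R] Q(2) Q''(3) by blast
qed

section \<open>Regular local rings\<close>

lemma local_ring_unit:
  assumes "is_local_ring m" and "a \<notin> m"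
  obtains b where "b * a = 1"
proof -
  have "ideal_gen {a} = UNIV"
    using assms ideal_gen_base[of a "{a}"] unfolding is_local_ring_def by (metis is_ideal_gen singletonI subsetD)
  then have "1 \<in> ideal_gen (insert a {})" by simp
  then show ?thesis using that ideal_gen_finite[of "{a}" 1] by auto
qed

lemma local_ring_prime:
  assumes m: "is_local_ring m"
  shows "is_prime_ideal m"
proof -
  have "y \<in> m" if xy: "x * y \<in> m" "x \<notin> m" for x y
  proof -
    obtain b where "b * x = 1" using local_ring_unit[OF m xy(2)] by blast
    then have "y = b * (x * y)" by (simp flip: mult.assoc)
    moreover have "b * (x * y) \<in> m" using m xy by (auto simp: is_local_ring_def intro: ideal_times)
    ultimately show ?thesis by simp
  qed
  then show ?thesis using m unfolding is_prime_ideal_def is_local_ring_def by blast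
qed

lemma local_ring_saturated:
  assumes m: "is_local_ring m" and I: "is_ideal I"
  shows "saturated m I"
  unfolding saturated_def
proof (intro allI impI)
  fix s u assume "s \<notin> m" "s * u \<in> I"
  then obtain b where "b * s = 1" using local_ring_unit[OF m] by blast
  then have "u = b * (s * u)" by (simp flip: mult.assoc)
  then show "u \<in> I" using ideal_times[OF I \<open>s * u \<in> I\<close>, of b] by simp
qed

text \<open>With \<open>J = {0}\<close>, this is why a regular local ring is a domain: a chain of
  the maximal possible length must begin at \<open>J\<close> itself. By exchange, the second prime
  may be taken to contain \<open>x i\<close>; the induction hypothesis identifies it with
  \<open>J'\<close>, and Nakayama's lemma descends from \<open>J'\<close> to
  \<open>J\<close>.\<close>

lemma local_ring_dimension:
  fixes m :: "'a::comm_ring_1 set"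
  assumes noeth: "is_noetherian TYPE('a)" and m: "is_local_ring m" and "finite T"
    and "is_ideal J" and "ideal_gen (J \<union> x ` T) = m" and "J \<subseteq> P" and "prime_chain P m (card T)"
  shows "P = J"
  using assms(3-7)
proof (induction T arbitrary: J P rule: finite_induct)
  case empty
  then have "P = m" by (simp add: prime_chain_0)
  then show ?case using empty by (simp add: ideal_gen_self)
next
  case (insert i T)
  define J' where "J' = ideal_gen (insert (x i) J)"
  have J': "is_ideal J'" "J \<subseteq> J'" "x i \<in> J'" by (auto simp: J'_def intro: ideal_gen_base)
  have gen: "ideal_gen (J' \<union> x ` T) = m"
    using insert.prems by (simp add: J'_def ideal_gen_absorb)
  have chain: "prime_chain P m (Suc (card T))" using insert by simp
  have P: "is_prime_ideal P" using prime_chain_primes[OF chain] by blast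
  have xm: "x i \<in> m" using insert.prems(2) ideal_gen_base[of "x i" "J \<union> x ` insert i T"] by auto
  \<comment> \<open>Dropping the first prime of the chain leaves one of length
    \<open>card T\<close>, whose first prime would have to be \<open>J'\<close> although it strictly
    contains \<open>P\<close> and hence \<open>J'\<close>.\<close>
  have "x i \<notin> P"
  proof
    assume "x i \<in> P"
    then have JP: "J' \<subseteq> P"
      unfolding J'_def using insert.prems P by (intro ideal_gen_least prime_idealD) auto
    obtain Q where "P \<subset> Q" "prime_chain Q m (card T)" using prime_chain_first[OF chain] by blast
    then show False using insert.IH[OF J'(1) gen, of Q] JP by blast
  qed
  obtain Q where Q: "P \<subset> Q" "x i \<in> Q" "prime_chain Q m (card T)"
    using prime_chain_through[OF noeth chain xm] by blast
  have "J' \<subseteq> Q"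
    unfolding J'_def using insert.prems Q prime_chain_primes[OF Q(3)] by (intro ideal_gen_least prime_idealD) auto
  then have "Q = J'" using insert.IH[OF J'(1) gen] Q by blast
  have "P \<subseteq> saturation m J"
  proof (rule nakayama_principal[OF noeth local_ring_prime[OF m] insert.prems(1) prime_idealD(1)[OF P] xm])
    fix u assume u: "u \<in> P"
    then have "u \<in> J'" using Q \<open>Q = J'\<close> by blast
    then obtain a where a: "u - a * x i \<in> J"
      unfolding J'_def ideal_gen_insert_ideal[OF insert.prems(1)] by blast
    then have "a * x i \<in> P" using u insert.prems P by (meson ideal_diff_cancel2 prime_idealD(1) subsetD)
    then have "a \<in> P" using P \<open>x i \<notin> P\<close> prime_idealD(3) by blast
    then show "\<exists>s a. s \<notin> m \<and> a \<in> P \<and> s * u - a * x i \<in> J"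
      using a prime_idealD(2)[OF local_ring_prime[OF m]] by (intro exI[of _ 1] exI[of _ a]) auto
  qed
  also have "\<dots> \<subseteq> J" using local_ring_saturated[OF m insert.prems(1)] by (intro saturation_least) auto
  finally show ?case using insert.prems by blast
qed

text \<open>Induction step for the regular sequence: exchange provides a prime that contains
  \<open>J\<close> and \<open>x i\<close> and starts a chain shorter by one, and by
  \<open>local_ring_dimension\<close> this prime is generated by them.\<close>

lemma parameter_step:
  fixes m :: "'a::comm_ring_1 set"
  assumes noeth: "is_noetherian TYPE('a)" and m: "is_local_ring m" and T: "finite T" "i \<notin> T"
    and J: "is_ideal J" "ideal_gen (J \<union> x ` insert i T) = m" "prime_chain J m (Suc (card T))"
  shows "x i \<notin> J" and "prime_chain (ideal_gen (insert (x i) J)) m (card T)"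
proof -
  define J' where "J' = ideal_gen (insert (x i) J)"
  have J': "is_ideal J'" "J \<subseteq> J'" "x i \<in> J'" by (auto simp: J'_def intro: ideal_gen_base)
  have gen: "ideal_gen (J' \<union> x ` T) = m"
    using J by (simp add: J'_def ideal_gen_absorb)
  have xm: "x i \<in> m" using J(2) ideal_gen_base[of "x i" "J \<union> x ` insert i T"] by auto
  obtain Q where Q: "J \<subset> Q" "x i \<in> Q" "prime_chain Q m (card T)"
    using prime_chain_through[OF noeth J(3) xm] by blast
  have "J' \<subseteq> Q"
    unfolding J'_def using Q prime_chain_primes[OF Q(3)] by (intro ideal_gen_least prime_idealD) auto
  then have "Q = J'" using local_ring_dimension[OF noeth m T(1) J'(1) gen] Q by blast
  then show "prime_chain (ideal_gen (insert (x i) J)) m (card T)" using Q J'_def by simp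
  show "x i \<notin> J"
  proof
    assume "x i \<in> J"
    then have "J' = J" using J by (simp add: J'_def insert_absorb ideal_gen_self)
    then show False using Q \<open>Q = J'\<close> by blast
  qed
qed

text \<open>Well-definedness of the transition maps in the direct system with limit the top local
  cohomology: the product supplies the \<open>k\<close> missing factors of each
  \<open>y i\<close>.\<close>

lemma prod_power_shift:
  fixes y :: "nat \<Rightarrow> 'b::comm_ring_1"
  assumes "v \<in> ideal_gen ((\<lambda>i. y i ^ n) ` {..<d})"
  shows "(\<Prod>i<d. y i) ^ k * v \<in> ideal_gen ((\<lambda>i. y i ^ (n + k)) ` {..<d})"
proof -
  have "ideal_gen ((\<lambda>i. y i ^ n) ` {..<d}) \<subseteq> colon (ideal_gen ((\<lambda>i. y i ^ (n + k)) ` {..<d})) {(\<Prod>i<d. y i) ^ k}"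
  proof (intro ideal_gen_least is_ideal_colon is_ideal_gen image_subsetI)
    fix i assume i: "i \<in> {..<d}"
    have "(\<Prod>i<d. y i) = y i * (\<Prod>i\<in>{..<d} - {i}. y i)"
      using i by (intro prod.remove) auto
    then have "(\<Prod>i<d. y i) ^ k * y i ^ n = (\<Prod>i\<in>{..<d} - {i}. y i) ^ k * y i ^ (n + k)"
      by (simp add: power_mult_distrib power_add mult_ac)
    moreover have "y i ^ (n + k) \<in> ideal_gen ((\<lambda>i. y i ^ (n + k)) ` {..<d})"
      using i by (intro ideal_gen_base) auto
    ultimately show "y i ^ n \<in> colon (ideal_gen ((\<lambda>i. y i ^ (n + k)) ` {..<d})) {(\<Prod>i<d. y i) ^ k}"
      by (simp add: colon_def ideal_times)
  qed
  then show ?thesis using assms by (auto simp: colon_def)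
qed

locale regular_local =
  fixes m :: "'a::comm_ring_1 set" and x :: "nat \<Rightarrow> 'a" and d :: nat
  assumes noetherian: "is_noetherian TYPE('a)"
    and local_ring: "is_local_ring m"
    and dim: "krull_dim TYPE('a) = enat d"
    and generators: "ideal_gen (x ` {..<d}) = m"
begin

lemma prime_m: "is_prime_ideal m"
  using local_ring by (rule local_ring_prime)

lemma is_ideal_m: "is_ideal m"
  using prime_m by (rule prime_idealD)

lemma x_in_m: "i < d \<Longrightarrow> x i \<in> m"
  using generators ideal_gen_base[of "x i" "x ` {..<d}"] by auto

lemma saturated_m: "is_ideal I \<Longrightarrow> saturated m I"
  using local_ring by (rule local_ring_saturated)

lemma prime_chain_zero: "prime_chain {0} m d"
proof -
  have "\<exists>P. prime_chain P m d"
  proof (cases d)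
    case 0
    then show ?thesis using prime_m by (auto intro: prime_chain.refl)
  next
    case (Suc e)
    \<comment> \<open>The supremum yields only a chain of some length \<open>n > e\<close>. It is
      cut off at \<open>e\<close>, and putting \<open>m\<close> on top gives length exactly
      \<open>d\<close>.\<close>
    have "enat e < Sup {enat n | n. \<exists>P::nat \<Rightarrow> 'a set.
        (\<forall>i\<le>n. is_prime_ideal (P i)) \<and> (\<forall>i<n. P i \<subset> P (Suc i))}"
      using dim Suc unfolding krull_dim_def by simp
    then obtain n and P :: "nat \<Rightarrow> 'a set" where "e < n"
      and P: "\<forall>i\<le>n. is_prime_ideal (P i)" "\<forall>i<n. P i \<subset> P (Suc i)"
      unfolding less_Sup_iff by auto
    have "prime_chain (P 0) (P i) i" if "i \<le> n" for i
      using that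
    proof (induction i)
      case 0
      then show ?case using P by (auto intro: prime_chain.refl)
    next
      case (Suc i)
      then have "prime_chain (P 0) (P i) i" "is_prime_ideal (P (Suc i))" "P i \<subset> P (Suc i)" using P by auto
      then show ?case by (rule prime_chain.step)
    qed
    then have "prime_chain (P 0) (P e) e" using \<open>e < n\<close> by simp
    moreover have "P (Suc e) \<subseteq> m"
      using P(1) \<open>e < n\<close> local_ring unfolding is_local_ring_def is_prime_ideal_def by simp
    then have "P e \<subset> m" using P(2) \<open>e < n\<close> by blast
    ultimately show ?thesis using prime_m Suc by (auto intro: prime_chain.step)
  qed
  then obtain P where P: "prime_chain P m d" by blast
  then have "is_ideal P" using prime_chain_primes prime_idealD by blast
  have "ideal_gen ({0} \<union> x ` {..<d}) = m"
    unfolding generators[symmetric]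
    by (intro antisym ideal_gen_least ideal_gen_mono) (auto intro: ideal_gen_base ideal_0)
  then have "P = {0}"
    using local_ring_dimension[OF noetherian local_ring, of "{..<d}" "{0}" x P] P ideal_0[OF \<open>is_ideal P\<close>]
    by simp
  then show ?thesis using P by simp
qed

text \<open>The parameters form a regular sequence in any order: a remaining parameter lies outside
  the prime generated by the chosen ones. The chain is carried along because its length drops by one
  at each step.\<close>

lemma prime_chain_partial:
  assumes "finite S" and "S \<subseteq> {..<d}"
  shows "prime_chain (ideal_gen (x ` S)) m (d - card S) \<and>
    (\<forall>j. j < d \<longrightarrow> j \<notin> S \<longrightarrow> x j \<notin> ideal_gen (x ` S))"
proof -
  have next_step: "x j \<notin> ideal_gen (x ` S) \<and> prime_chain (ideal_gen (x ` insert j S)) m (d - card (insert j S))"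
    if S: "finite S" "S \<subseteq> {..<d}" "prime_chain (ideal_gen (x ` S)) m (d - card S)" "j < d" "j \<notin> S" for S j
  proof -
    define T where "T = {..<d} - S - {j}"
    have T: "insert j T = {..<d} - S" "j \<notin> T" "finite T" using S by (auto simp: T_def)
    have "card (insert j T) = d - card S"
      unfolding T(1) using S by (subst card_Diff_subset) auto
    then have card: "d - card S = Suc (card T)" using T(2,3) by simp
    have "ideal_gen (ideal_gen (x ` S) \<union> x ` insert j T) = m"
    proof (rule antisym)
      show "ideal_gen (ideal_gen (x ` S) \<union> x ` insert j T) \<subseteq> m"
        using S T x_in_m is_ideal_m by (intro ideal_gen_least Un_least) auto
      show "m \<subseteq> ideal_gen (ideal_gen (x ` S) \<union> x ` insert j T)"
        unfolding generators[symmetric]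
        by (intro ideal_gen_least) (auto simp: T(1) intro: ideal_gen_base)
    qed
    note * = parameter_step[OF noetherian local_ring T(3,2) is_ideal_gen this]
    have "d - card (insert j S) = card T" using S card by simp
    then show ?thesis
      using * S(3) card by (simp add: ideal_gen_insert_gen)
  qed
  have "prime_chain (ideal_gen (x ` S)) m (d - card S)"
    using assms
  proof (induction S rule: finite_induct)
    case empty
    have "ideal_gen {} = {0::'a}" using ideal_gen_least[of "{0::'a}" "{}"] ideal_0[OF is_ideal_gen] by auto
    then show ?case using prime_chain_zero by simp
  next
    case (insert j S)
    then show ?case using next_step[of S j] by simp
  qed
  then show ?thesis using next_step[of S] assms by blast
qed

lemma prime_partial: "S \<subseteq> {..<d} \<Longrightarrow> is_prime_ideal (ideal_gen (x ` S))"
  using prime_chain_partial[of S] prime_chain_primes finite_subset[of S "{..<d}"] by blast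

lemma not_in_partial: "S \<subseteq> {..<d} \<Longrightarrow> j < d \<Longrightarrow> j \<notin> S \<Longrightarrow> x j \<notin> ideal_gen (x ` S)"
  using prime_chain_partial[of S] finite_subset[of S "{..<d}"] by blast

section \<open>Ideals generated by powers of the parameters\<close>

definition pideal :: "nat set \<Rightarrow> (nat \<Rightarrow> nat) \<Rightarrow> 'a set" where
  "pideal S n = ideal_gen ((\<lambda>i. x i ^ n i) ` S)"

lemma is_ideal_pideal [simp]: "is_ideal (pideal S n)"
  by (simp add: pideal_def)

lemma pideal_base: "i \<in> S \<Longrightarrow> x i ^ n i \<in> pideal S n"
  unfolding pideal_def by (rule ideal_gen_base) simp

lemma pideal_cong: "(\<And>i. i \<in> S \<Longrightarrow> n i = n' i) \<Longrightarrow> pideal S n = pideal S n'"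
  unfolding pideal_def by (metis (no_types, lifting) image_cong)

lemma pideal_insert: "u \<in> pideal (insert i S) n \<longleftrightarrow> (\<exists>a. u - a * x i ^ n i \<in> pideal S n)"
  by (simp add: pideal_def ideal_gen_insert)

lemma pideal_least:
  "is_ideal I \<Longrightarrow> (\<And>i. i \<in> S \<Longrightarrow> x i ^ n i \<in> I) \<Longrightarrow> pideal S n \<subseteq> I"
  unfolding pideal_def by (rule ideal_gen_least) auto

lemma pideal_mono: "(\<And>i. i \<in> S \<Longrightarrow> i \<in> S' \<and> n' i \<le> n i) \<Longrightarrow> pideal S n \<subseteq> pideal S' n'"
proof (rule pideal_least)
  fix i assume "\<And>i. i \<in> S \<Longrightarrow> i \<in> S' \<and> n' i \<le> n i" "i \<in> S"
  then have i: "i \<in> S'" "n' i \<le> n i" by auto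
  have "x i ^ n i = x i ^ (n i - n' i) * x i ^ n' i" using i by (simp flip: power_add)
  then show "x i ^ n i \<in> pideal S' n'"
    using pideal_base[OF i(1), of n'] by (auto intro: ideal_times)
qed simp

text \<open>\<open>S\<close> contains the indices whose exponent may differ from 1. Without such
  indices the ideal is prime. Otherwise the exponent \<open>k\<close> of \<open>x i\<close> is
  raised step by step; each step cancels \<open>x i\<close> modulo the other generators and
  \<open>x j\<close> modulo the ideal with exponent 1 at \<open>i\<close>, both known for the
  smaller \<open>S\<close>.\<close>

lemma pideal_cancel_new:
  assumes "finite S" and "S \<subseteq> U" and "U \<subseteq> {..<d}" and "\<And>i. i \<in> U - S \<Longrightarrow> n i = 1"
    and "j < d" and "j \<notin> U" and "x j * c \<in> pideal U n"
  shows "c \<in> pideal U n"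
  using assms
proof (induction S arbitrary: U n j c rule: finite_induct)
  case empty
  have "pideal U n = ideal_gen (x ` U)"
    unfolding pideal_def using empty.prems(3) by (intro arg_cong[of _ _ ideal_gen] image_cong) auto
  then show ?case
    using empty.prems prime_idealD(3)[OF prime_partial] not_in_partial by metis
next
  case (insert i S)
  define V where "V = U - {i}"
  have U: "U = insert i V" "i \<notin> V" "i < d" using insert.prems by (auto simp: V_def)
  have VS: "S \<subseteq> V" "V \<subseteq> {..<d}" "\<And>i. i \<in> V - S \<Longrightarrow> n i = 1"
    using insert.prems insert.hyps by (auto simp: V_def)
  have V: "pideal V (n(i := k)) = pideal V n" for k
    using U(2) by (intro pideal_cong) auto
  have mem: "u \<in> pideal U (n(i := k)) \<longleftrightarrow> (\<exists>a. u - a * x i ^ k \<in> pideal V n)" for u k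
    unfolding U(1) pideal_insert V by simp
  have cancel_i: "a \<in> pideal V n" if "x i ^ k * a \<in> pideal V n" for a k
    using that
  proof (induction k)
    case (Suc k)
    then have "x i * (x i ^ k * a) \<in> pideal V n" by (simp add: mult.assoc)
    then have "x i ^ k * a \<in> pideal V n"
      by - (rule insert.IH[OF VS U(3,2)]; assumption)
    then show ?case by (rule Suc.IH)
  qed simp
  have one: "c \<in> pideal U (n(i := 1))" if "x j * c \<in> pideal U (n(i := 1))" for c
    using insert.prems insert.hyps that by - (rule insert.IH[of U "n(i := 1)" j]; (rule that | auto))
  have "c \<in> pideal U (n(i := k))" if "x j * c \<in> pideal U (n(i := k))" for k c
    using that
  proof (induction k arbitrary: c)
    case 0
    then show ?case unfolding mem by (intro exI[of _ c]) (simp add: ideal_0)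
  next
    case (Suc k)
    then obtain b where b: "x j * c - b * x i ^ Suc k \<in> pideal V n" unfolding mem by blast
    have "x j * c \<in> pideal U (n(i := k))"
      unfolding mem using b by (intro exI[of _ "b * x i"]) (simp add: mult_ac)
    then obtain a where a: "c - a * x i ^ k \<in> pideal V n" using Suc.IH unfolding mem by blast
    \<comment> \<open>Comparing the two expressions for \<open>x j * c\<close> and cancelling
      \<open>x i ^ k\<close> makes \<open>x j * a\<close> a multiple of \<open>x i\<close> modulo
      the ideal of \<open>V\<close>; cancelling \<open>x j\<close> then does the same for
      \<open>a\<close>.\<close>
    have "x i ^ k * (x j * a - b * x i) = (x j * c - b * x i ^ Suc k) - x j * (c - a * x i ^ k)"
      by (simp add: algebra_simps)
    then have "x i ^ k * (x j * a - b * x i) \<in> pideal V n"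
      using a b by (simp add: ideal_diff ideal_times)
    then have "x j * a - b * x i ^ 1 \<in> pideal V n" using cancel_i by simp
    then have "a \<in> pideal U (n(i := 1))" using one unfolding mem by blast
    then obtain e where "a - e * x i ^ 1 \<in> pideal V n" unfolding mem by blast
    then have e: "a - e * x i \<in> pideal V n" by simp
    have "(c - a * x i ^ k) + x i ^ k * (a - e * x i) \<in> pideal V n"
      using a e by (simp only: ideal_add ideal_times is_ideal_pideal)
    also have "(c - a * x i ^ k) + x i ^ k * (a - e * x i) = c - e * x i ^ Suc k"
      by (simp add: algebra_simps)
    finally show ?case unfolding mem by blast
  qed
  from this[of c "n i"] show ?case using insert.prems by simp
qed

lemma pideal_cancel_power:
  assumes "U \<subseteq> {..<d}" and "j \<in> U" and "x j ^ k * c \<in> pideal U (n(j := n j + k))"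
  shows "c \<in> pideal U n"
proof -
  define V where "V = U - {j}"
  have U: "U = insert j V" "j \<notin> V" "j < d" "finite V"
    using assms finite_subset[OF assms(1)] by (auto simp: V_def)
  have V: "pideal V (n(j := k)) = pideal V n" for k
    using U(2) by (intro pideal_cong) auto
  have cancel: "a \<in> pideal V n" if "x j ^ k * a \<in> pideal V n" for a k
    using that
  proof (induction k)
    case (Suc k)
    then have "x j * (x j ^ k * a) \<in> pideal V n" by (simp add: mult.assoc)
    then have "x j ^ k * a \<in> pideal V n"
      using U(2-4) assms(1) by - (rule pideal_cancel_new[of V V n j]; auto simp: V_def)
    then show ?case by (rule Suc.IH)
  qed simp
  obtain a where "x j ^ k * c - a * x j ^ (n j + k) \<in> pideal V n"
    using assms(3) unfolding U(1) pideal_insert V by auto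
  then have "x j ^ k * (c - a * x j ^ n j) \<in> pideal V n"
    by (simp add: algebra_simps power_add)
  then have "c - a * x j ^ n j \<in> pideal V n" by (rule cancel)
  then show ?thesis unfolding U(1) pideal_insert by blast
qed

lemma pideal_cancel_prod:
  assumes "finite T" and "T \<subseteq> U" and "U \<subseteq> {..<d}"
    and "(\<Prod>i\<in>T. x i ^ k i) * c \<in> pideal U (\<lambda>i. n i + (if i \<in> T then k i else 0))"
  shows "c \<in> pideal U n"
  using assms
proof (induction T rule: finite_induct)
  case (insert j T)
  define n' where "n' = (\<lambda>i. n i + (if i \<in> T then k i else 0))"
  have "(\<lambda>i. n i + (if i \<in> insert j T then k i else 0)) = n'(j := n' j + k j)"
    using insert.hyps by (auto simp: n'_def)
  then have "x j ^ k j * ((\<Prod>i\<in>T. x i ^ k i) * c) \<in> pideal U (n'(j := n' j + k j))"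
    using insert by (simp add: mult.assoc)
  then have "(\<Prod>i\<in>T. x i ^ k i) * c \<in> pideal U n'"
    using insert.prems by - (rule pideal_cancel_power[of U j "k j"]; auto)
  then show ?case using insert by (simp add: n'_def)
qed simp

definition Q :: "nat \<Rightarrow> 'a set" where
  "Q n = pideal {..<d} (\<lambda>_. n)"

lemma is_ideal_Q [simp]: "is_ideal (Q n)"
  by (simp add: Q_def)

lemma Q_base: "i < d \<Longrightarrow> x i ^ n \<in> Q n"
  unfolding Q_def using pideal_base[of i "{..<d}" "\<lambda>_. n"] by simp

lemma Q_antimono: "i \<le> j \<Longrightarrow> Q j \<subseteq> Q i"
  unfolding Q_def by (rule pideal_mono) auto

lemma Q_least: "is_ideal I \<Longrightarrow> (\<And>i. i < d \<Longrightarrow> x i ^ n \<in> I) \<Longrightarrow> Q n \<subseteq> I"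
  unfolding Q_def by (rule pideal_least) auto

lemma Q_subset_pow: "Q n \<subseteq> ideal_pow m n"
  by (rule Q_least) (auto intro: power_in_ideal_pow x_in_m)

text \<open>Injectivity of the transition maps between the levels, which makes \<open>E\<close> a
  union.\<close>

lemma Q_cancel:
  assumes "(\<Prod>i<d. x i) ^ k * c \<in> Q (n + k)"
  shows "c \<in> Q n"
proof -
  have "(\<Prod>i<d. x i ^ k) * c \<in> pideal {..<d} (\<lambda>i. n + (if i \<in> {..<d} then k else 0))"
    using assms pideal_cong[of "{..<d}" "\<lambda>i. n + (if i \<in> {..<d} then k else 0)" "\<lambda>_. n + k"]
    by (simp add: Q_def prod_power_distrib)
  then show ?thesis unfolding Q_def by - (rule pideal_cancel_prod[of "{..<d}" _ "\<lambda>_. k"]; auto)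
qed

lemma Q_shift: "c \<in> Q n \<Longrightarrow> (\<Prod>i<d. x i) ^ k * c \<in> Q (n + k)"
  unfolding Q_def pideal_def by (rule prod_power_shift)

text \<open>One index \<open>j\<close> at a time, the factor \<open>x j ^ n\<close> is split off
  from \<open>c\<close>; for the full index set, the product of all \<open>x i ^ n\<close> spans the
  socle.\<close>

lemma Q_socle_generator:
  assumes c: "\<And>j. j < d \<Longrightarrow> x j * c \<in> Q (Suc n)" and "finite S" and "S \<subseteq> {..<d}"
  shows "\<exists>a. c - a * (\<Prod>i\<in>S. x i ^ n) \<in> Q (Suc n)"
  using assms(2,3)
proof (induction S rule: finite_induct)
  case empty
  then show ?case by (intro exI[of _ c]) (simp add: ideal_0)
next
  case (insert j S)
  then obtain a where a: "c - a * (\<Prod>i\<in>S. x i ^ n) \<in> Q (Suc n)" by auto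
  have j: "j < d" using insert by simp
  \<comment> \<open>These are the exponents of \<open>Q (Suc n)\<close> left after cancelling
    \<open>x i ^ n\<close> for \<open>i\<close> in \<open>S\<close>.\<close>
  define n0 where "n0 i = (if i \<in> S then 1 else Suc n)" for i
  define V where "V = {..<d} - {j}"
  have V: "{..<d} = insert j V" "j \<notin> V" using j by (auto simp: V_def)
  have "x j * c - x j * (c - a * (\<Prod>i\<in>S. x i ^ n)) \<in> Q (Suc n)"
    by (rule ideal_diff[OF is_ideal_Q c[OF j] ideal_times[OF is_ideal_Q a]])
  then have "(\<Prod>i\<in>S. x i ^ n) * (x j * a) \<in> Q (Suc n)"
    by (simp add: algebra_simps)
  moreover have "Q (Suc n) = pideal {..<d} (\<lambda>i. n0 i + (if i \<in> S then n else 0))"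
    unfolding Q_def by (rule pideal_cong) (simp add: n0_def)
  ultimately have "x j * a \<in> pideal {..<d} n0"
    using insert by - (rule pideal_cancel_prod[of S _ "\<lambda>_. n"]; auto)
  \<comment> \<open>At \<open>j\<close> the exponent is still \<open>Suc n\<close>; cancelling the
    factor \<open>x j\<close> lowers it to \<open>n\<close>, and the term with
    \<open>x j ^ n\<close> is the one to be split off.\<close>
  moreover have "n0 = (n0(j := n))(j := (n0(j := n)) j + 1)"
    using insert.hyps by (auto simp: n0_def)
  ultimately have "a \<in> pideal {..<d} (n0(j := n))"
    using j by - (rule pideal_cancel_power[of _ j 1]; auto)
  then obtain b where b0: "a - b * x j ^ n \<in> pideal V (n0(j := n))"
    unfolding V(1) pideal_insert by auto
  have b: "a - b * x j ^ n \<in> pideal {..<d} n0"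
  proof -
    have "pideal V (n0(j := n)) = pideal V n0" using V(2) by (intro pideal_cong) auto
    moreover have "pideal V n0 \<subseteq> pideal {..<d} n0" by (rule pideal_mono) (auto simp: V_def)
    ultimately show ?thesis using b0 by blast
  qed
  have "pideal {..<d} n0 \<subseteq> colon (Q (Suc n)) {\<Prod>i\<in>S. x i ^ n}"
  proof (rule pideal_least)
    fix i assume i: "i \<in> {..<d}"
    show "x i ^ n0 i \<in> colon (Q (Suc n)) {\<Prod>i\<in>S. x i ^ n}"
    proof (cases "i \<in> S")
      case True
      then have "(\<Prod>i\<in>S. x i ^ n) = x i ^ n * (\<Prod>i\<in>S - {i}. x i ^ n)"
        using insert.hyps by (intro prod.remove) auto
      then have "(\<Prod>i\<in>S. x i ^ n) * x i ^ n0 i = (\<Prod>i\<in>S - {i}. x i ^ n) * x i ^ Suc n"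
        using True by (simp add: n0_def mult_ac)
      then show ?thesis using Q_base[of i "Suc n"] i by (simp add: colon_def ideal_times del: power_Suc)
    next
      case False
      then show ?thesis
        using Q_base[of i "Suc n"] i by (simp add: colon_def ideal_times n0_def del: power_Suc)
    qed
  qed (simp add: is_ideal_colon)
  then have "(\<Prod>i\<in>S. x i ^ n) * (a - b * x j ^ n) \<in> Q (Suc n)"
    using b by (auto simp: colon_def)
  moreover have "c - b * (\<Prod>i\<in>insert j S. x i ^ n)
      = (c - a * (\<Prod>i\<in>S. x i ^ n)) + (\<Prod>i\<in>S. x i ^ n) * (a - b * x j ^ n)"
    using insert.hyps by (simp add: algebra_simps)
  ultimately show ?case using a by (metis ideal_add is_ideal_Q)
qed

text \<open>Both elements are multiples of \<open>w\<close> modulo \<open>Q (Suc n)\<close>. As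
  \<open>m\<close> kills \<open>w\<close>, the coefficient in a nonzero multiple is a unit.\<close>

lemma Q_socle_simple:
  assumes u: "u \<in> colon (Q (Suc n)) m" "u \<notin> Q (Suc n)" and v: "v \<in> colon (Q (Suc n)) m"
  shows "\<exists>a. v - a * u \<in> Q (Suc n)"
proof -
  define w where "w = (\<Prod>i<d. x i ^ n)"
  have gen: "\<exists>a. c - a * w \<in> Q (Suc n)" if "c \<in> colon (Q (Suc n)) m" for c
    unfolding w_def using that x_in_m by (intro Q_socle_generator) (auto simp: colon_def)
  obtain a where a: "u - a * w \<in> Q (Suc n)" using gen u by blast
  obtain e where e: "v - e * w \<in> Q (Suc n)" using gen v by blast
  have "m \<subseteq> colon (Q (Suc n)) {w}"
    unfolding generators[symmetric]
  proof (intro ideal_gen_least is_ideal_colon is_ideal_Q image_subsetI)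
    fix i assume "i \<in> {..<d}"
    then have "w = x i ^ n * (\<Prod>i\<in>{..<d} - {i}. x i ^ n)"
      unfolding w_def by (intro prod.remove) auto
    then have "w * x i = (\<Prod>i\<in>{..<d} - {i}. x i ^ n) * x i ^ Suc n" by (simp add: mult_ac)
    then show "x i \<in> colon (Q (Suc n)) {w}"
      using Q_base[of i "Suc n"] \<open>i \<in> {..<d}\<close> by (simp add: colon_def ideal_times del: power_Suc)
  qed
  then have "a \<notin> m"
    using a u ideal_diff_cancel[OF is_ideal_Q a] by (auto simp: colon_def mult.commute)
  then obtain b where b: "b * a = 1" using local_ring_unit[OF local_ring] by blast
  have "(v - e * w) - (e * b) * (u - a * w) \<in> Q (Suc n)"
    using a e by (simp only: ideal_diff ideal_times is_ideal_Q)
  also have "(v - e * w) - (e * b) * (u - a * w) = v - (e * b) * u + e * (b * a - 1) * w"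
    by (simp add: algebra_simps)
  finally show ?thesis using b by auto
qed

section \<open>Gorenstein duality\<close>

text \<open>If \<open>y * u\<close> were outside \<open>D\<close>, simplicity would put some
  \<open>(s - a * y) * u\<close> into \<open>D\<close> with a unit in front.\<close>

lemma simple_step_maximal:
  assumes D: "is_ideal D" "simple_step m D E" and "u \<in> E" "is_ideal E" "y \<in> m"
  shows "y * u \<in> D"
proof (rule ccontr)
  assume no: "y * u \<notin> D"
  then have "y * u \<in> E - D" using assms by (auto intro: ideal_times)
  then obtain s a where sa: "s \<notin> m" "s * u - a * (y * u) \<in> D"
    using assms unfolding simple_step_def by blast
  have "s - a * y \<notin> m" using sa(1) \<open>y \<in> m\<close> ideal_diff_cancel[OF is_ideal_m] is_ideal_m by (blast intro: ideal_times)
  moreover have "(s - a * y) * u \<in> D" using sa(2) by (simp add: algebra_simps)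
  ultimately have "u \<in> D" using saturated_m[OF D(1)] by (auto dest: saturatedD)
  then show False using no D by (auto intro: ideal_times)
qed

lemma comp_series_Q: "\<exists>K l. comp_series m (Q n) K l"
proof -
  have "\<exists>k. y ^ k \<in> Q n" if "y \<in> x ` {..<d}" for y
    using that Q_base by auto
  moreover have "finite (x ` {..<d})" by simp
  ultimately obtain K l where "comp_series m (Q n) K l"
    using comp_series_exists[OF noetherian prime_m is_ideal_Q saturated_m[OF is_ideal_Q] _ generators[symmetric]]
    by metis
  then show ?thesis by blast
qed

text \<open>Each step of a composition series absorbs one factor \<open>m\<close>. With
  \<open>Q_subset_pow\<close> this says that the ideals \<open>Q n\<close> define the
  \<open>m\<close>-adic topology.\<close>

lemma pow_subset_Q: "\<exists>N. ideal_pow m N \<subseteq> Q n"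
proof -
  obtain K l where K: "comp_series m (Q n) K l" using comp_series_Q by blast
  have "ideal_pow m i \<subseteq> K (l - i)" if "i \<le> l" for i
    using that
  proof (induction i)
    case 0
    then show ?case using K by (simp add: comp_series_def)
  next
    case (Suc i)
    have step: "is_ideal (K (l - Suc i))" "is_ideal (K (l - i))" "simple_step m (K (l - Suc i)) (K (l - i))"
    proof -
      have "\<forall>i\<le>l. is_ideal (K i)" "\<forall>i<l. simple_step m (K i) (K (Suc i))"
        using K by (simp_all add: comp_series_def)
      moreover have "l - i = Suc (l - Suc i)" "l - Suc i < l" using Suc.prems by auto
      ultimately show "is_ideal (K (l - Suc i))" "is_ideal (K (l - i))"
        "simple_step m (K (l - Suc i)) (K (l - i))" by (metis less_imp_le_nat diff_le_self)+
    qed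
    show ?case
      unfolding ideal_pow.simps
    proof (rule ideal_mult_least[OF step(1)])
      fix y u assume "y \<in> m" "u \<in> ideal_pow m i"
      then show "y * u \<in> K (l - Suc i)"
        using simple_step_maximal[OF step(1,3) _ step(2)] Suc by auto
    qed
  qed
  from this[of l] show ?thesis using K by (auto simp: comp_series_def)
qed

text \<open>For \<open>u\<close> in \<open>E\<close> outside \<open>D\<close>, multiplication by
  \<open>u\<close> maps the annihilator of \<open>D\<close> into the socle, which is simple; the
  kernel is the annihilator of \<open>E\<close> because \<open>E\<close> is spanned by
  \<open>u\<close> over \<open>D\<close>.\<close>

lemma simple_step_colon:
  assumes D: "is_ideal D" "is_ideal E" "simple_step m D E"
  shows "simple_step m (colon (Q (Suc n)) E) (colon (Q (Suc n)) D)"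
  unfolding simple_step_def
proof (intro conjI ballI)
  show "colon (Q (Suc n)) E \<subseteq> colon (Q (Suc n)) D"
    using D by (intro colon_antimono) (simp add: simple_step_def)
next
  fix z1 z2 assume z1: "z1 \<in> colon (Q (Suc n)) D - colon (Q (Suc n)) E" and z2: "z2 \<in> colon (Q (Suc n)) D"
  then obtain u where u: "u \<in> E" "u * z1 \<notin> Q (Suc n)" by (auto simp: colon_def)
  have "u \<notin> D" using z1 u by (auto simp: colon_def)
  have soc: "u * z \<in> colon (Q (Suc n)) m" if "z \<in> colon (Q (Suc n)) D" for z
  proof -
    have "(y * u) * z \<in> Q (Suc n)" if "y \<in> m" for y
      using simple_step_maximal[OF D(1,3) u(1) D(2) that] \<open>z \<in> colon (Q (Suc n)) D\<close>
      by (auto simp: colon_def)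
    then show ?thesis by (simp add: colon_def mult.assoc)
  qed
  obtain a where a: "u * z2 - a * (u * z1) \<in> Q (Suc n)"
    using Q_socle_simple[OF soc u(2) soc] z1 z2 by auto
  define z where "z = z2 - a * z1"
  have zD: "z \<in> colon (Q (Suc n)) D"
    using z1 z2 ideal_diff[OF is_ideal_colon[OF is_ideal_Q]] ideal_times[OF is_ideal_colon[OF is_ideal_Q]]
    unfolding z_def by blast
  have zu: "u * z \<in> Q (Suc n)" using a by (simp add: z_def algebra_simps)
  have "v * z \<in> Q (Suc n)" if v: "v \<in> E" for v
  proof -
    obtain s b where sb: "s \<notin> m" "s * v - b * u \<in> D"
      using D(3) u \<open>u \<notin> D\<close> v unfolding simple_step_def by blast
    have "(s * v - b * u) * z + b * (u * z) \<in> Q (Suc n)"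
      using zD sb by (intro ideal_add ideal_times[OF _ zu] is_ideal_Q) (auto simp: colon_def)
    also have "(s * v - b * u) * z + b * (u * z) = s * (v * z)" by (simp add: algebra_simps)
    finally show ?thesis using sb saturated_m[OF is_ideal_Q] by (blast dest: saturatedD)
  qed
  then have "z \<in> colon (Q (Suc n)) E" by (simp add: colon_def)
  then show "\<exists>s a. s \<notin> m \<and> s * z2 - a * z1 \<in> colon (Q (Suc n)) E"
    using prime_idealD(2)[OF prime_m] unfolding z_def by (intro exI[of _ 1] exI[of _ a]) simp
qed

text \<open>Telescoping over a filtration in which some steps may be trivial; only proper steps cost
  a jump.\<close>

lemma card_jumps_colon:
  assumes K: "comp_series m (Q (Suc n)) K l"
    and D: "\<And>i. i \<le> k \<Longrightarrow> is_ideal (D i)" "\<And>i. i < k \<Longrightarrow> simple_step m (D i) (D (Suc i))"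
  shows "card (jumps K l (colon (Q (Suc n)) (D 0)))
    \<le> card (jumps K l (colon (Q (Suc n)) (D k))) + card {i. i < k \<and> \<not> D (Suc i) \<subseteq> D i}"
  using D
proof (induction k)
  case (Suc k)
  let ?j = "\<lambda>i. card (jumps K l (colon (Q (Suc n)) (D i)))"
  have IH: "?j 0 \<le> ?j k + card {i. i < k \<and> \<not> D (Suc i) \<subseteq> D i}"
    using Suc by simp
  have step: "simple_step m (D k) (D (Suc k))" "is_ideal (D k)" "is_ideal (D (Suc k))" using Suc.prems by auto
  show ?case
  proof (cases "D (Suc k) \<subseteq> D k")
    case True
    then have "D (Suc k) = D k" using step by (auto simp: simple_step_def)
    moreover have "{i. i < Suc k \<and> \<not> D (Suc i) \<subseteq> D i} = {i. i < k \<and> \<not> D (Suc i) \<subseteq> D i}"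
      using True by (auto simp: less_Suc_eq)
    ultimately show ?thesis using IH by simp
  next
    case False
    have "?j k \<le> ?j (Suc k) + 1"
      using step by (intro card_jumps_simple_step[OF prime_m K] is_ideal_colon simple_step_colon is_ideal_Q)
    moreover have "{i. i < Suc k \<and> \<not> D (Suc i) \<subseteq> D i} = insert k {i. i < k \<and> \<not> D (Suc i) \<subseteq> D i}"
      using False by (auto simp: less_Suc_eq)
    ultimately show ?thesis using IH by simp
  qed
qed simp

lemma simple_step_Int:
  assumes "is_ideal C" and "simple_step m D E"
  shows "simple_step m (C \<inter> D) (C \<inter> E)"
  unfolding simple_step_def
proof (intro conjI ballI)
  show "C \<inter> D \<subseteq> C \<inter> E" using assms by (auto simp: simple_step_def)
next
  fix u v assume uv: "u \<in> C \<inter> E - C \<inter> D" "v \<in> C \<inter> E"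
  then obtain s a where "s \<notin> m" "s * v - a * u \<in> D" using assms unfolding simple_step_def by blast
  moreover have "s * v - a * u \<in> C" using assms uv by (auto intro: ideal_diff ideal_times)
  ultimately show "\<exists>s a. s \<notin> m \<and> s * v - a * u \<in> C \<inter> D" by blast
qed

lemma simple_step_isum:
  assumes "is_ideal C" and "is_ideal D" and "simple_step m D E"
  shows "simple_step m (isum C D) (isum C E)"
  unfolding simple_step_def
proof (intro conjI ballI)
  show "isum C D \<subseteq> isum C E" using assms by (auto simp: simple_step_def isum_def)
next
  fix u v assume uv: "u \<in> isum C E - isum C D" "v \<in> isum C E"
  then obtain c k c' k' where *: "u = c + k" "v = c' + k'" "c \<in> C" "c' \<in> C" "k \<in> E" "k' \<in> E"
    unfolding isum_def by blast
  have "k \<notin> D" using uv * by (auto simp: isum_def)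
  then obtain s a where sa: "s \<notin> m" "s * k' - a * k \<in> D" using assms * unfolding simple_step_def by blast
  have "s * v - a * u = (s * c' - a * c) + (s * k' - a * k)" using * by (simp add: algebra_simps)
  moreover have "s * c' - a * c \<in> C" using assms * by (auto intro: ideal_diff ideal_times)
  ultimately show "\<exists>s a. s \<notin> m \<and> s * v - a * u \<in> isum C D" using sa unfolding isum_def by blast
qed

text \<open>The two inequalities compare lengths along the composition series intersected with \<open>C\<close> and
  along the composition series added to \<open>C\<close>; passing to the annihilator lowers the length by at most
  one in each simple step because the socle of the quotient by \<open>Q (Suc n)\<close> is simple.\<close>

lemma card_jumps_colon_bounds:
  assumes K: "comp_series m (Q (Suc n)) K l" and C: "is_ideal C" "Q (Suc n) \<subseteq> C"
  shows "l \<le> card (jumps K l (colon (Q (Suc n)) C)) + card (jumps K l C)"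
    and "card (jumps K l (colon (Q (Suc n)) C)) + card (jumps K l C) \<le> l"
proof -
  have K': "K 0 = Q (Suc n)" "K l = UNIV" "\<And>i. i \<le> l \<Longrightarrow> is_ideal (K i)"
    "\<And>i. i < l \<Longrightarrow> simple_step m (K i) (K (Suc i))" "\<And>i. i < l \<Longrightarrow> \<not> K (Suc i) \<subseteq> K i"
    using K by (auto simp: comp_series_def)
  have jumps_UNIV: "jumps K l UNIV = {..<l}" using K' by (auto simp: jumps_def)
  \<comment> \<open>The filtration \<open>C \<inter> K i\<close> runs from \<open>Q (Suc n)\<close>,
    with annihilator everything, up to \<open>C\<close>.\<close>
  have "colon (Q (Suc n)) (C \<inter> K 0) = UNIV"
    using C by (auto simp: K' colon_def intro: ideal_times_right)
  moreover have "{i. i < l \<and> \<not> C \<inter> K (Suc i) \<subseteq> C \<inter> K i} = jumps K l C" by (auto simp: jumps_def)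
  ultimately show "l \<le> card (jumps K l (colon (Q (Suc n)) C)) + card (jumps K l C)"
    using card_jumps_colon[OF K, of l "\<lambda>i. C \<inter> K i"] C K' jumps_UNIV
    by (simp add: is_ideal_Int simple_step_Int)
  \<comment> \<open>The sums of \<open>C\<close> with \<open>K i\<close> run from \<open>C\<close>
    up to the whole ring, whose annihilator \<open>Q (Suc n)\<close> has no jumps.\<close>
  have "isum C (K 0) = C"
    using C isum_left[of "K 0" C] by (auto simp: K' isum_def intro: ideal_add)
  moreover have "colon (Q (Suc n)) (isum C (K l)) \<subseteq> Q (Suc n)"
  proof
    fix c assume "c \<in> colon (Q (Suc n)) (isum C (K l))"
    moreover have "1 \<in> isum C (K l)" using isum_right[OF C(1), of "K l"] K' by auto
    ultimately have "1 * c \<in> Q (Suc n)" unfolding colon_def by blast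
    then show "c \<in> Q (Suc n)" by simp
  qed
  then have "jumps K l (colon (Q (Suc n)) (isum C (K l))) \<subseteq> jumps K l (Q (Suc n))" by (rule jumps_mono)
  moreover have "K 0 \<subseteq> K i" if "i \<le> l" for i
    using that
  proof (induction i)
    case (Suc i)
    then show ?case using K'(4)[of i] unfolding simple_step_def by simp blast
  qed simp
  then have "jumps K l (Q (Suc n)) = {}" unfolding jumps_def K'(1)[symmetric] by (simp add: Int_absorb2)
  \<comment> \<open>At a jump of \<open>C\<close>, an element of \<open>C\<close> already spans the
    step from \<open>K i\<close> to \<open>K (Suc i)\<close>, so this step disappears after adding
    \<open>C\<close>.\<close>
  moreover have "{i. i < l \<and> \<not> isum C (K (Suc i)) \<subseteq> isum C (K i)} \<subseteq> {..<l} - jumps K l C"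
  proof -
    have "isum C (K (Suc i)) \<subseteq> isum C (K i)" if i: "i \<in> jumps K l C" for i
    proof -
      obtain u where u: "i < l" "u \<in> C" "u \<in> K (Suc i)" "u \<notin> K i" using i by (auto simp: jumps_def)
      have sum: "is_ideal (isum C (K i))" using C K' u by (intro is_ideal_isum) auto
      have "v \<in> isum C (K i)" if v: "v \<in> K (Suc i)" for v
      proof -
        obtain s a where sa: "s \<notin> m" "s * v - a * u \<in> K i"
          using K'(4)[of i] u v unfolding simple_step_def by blast
        have "s * v = a * u + (s * v - a * u)" "a * u \<in> C" using C u by (auto intro: ideal_times)
        then have "s * v \<in> isum C (K i)" using sa unfolding isum_def by blast
        then show ?thesis using sa saturated_m[OF sum] by (blast dest: saturatedD)
      qed
      moreover have "C \<subseteq> isum C (K i)" using K' u by (intro isum_left) auto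
      ultimately show ?thesis unfolding isum_def[of C "K (Suc i)"] using sum by (auto intro: ideal_add)
    qed
    then show ?thesis by blast
  qed
  then have "card {i. i < l \<and> \<not> isum C (K (Suc i)) \<subseteq> isum C (K i)} \<le> card ({..<l} - jumps K l C)"
    by (intro card_mono) auto
  moreover have "jumps K l C \<subseteq> {..<l}" by (auto simp: jumps_def)
  then have "card ({..<l} - jumps K l C) + card (jumps K l C) = l"
    using card_mono[of "{..<l}" "jumps K l C"] by (simp add: card_Diff_subset)
  ultimately show "card (jumps K l (colon (Q (Suc n)) C)) + card (jumps K l C) \<le> l"
    using card_jumps_colon[OF K, of l "\<lambda>i. isum C (K i)"] C K' by (simp add: is_ideal_isum simple_step_isum)
qed

text \<open>The lengths of \<open>C\<close> and of its annihilator add up to \<open>l\<close>. A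
  triple annihilator equals a single one, so \<open>C\<close> and its double annihilator have the
  same length, and nested ideals of equal length coincide.\<close>

lemma colon_colon_Q:
  assumes C: "is_ideal C" "Q (Suc n) \<subseteq> C"
  shows "colon (Q (Suc n)) (colon (Q (Suc n)) C) = C"
proof
  obtain K l where K: "comp_series m (Q (Suc n)) K l" using comp_series_Q by blast
  define C' where "C' = colon (Q (Suc n)) (colon (Q (Suc n)) C)"
  have C': "C \<subseteq> C'" "is_ideal C'" unfolding C'_def by (auto intro!: colon_colon[THEN subsetD] is_ideal_colon)
  have "colon (Q (Suc n)) C' = colon (Q (Suc n)) C"
  proof
    show "colon (Q (Suc n)) C' \<subseteq> colon (Q (Suc n)) C" using C' by (intro colon_antimono)
    show "colon (Q (Suc n)) C \<subseteq> colon (Q (Suc n)) C'" unfolding C'_def by (rule colon_colon)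
  qed
  then have "card (jumps K l C') \<le> card (jumps K l C)"
    using card_jumps_colon_bounds[OF K C] card_jumps_colon_bounds(2)[OF K C'(2)] order_trans[OF C(2) C'(1)] by simp
  then have "jumps K l C' = jumps K l C"
    using C' card_seteq[OF _ jumps_mono[of C C' K l]] by simp
  then show "colon (Q (Suc n)) (colon (Q (Suc n)) C) \<subseteq> C"
    using jumps_strict[OF K C(1) saturated_m[OF C(1)] C(2) C'(2,1)] by (simp add: C'_def)
qed (rule colon_colon)

section \<open>Krull intersection and Chevalley's theorem\<close>

text \<open>A substitute for the Artin-Rees lemma: take \<open>L\<close> maximal among the ideals
  over \<open>M = J + m * z\<close> that meet \<open>Z\<close> only in \<open>M\<close>. It contains
  \<open>J\<close> and some \<open>Q (Suc n)\<close>, hence \<open>z\<close>; thus \<open>z\<close>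
  lies in \<open>J + m * z\<close>, and Nakayama's argument applies.\<close>

lemma krull_intersection:
  assumes J: "is_ideal J" and z: "\<And>n. z \<in> isum J (Q (Suc n))"
  shows "z \<in> J"
proof -
  define Z where "Z = ideal_gen (insert z J)"
  define M where "M = {u. \<exists>a\<in>m. u - a * z \<in> J}"
  have Z: "u \<in> Z \<longleftrightarrow> (\<exists>a. u - a * z \<in> J)" for u
    unfolding Z_def by (rule ideal_gen_insert_ideal[OF J])
  have M: "is_ideal M"
  proof (rule is_idealI)
    show "0 \<in> M" unfolding M_def using ideal_0[OF J] ideal_0[OF is_ideal_m] by (auto intro!: bexI[of _ 0])
  next
    fix u v assume "u \<in> M" "v \<in> M"
    then obtain a b where ab: "a \<in> m" "b \<in> m" "u - a * z \<in> J" "v - b * z \<in> J" by (auto simp: M_def)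
    have "(u + v) - (a + b) * z = (u - a * z) + (v - b * z)" by (simp add: algebra_simps)
    then have "(u + v) - (a + b) * z \<in> J" using ab ideal_add[OF J] by metis
    then show "u + v \<in> M" unfolding M_def using ab ideal_add[OF is_ideal_m] by blast
  next
    fix c u assume "u \<in> M"
    then obtain a where a: "a \<in> m" "u - a * z \<in> J" by (auto simp: M_def)
    have "c * u - (c * a) * z = c * (u - a * z)" by (simp add: algebra_simps)
    then have "c * u - (c * a) * z \<in> J" using a ideal_times[OF J] by metis
    then show "c * u \<in> M" unfolding M_def using a ideal_times[OF is_ideal_m] by blast
  qed
  have JM: "J \<subseteq> M" unfolding M_def using ideal_0[OF is_ideal_m] by (auto intro!: bexI[of _ 0])
  define F where "F = {L. is_ideal L \<and> M \<subseteq> L \<and> L \<inter> Z \<subseteq> M}"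
  have "M \<in> F" using M by (auto simp: F_def)
  then obtain L where "L \<in> F" and max: "\<And>N. N \<in> F \<Longrightarrow> L \<subseteq> N \<Longrightarrow> N = L"
    by (elim noetherian_maximal[OF noetherian, of F, rotated 2]) (auto simp: F_def)
  then have L: "is_ideal L" "M \<subseteq> L" "L \<inter> Z \<subseteq> M" by (auto simp: F_def)
  have "\<exists>k. x j ^ k \<in> L" if j: "j < d" for j
  proof -
    \<comment> \<open>The colon ideals by powers of \<open>x j\<close> have a maximal member. There,
      adjoining \<open>x j ^ k\<close> to \<open>L\<close> adds no element of \<open>Z\<close>,
      since \<open>x j\<close> maps \<open>Z\<close> into \<open>M\<close>; maximality of
      \<open>L\<close> puts \<open>x j ^ k\<close> into \<open>L\<close>.\<close>
    define G where "G = range (\<lambda>k. colon L {x j ^ k})"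
    obtain N where "N \<in> G" and maxG: "\<And>I. I \<in> G \<Longrightarrow> N \<subseteq> I \<Longrightarrow> I = N"
      by (rule noetherian_maximal[OF noetherian, of G]) (auto simp: G_def is_ideal_colon L)
    then obtain k where k: "N = colon L {x j ^ k}" by (auto simp: G_def)
    have "N \<subseteq> colon L {x j ^ Suc k}"
      using L by (auto simp: k colon_def mult.assoc intro: ideal_times)
    then have eq: "colon L {x j ^ Suc k} = N" unfolding G_def by (intro maxG[unfolded G_def]) blast+
    define N' where "N' = ideal_gen (insert (x j ^ k) L)"
    have "L \<subseteq> N'" "x j ^ k \<in> N'" by (auto simp: N'_def intro: ideal_gen_base)
    have "N' \<inter> Z \<subseteq> L"
    proof
      fix u assume u: "u \<in> N' \<inter> Z"
      then obtain a b where ab: "u - a * x j ^ k \<in> L" "u - b * z \<in> J"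
        by (auto simp: N'_def ideal_gen_insert_ideal L Z)
      have "x j * u - (x j * b) * z = x j * (u - b * z)" by (simp add: algebra_simps)
      then have "x j * u - (x j * b) * z \<in> J" using ab ideal_times[OF J] by metis
      moreover have "x j * b \<in> m" using x_in_m[OF j] is_ideal_m by (auto intro: ideal_times_right)
      ultimately have "x j * u \<in> L" using L unfolding M_def by blast
      then have "x j * u - x j * (u - a * x j ^ k) \<in> L" using ab L by (auto intro: ideal_diff ideal_times)
      then have "a \<in> colon L {x j ^ Suc k}" by (simp add: colon_def algebra_simps)
      then have "a * x j ^ k \<in> L" unfolding eq k by (simp add: colon_def mult.commute)
      then show "u \<in> L" using ab L by (auto intro: ideal_diff_cancel)
    qed
    then have "N' \<in> F" using L \<open>L \<subseteq> N'\<close> by (auto simp: F_def N'_def)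
    then have "N' = L" using max \<open>L \<subseteq> N'\<close> by blast
    then show ?thesis using \<open>x j ^ k \<in> N'\<close> by blast
  qed
  then obtain k where k: "\<And>j. j < d \<Longrightarrow> x j ^ k j \<in> L" by metis
  have "Q (Suc (\<Sum>j<d. k j)) \<subseteq> L"
  proof (rule Q_least[OF L(1)])
    fix i assume i: "i < d"
    have "k i \<le> (\<Sum>j<d. k j)" using i by (intro member_le_sum) auto
    then have "x i ^ Suc (\<Sum>j<d. k j) = x i ^ (Suc (\<Sum>j<d. k j) - k i) * x i ^ k i"
      by (simp flip: power_add)
    then show "x i ^ Suc (\<Sum>j<d. k j) \<in> L" using k[OF i] ideal_times[OF L(1)] by metis
  qed
  then have "z \<in> L" using z[of "\<Sum>j<d. k j"] JM L unfolding isum_def by (auto intro: ideal_add)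
  moreover have "z \<in> Z" by (auto simp: Z_def intro: ideal_gen_base)
  ultimately obtain a where a: "a \<in> m" "z - a * z \<in> J" using L by (auto simp: M_def)
  have "1 - a \<notin> m" using a ideal_diff_cancel[OF is_ideal_m] prime_idealD(2)[OF prime_m] by blast
  moreover have "(1 - a) * z \<in> J" using a by (simp add: algebra_simps)
  ultimately show ?thesis using saturated_m[OF J] by (blast dest: saturatedD)
qed

text \<open>Modulo each \<open>Q e\<close> the decreasing ideals become stationary. An element deep
  enough can therefore be corrected successively, by members of \<open>Q e\<close>, into deeper and
  deeper ideals; the limit lies in every \<open>I k\<close> because \<open>I k\<close> contains
  \<open>Q k\<close>.\<close>

lemma chevalley:
  assumes complete: "adically_complete m"
    and I: "\<And>k. is_ideal (I k)" "\<And>k. Q k \<subseteq> I k" "\<And>i j. i \<le> j \<Longrightarrow> I j \<subseteq> I i"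
  shows "\<exists>k\<ge>n. I k \<subseteq> isum (\<Inter>k. I k) (Q n)"
proof -
  have "\<exists>k. \<forall>i\<ge>k. isum (I i) (Q e) = isum (I k) (Q e)" for e
  proof -
    obtain K l where K: "comp_series m (Q e) K l" using comp_series_Q by blast
    have ideal: "is_ideal (isum (I k) (Q e))" for k using I by (intro is_ideal_isum) auto
    show ?thesis
    proof (rule descending_chain_stabilizes[OF K])
      show "isum (I j) (Q e) \<subseteq> isum (I i) (Q e)" if "i \<le> j" for i j
        using I(3)[OF that] unfolding isum_def by blast
    qed (intro ideal saturated_m isum_right I(1))+
  qed
  then obtain \<kappa> where \<kappa>: "\<And>e i. i \<ge> \<kappa> e \<Longrightarrow> isum (I i) (Q e) = isum (I (\<kappa> e)) (Q e)" by metis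
  \<comment> \<open>Summing makes \<open>r\<close> monotone while keeping it above both
    \<open>\<kappa> e\<close> and \<open>e\<close>.\<close>
  define r where "r e = e + (\<Sum>i\<le>e. \<kappa> i)" for e
  have r: "\<kappa> e \<le> r e" "e \<le> r e" "r e \<le> r (Suc e)" for e
    unfolding r_def by (auto intro: trans_le_add2 member_le_sum)
  have "I (r n) \<subseteq> isum (\<Inter>k. I k) (Q n)"
  proof
    fix u assume u: "u \<in> I (r n)"
    have "\<exists>v. v \<in> I (r (Suc e)) \<and> v - w \<in> Q e" if "w \<in> I (r e)" for e w
    proof -
      have "w \<in> isum (I (r e)) (Q e)" using that isum_left[of "Q e" "I (r e)"] by auto
      also have "\<dots> = isum (I (r (Suc e))) (Q e)" using \<kappa>[of e] r by (metis le_trans)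
      finally obtain v q where "w = v + q" "v \<in> I (r (Suc e))" "q \<in> Q e" unfolding isum_def by blast
      moreover from this have "v - w \<in> Q e" using ideal_minus[OF is_ideal_Q, of q e] by simp
      ultimately show ?thesis by blast
    qed
    then obtain f where f: "\<And>i. f i \<in> I (r (n + i)) \<and> (i = 0 \<longrightarrow> f i = u)" "\<And>i. f (Suc i) - f i \<in> Q (n + i)"
      using dependent_nat_choice[of "\<lambda>i w. w \<in> I (r (n + i)) \<and> (i = 0 \<longrightarrow> w = u)" "\<lambda>i w v. v - w \<in> Q (n + i)"] u
      by (metis add_0_right add_Suc_right nat.distinct(1))
    have "f (Suc i) - f i \<in> ideal_pow m i" for i
      using f(2)[of i] Q_subset_pow[of "n + i"] ideal_pow_antimono[of i "n + i" m] by auto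
    then obtain y where y: "\<And>i. y - f i \<in> ideal_pow m i"
      using complete unfolding adically_complete_def by blast
    \<comment> \<open>The sequence converges \<open>m\<close>-adically, and a high power of
      \<open>m\<close> lies in \<open>Q k\<close>.\<close>
    have near: "\<exists>i\<ge>k. y - f i \<in> Q k" for k
    proof -
      obtain N where "ideal_pow m N \<subseteq> Q k" using pow_subset_Q by blast
      then have "ideal_pow m (N + k) \<subseteq> Q k" using ideal_pow_antimono[of N "N + k" m] by auto
      then show ?thesis using y[of "N + k"] by (intro exI[of _ "N + k"]) auto
    qed
    have "y \<in> I k" for k
    proof -
      obtain i where i: "i \<ge> k" "y - f i \<in> Q k" using near by blast
      have "k \<le> r (n + i)" using i r(2)[of "n + i"] by linarith
      then have "f i \<in> I k" using f(1)[of i] I(3) by blast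
      moreover have "y - f i \<in> I k" using i I(2) by blast
      ultimately show ?thesis using ideal_diff_cancel[OF I(1)] by blast
    qed
    moreover have "f i - u \<in> Q n" for i
    proof (induction i)
      case 0
      then show ?case using f(1)[of 0] ideal_0[OF is_ideal_Q] by simp
    next
      case (Suc i)
      have "f (Suc i) - f i \<in> Q n" using f(2)[of i] Q_antimono[of n "n + i"] by auto
      then have "(f (Suc i) - f i) + (f i - u) \<in> Q n" using Suc ideal_add[OF is_ideal_Q] by blast
      then show ?case by simp
    qed
    moreover obtain i where "y - f i \<in> Q n" using near by blast
    ultimately have "- ((y - f i) + (f i - u)) \<in> Q n" by (intro ideal_minus ideal_add is_ideal_Q)
    then have "u - y \<in> Q n" by simp
    moreover have "u = y + (u - y)" by simp
    ultimately show "u \<in> isum (\<Inter>k. I k) (Q n)" using \<open>\<And>k. y \<in> I k\<close> unfolding isum_def by blast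
  qed
  then show ?thesis using r(2) by blast
qed

end

section \<open>Almost flatness\<close>

lemma lookup_map_zero:
  "f 0 = 0 \<Longrightarrow> Poly_Mapping.lookup (Poly_Mapping.map f v) i = f (Poly_Mapping.lookup v i)"
  by (simp add: map.rep_eq when_def)

lemma lookup_free_scale [simp]:
  "Poly_Mapping.lookup (free_scale a v) i = a * Poly_Mapping.lookup v i"
  by (simp add: free_scale_def lookup_map_zero)

lemma module_free_scale: "module (free_scale :: 'a::comm_ring_1 \<Rightarrow> _)"
  by unfold_locales (auto intro!: poly_mapping_eqI simp: lookup_add algebra_simps)

text \<open>The linear map whose matrix has the columns \<open>col i\<close>; base changes of linear
  maps are of this form over the other ring.\<close>

definition lincomb :: "(nat \<Rightarrow> (nat \<Rightarrow>\<^sub>0 'a)) \<Rightarrow> (nat \<Rightarrow>\<^sub>0 'a::comm_ring_1) \<Rightarrow> (nat \<Rightarrow>\<^sub>0 'a)" where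
  "lincomb col v = (\<Sum>i\<in>Poly_Mapping.keys v. free_scale (Poly_Mapping.lookup v i) (col i))"

lemma lookup_lincomb:
  assumes "finite A" and "Poly_Mapping.keys v \<subseteq> A"
  shows "Poly_Mapping.lookup (lincomb col v) j =
    (\<Sum>i\<in>A. Poly_Mapping.lookup v i * Poly_Mapping.lookup (col i) j)"
  unfolding lincomb_def lookup_sum lookup_free_scale
  using assms by (intro sum.mono_neutral_left) (auto simp: in_keys_iff)

lemma module_hom_lincomb: "module_hom free_scale free_scale (lincomb col)"
proof -
  have "lincomb col (u + v) = lincomb col u + lincomb col v" for u v
  proof (rule poly_mapping_eqI)
    fix j
    let ?A = "Poly_Mapping.keys u \<union> Poly_Mapping.keys v"
    have "Poly_Mapping.keys (u + v) \<subseteq> ?A" by (rule keys_add)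
    then show "Poly_Mapping.lookup (lincomb col (u + v)) j = Poly_Mapping.lookup (lincomb col u + lincomb col v) j"
      unfolding lookup_add by (subst (1 2 3) lookup_lincomb[where A = ?A]) (auto simp: lookup_add algebra_simps sum.distrib)
  qed
  moreover have "lincomb col (free_scale a v) = free_scale a (lincomb col v)" for a v
  proof (rule poly_mapping_eqI)
    fix j
    have "Poly_Mapping.keys (free_scale a v) \<subseteq> Poly_Mapping.keys v" by (auto simp: in_keys_iff)
    then show "Poly_Mapping.lookup (lincomb col (free_scale a v)) j = Poly_Mapping.lookup (free_scale a (lincomb col v)) j"
      unfolding lookup_free_scale by (subst (1 2) lookup_lincomb[where A = "Poly_Mapping.keys v"]) (auto simp: sum_distrib_left mult.assoc)
  qed
  ultimately show ?thesis
    unfolding module_hom_def module_hom_axioms_def using module_free_scale by auto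
qed

lemma lincomb_single: "lincomb col (Poly_Mapping.single i a) = free_scale a (col i)"
proof (rule poly_mapping_eqI)
  fix j
  show "Poly_Mapping.lookup (lincomb col (Poly_Mapping.single i a)) j = Poly_Mapping.lookup (free_scale a (col i)) j"
    by (subst lookup_lincomb[where A = "{i}"]) auto
qed

lemma lincomb_single_one [simp]: "lincomb col (Poly_Mapping.single i 1) = col i"
  by (rule poly_mapping_eqI) (simp add: lincomb_single)

lemma base_change_eq_lincomb:
  "base_change \<phi> D = lincomb (\<lambda>i. Poly_Mapping.map \<phi> (D (Poly_Mapping.single i 1)))"
  by (simp add: fun_eq_iff base_change_def lincomb_def)

text \<open>Keeps resolutions within free modules of countable rank. The coefficients at
  \<open>n\<close> of members supported up to \<open>n\<close> form an ideal; lifting finitely many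
  generators for each \<open>n\<close> gives a countable generating set, because subtracting a
  combination of lifts shortens the support.\<close>

lemma submodule_is_range:
  fixes N :: "(nat \<Rightarrow>\<^sub>0 'a::comm_ring_1) set"
  assumes noeth: "is_noetherian TYPE('a)" and N: "module.subspace free_scale N"
  shows "\<exists>D. module_hom free_scale free_scale D \<and> range D = N"
proof -
  interpret fm: module "free_scale :: 'a \<Rightarrow> _" by (rule module_free_scale)
  define V where "V n = {v \<in> N. Poly_Mapping.keys v \<subseteq> {..n}}" for n
  define L where "L n = (\<lambda>v. Poly_Mapping.lookup v n) ` V n" for n
  have "is_ideal (L n)" for n
  proof (rule is_idealI)
    have "0 \<in> V n" using fm.subspace_0[OF N] by (simp add: V_def)
    then have "Poly_Mapping.lookup 0 n \<in> L n" unfolding L_def by (rule imageI)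
    then show "0 \<in> L n" by simp
  next
    fix a b assume "a \<in> L n" "b \<in> L n"
    then obtain u v where uv: "u \<in> V n" "v \<in> V n" "a = Poly_Mapping.lookup u n" "b = Poly_Mapping.lookup v n"
      by (auto simp: L_def)
    then have "u + v \<in> V n"
      unfolding V_def using fm.subspace_add[OF N] keys_add[of u v] by blast
    then have "Poly_Mapping.lookup (u + v) n \<in> L n" unfolding L_def by (rule imageI)
    then show "a + b \<in> L n" by (simp add: uv lookup_add)
  next
    fix c a assume "a \<in> L n"
    then obtain u where u: "u \<in> V n" "a = Poly_Mapping.lookup u n" by (auto simp: L_def)
    have "Poly_Mapping.keys (free_scale c u) \<subseteq> Poly_Mapping.keys u" by (auto simp: in_keys_iff)
    then have "free_scale c u \<in> V n"
      using u unfolding V_def using fm.subspace_scale[OF N] by blast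
    then have "Poly_Mapping.lookup (free_scale c u) n \<in> L n" unfolding L_def by (rule imageI)
    then show "c * a \<in> L n" by (simp add: u)
  qed
  then have "\<forall>n. \<exists>X. finite X \<and> L n = ideal_gen X" using noeth unfolding is_noetherian_def by blast
  then obtain X where X: "\<And>n. finite (X n)" "\<And>n. L n = ideal_gen (X n)" by metis
  have ex: "\<exists>v. v \<in> V n \<and> Poly_Mapping.lookup v n = a" if "a \<in> X n" for n a
  proof -
    have "a \<in> L n" unfolding X(2) using that by (rule ideal_gen_base)
    then show ?thesis by (auto simp: L_def)
  qed
  define g where "g n a = (SOME v. v \<in> V n \<and> Poly_Mapping.lookup v n = a)" for n a
  have g: "g n a \<in> V n \<and> Poly_Mapping.lookup (g n a) n = a" if "a \<in> X n" for n a
    unfolding g_def using someI_ex[OF ex[OF that]] .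
  \<comment> \<open>Adding 0 makes the set nonempty, so \<open>from_nat_into\<close> enumerates
    exactly this set.\<close>
  define G where "G = insert 0 (\<Union>n. g n ` X n)"
  have "countable G" unfolding G_def using X(1) by (auto intro: countable_finite)
  define e where "e = from_nat_into G"
  have e: "range e = G" unfolding e_def using \<open>countable G\<close> by (intro range_from_nat_into) (auto simp: G_def)
  have GN: "G \<subseteq> N" using g fm.subspace_0[OF N] by (auto simp: G_def V_def)
  interpret h: module_hom free_scale free_scale "lincomb e" by (rule module_hom_lincomb)
  have R: "fm.subspace (range (lincomb e))" by (intro h.subspace_image fm.subspace_UNIV)
  have GR: "G \<subseteq> range (lincomb e)"
  proof
    fix v assume "v \<in> G"
    then obtain i where "v = e i" using e by blast
    then have "v = lincomb e (Poly_Mapping.single i 1)" by simp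
    then show "v \<in> range (lincomb e)" by blast
  qed
  have "range (lincomb e) \<subseteq> N"
  proof
    fix v assume "v \<in> range (lincomb e)"
    then show "v \<in> N"
      unfolding lincomb_def using e GN by (auto intro!: fm.subspace_sum[OF N] fm.subspace_scale[OF N])
  qed
  moreover have "v \<in> range (lincomb e)" if "v \<in> N" "Poly_Mapping.keys v \<subseteq> {..<n}" for n v
    using that
  proof (induction n arbitrary: v)
    case 0
    then have "v = 0" by simp
    then show ?case using GR by (auto simp: G_def)
  next
    case (Suc n)
    then have "v \<in> V n" by (auto simp: V_def lessThan_Suc_atMost)
    then have "Poly_Mapping.lookup v n \<in> ideal_gen (X n)" using X(2)[of n] by (auto simp: L_def)
    then obtain c where c: "Poly_Mapping.lookup v n = (\<Sum>a\<in>X n. c a * a)"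
      using ideal_gen_finite[OF X(1)] by metis
    define w where "w = (\<Sum>a\<in>X n. free_scale (c a) (g n a))"
    have wn: "Poly_Mapping.lookup w n = Poly_Mapping.lookup v n"
      unfolding w_def c lookup_sum lookup_free_scale using g by (intro sum.cong) auto
    have wN: "w \<in> N" unfolding w_def using g by (intro fm.subspace_sum[OF N] fm.subspace_scale[OF N]) (auto simp: V_def)
    have w0: "Poly_Mapping.lookup w i = 0" if "i > n" for i
      unfolding w_def lookup_sum lookup_free_scale
    proof (rule sum.neutral, rule ballI)
      fix a assume "a \<in> X n"
      then have "i \<notin> Poly_Mapping.keys (g n a)" using g[of a n] that by (auto simp: V_def)
      then show "c a * Poly_Mapping.lookup (g n a) i = 0" by (simp add: in_keys_iff)
    qed
    have wR: "w \<in> range (lincomb e)"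
      unfolding w_def using GR by (intro fm.subspace_sum[OF R] fm.subspace_scale[OF R]) (auto simp: G_def)
    have "Poly_Mapping.keys (v - w) \<subseteq> {..<n}"
    proof
      fix i assume i: "i \<in> Poly_Mapping.keys (v - w)"
      show "i \<in> {..<n}"
      proof (rule ccontr)
        assume "i \<notin> {..<n}"
        then consider "i = n" | "i > n" by force
        then have "Poly_Mapping.lookup (v - w) i = 0"
        proof cases
          case 2
          then have "i \<notin> Poly_Mapping.keys v" using Suc.prems(2) by auto
          then show ?thesis using w0[OF 2] by (simp add: lookup_minus in_keys_iff)
        qed (simp add: lookup_minus wn)
        then show False using i by (simp add: in_keys_iff)
      qed
    qed
    then have "v - w \<in> range (lincomb e)"
      using Suc.prems wN fm.subspace_diff[OF N] by (intro Suc.IH) auto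
    then have "(v - w) + w \<in> range (lincomb e)" using wR by (intro fm.subspace_add[OF R])
    then show ?case by simp
  qed
  then have "N \<subseteq> range (lincomb e)"
    by (metis (no_types, lifting) finite_keys finite_nat_set_iff_bounded lessThan_iff subsetI)
  ultimately show ?thesis using module_hom_lincomb by blast
qed

text \<open>Almost flatness is stated for whole free resolutions, so the given map \<open>u\<close>
  is prolonged to one with \<open>D 0 = u\<close>, each further map being chosen onto the previous
  kernel.\<close>

lemma almost_flat_syzygies:
  fixes \<phi> :: "'a::comm_ring_1 \<Rightarrow> 'b::comm_ring_1"
  assumes noeth: "is_noetherian TYPE('a)" and flat: "is_almost_flat \<phi> \<pi>"
    and u: "module_hom free_scale free_scale u" and v: "base_change \<phi> u v = 0" and "k > 0"
  shows "\<exists>E w. range E = {z. u z = 0} \<and> free_scale (\<pi> k) v = base_change \<phi> E w"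
proof -
  define next_hom where "next_hom D = (SOME E. module_hom free_scale free_scale E \<and> range E = {z. D z = 0})"
    for D :: "(nat \<Rightarrow>\<^sub>0 'a) \<Rightarrow> (nat \<Rightarrow>\<^sub>0 'a)"
  have next_hom: "module_hom free_scale free_scale (next_hom D) \<and> range (next_hom D) = {z. D z = 0}"
    if D: "module_hom free_scale free_scale D" for D
  proof -
    interpret D: module_hom free_scale free_scale D by (rule D)
    have "D.m1.subspace {z. D z = 0}" by (rule D.subspace_kernel)
    then show ?thesis unfolding next_hom_def by (rule someI_ex[OF submodule_is_range[OF noeth]])
  qed
  define D where "D = rec_nat u (\<lambda>_. next_hom)"
  have D: "D 0 = u" "\<And>i. D (Suc i) = next_hom (D i)" by (simp_all add: D_def)
  have hom: "module_hom free_scale free_scale (D i)" for i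
    by (induction i) (use u next_hom in \<open>auto simp: D\<close>)
  interpret u: module_hom free_scale free_scale u by (rule u)
  have "is_free_resolution (range (D 0)) D"
    unfolding is_free_resolution_def using hom next_hom by (auto simp: D(2))
  moreover have "u.m1.subspace (range (D 0))"
    unfolding D by (intro u.subspace_image u.m1.subspace_UNIV)
  ultimately have "free_scale (\<pi> k) v \<in> range (base_change \<phi> (D (Suc 0)))"
    using flat v \<open>k > 0\<close> D(1) unfolding is_almost_flat_def by metis
  moreover have "range (D (Suc 0)) = {z. u z = 0}" using next_hom[OF hom, of 0] D by simp
  ultimately show ?thesis by blast
qed

lemma ring_hom_simps:
  assumes "is_ring_hom \<phi>"
  shows "\<phi> 0 = 0" and "\<phi> 1 = 1" and "\<phi> (a + b) = \<phi> a + \<phi> b" and "\<phi> (a * b) = \<phi> a * \<phi> b"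
    and "\<phi> (- a) = - \<phi> a" and "\<phi> (a - b) = \<phi> a - \<phi> b" and "\<phi> (a ^ n) = \<phi> a ^ n"
    and "\<phi> (sum f A) = (\<Sum>i\<in>A. \<phi> (f i))" and "\<phi> (prod f A) = (\<Prod>i\<in>A. \<phi> (f i))"
proof -
  have *: "\<phi> 1 = 1" "\<And>a b. \<phi> (a + b) = \<phi> a + \<phi> b" "\<And>a b. \<phi> (a * b) = \<phi> a * \<phi> b"
    using assms by (auto simp: is_ring_hom_def)
  interpret additive \<phi> by standard (rule *)
  show "\<phi> 0 = 0" "\<phi> 1 = 1" "\<phi> (a + b) = \<phi> a + \<phi> b" "\<phi> (a * b) = \<phi> a * \<phi> b"
    "\<phi> (- a) = - \<phi> a" "\<phi> (a - b) = \<phi> a - \<phi> b" "\<phi> (sum f A) = (\<Sum>i\<in>A. \<phi> (f i))"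
    using * zero minus diff sum by auto
  show "\<phi> (a ^ n) = \<phi> a ^ n" by (induction n) (auto simp: *)
  show "\<phi> (prod f A) = (\<Prod>i\<in>A. \<phi> (f i))"
    by (induction A rule: infinite_finite_induct) (auto simp: *)
qed

lemma ideal_gen_image_gen:
  assumes "is_ring_hom \<phi>"
  shows "ideal_gen (\<phi> ` ideal_gen X) = ideal_gen (\<phi> ` X)"
proof (rule antisym)
  note [simp] = ring_hom_simps[OF assms]
  have "is_ideal {a. \<phi> a \<in> ideal_gen (\<phi> ` X)}"
    by (rule is_idealI) (auto intro: ideal_add ideal_times ideal_0)
  then have "ideal_gen X \<subseteq> {a. \<phi> a \<in> ideal_gen (\<phi> ` X)}"
    by (rule ideal_gen_least) (auto intro: ideal_gen_base)
  then show "ideal_gen (\<phi> ` ideal_gen X) \<subseteq> ideal_gen (\<phi> ` X)"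
    by (intro ideal_gen_least) auto
qed (intro ideal_gen_mono image_mono subsetI ideal_gen_base)

text \<open>The conditions \<open>\<phi> (y i) * u = \<Sum>j. w i j * \<phi> (q j)\<close> form a system of linear equations over \<open>A\<close> in
  the unknowns \<open>u\<close> (with index 0) and \<open>w i j\<close> (with index \<open>Suc (prod_encode (i, j))\<close>). By almost
  flatness, a solution in \<open>B\<close> is almost a combination of solutions in \<open>A\<close>, whose components of index 0
  lie in the colon ideal.\<close>

lemma almost_flat_colon_generators:
  fixes \<phi> :: "'a::comm_ring_1 \<Rightarrow> 'b::comm_ring_1" and q y :: "nat \<Rightarrow> 'a"
  assumes noeth: "is_noetherian TYPE('a)" and hom: "is_ring_hom \<phi>" and flat: "is_almost_flat \<phi> \<pi>"
    and u: "\<And>i. i < l \<Longrightarrow> \<phi> (y i) * u \<in> ideal_gen (\<phi> ` q ` {..<r})" and "k > 0"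
  shows "\<pi> k * u \<in> ideal_gen (\<phi> ` colon (ideal_gen (q ` {..<r})) (y ` {..<l}))"
proof -
  note [simp] = ring_hom_simps[OF hom]
  have "\<exists>c. \<phi> (y i) * u = (\<Sum>j<r. c j * \<phi> (q j))" if "i < l" for i
    using u[OF that] ideal_gen_image_finite[of "{..<r}" _ "\<lambda>j. \<phi> (q j)"] by (auto simp: image_image)
  then obtain w where w: "\<And>i. i < l \<Longrightarrow> \<phi> (y i) * u = (\<Sum>j<r. w i j * \<phi> (q j))" by metis
  \<comment> \<open>Column 0 has the entries \<open>y i\<close>; the column of \<open>w i j\<close>
    has \<open>- q j\<close> in row \<open>i\<close>. At the remaining indices of the infinite basis
    the columns are zero.\<close>
  define col where "col t = (case t of 0 \<Rightarrow> (\<Sum>i<l. Poly_Mapping.single i (y i))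
    | Suc t \<Rightarrow> (case prod_decode t of (i, j) \<Rightarrow> if i < l \<and> j < r then Poly_Mapping.single i (- q j) else 0))" for t
  define \<psi> where "\<psi> = lincomb col"
  have \<psi>: "module_hom free_scale free_scale \<psi>" unfolding \<psi>_def by (rule module_hom_lincomb)
  have bc: "base_change \<phi> \<psi> = lincomb (\<lambda>t. Poly_Mapping.map \<phi> (col t))"
    by (simp add: base_change_eq_lincomb \<psi>_def)
  interpret b: module_hom free_scale free_scale "base_change \<phi> \<psi>"
    unfolding bc by (rule module_hom_lincomb)
  define v where "v = Poly_Mapping.single 0 u
    + (\<Sum>i<l. \<Sum>j<r. Poly_Mapping.single (Suc (prod_encode (i, j))) (w i j))"
  have col0: "Poly_Mapping.lookup (col 0) i = (if i < l then y i else 0)" for i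
    by (simp add: col_def lookup_sum lookup_single when_def)
  have colS: "Poly_Mapping.lookup (col (Suc t)) i \<in> ideal_gen (q ` {..<r})" for t i
  proof -
    have "- q j \<in> ideal_gen (q ` {..<r})" if "j < r" for j
      using that by (intro ideal_minus is_ideal_gen ideal_gen_base) simp
    then show ?thesis
      by (auto simp: col_def lookup_single when_def ideal_0 split: prod.splits)
  qed
  have "base_change \<phi> \<psi> v = 0"
  proof (rule poly_mapping_eqI)
    fix i
    have "base_change \<phi> \<psi> v = free_scale u (Poly_Mapping.map \<phi> (col 0))
      + (\<Sum>i<l. \<Sum>j<r. free_scale (w i j) (Poly_Mapping.map \<phi> (col (Suc (prod_encode (i, j))))))"
      unfolding v_def by (simp only: b.add b.sum) (simp add: bc lincomb_single)
    then have "Poly_Mapping.lookup (base_change \<phi> \<psi> v) i = u * \<phi> (if i < l then y i else 0)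
      + (\<Sum>i'<l. \<Sum>j<r. w i' j * \<phi> (if i' = i then - q j else 0))"
      by (simp add: lookup_add lookup_sum lookup_map_zero col0) 
        (simp add: col_def lookup_single when_def)
    also have "(\<Sum>i'<l. \<Sum>j<r. w i' j * \<phi> (if i' = i then - q j else 0))
      = (\<Sum>i'<l. if i' = i then - (\<Sum>j<r. w i j * \<phi> (q j)) else 0)"
      by (intro sum.cong) (auto simp: sum_negf)
    also have "u * \<phi> (if i < l then y i else 0) + \<dots> = 0"
      using w[of i] by (simp add: mult.commute)
    finally show "Poly_Mapping.lookup (base_change \<phi> \<psi> v) i = Poly_Mapping.lookup 0 i" by simp
  qed
  then obtain E z where E: "range E = {z. \<psi> z = 0}" "free_scale (\<pi> k) v = base_change \<phi> E z"
    using almost_flat_syzygies[OF noeth flat \<psi> _ \<open>k > 0\<close>] by blast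
  have ker: "Poly_Mapping.lookup z 0 \<in> colon (ideal_gen (q ` {..<r})) (y ` {..<l})" if z: "\<psi> z = 0" for z
  proof -
    have "y i * Poly_Mapping.lookup z 0 \<in> ideal_gen (q ` {..<r})" if i: "i < l" for i
    proof -
      let ?A = "Poly_Mapping.keys z - {0}"
      have "0 = Poly_Mapping.lookup (\<psi> z) i" by (simp add: z)
      also have "\<dots> = (\<Sum>t\<in>insert 0 ?A. Poly_Mapping.lookup z t * Poly_Mapping.lookup (col t) i)"
        unfolding \<psi>_def by (rule lookup_lincomb) auto
      also have "\<dots> = y i * Poly_Mapping.lookup z 0
          + (\<Sum>t\<in>?A. Poly_Mapping.lookup z t * Poly_Mapping.lookup (col t) i)"
        by (subst sum.insert) (auto simp: col0 i mult.commute)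
      finally have eq: "y i * Poly_Mapping.lookup z 0
          = - (\<Sum>t\<in>?A. Poly_Mapping.lookup z t * Poly_Mapping.lookup (col t) i)"
        by (simp add: eq_neg_iff_add_eq_0)
      have "Poly_Mapping.lookup (col t) i \<in> ideal_gen (q ` {..<r})" if "t \<in> ?A" for t
        using colS[of "t - 1" i] that by (cases t) auto
      then show ?thesis
        unfolding eq by (intro ideal_minus ideal_sum ideal_times is_ideal_gen)
    qed
    then show ?thesis by (auto simp: colon_def)
  qed
  \<comment> \<open>Coordinate 0 recovers \<open>u\<close>; the same coordinate of every column of
    \<open>E\<close> lies in the colon ideal by \<open>ker\<close>.\<close>
  have "Poly_Mapping.lookup v 0 = u"
    by (simp add: v_def lookup_add lookup_sum lookup_single)
  then have "\<pi> k * u = Poly_Mapping.lookup (free_scale (\<pi> k) v) 0" by simp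
  also have "\<dots> = (\<Sum>t\<in>Poly_Mapping.keys z. Poly_Mapping.lookup z t
      * \<phi> (Poly_Mapping.lookup (E (Poly_Mapping.single t 1)) 0))"
    unfolding E(2) base_change_eq_lincomb
    by (subst lookup_lincomb[of "Poly_Mapping.keys z"]) (auto simp: lookup_map_zero)
  also have "\<dots> \<in> ideal_gen (\<phi> ` colon (ideal_gen (q ` {..<r})) (y ` {..<l}))"
    using E(1) by (intro ideal_sum ideal_times is_ideal_gen ideal_gen_base imageI ker) auto
  finally show ?thesis .
qed

text \<open>Finitely many generators replace \<open>I\<close> and \<open>J\<close>, which turns the
  condition into the linear system treated before: colon ideals almost commute with extension along
  \<open>\<phi>\<close>.\<close>

lemma almost_flat_colon:
  fixes \<phi> :: "'a::comm_ring_1 \<Rightarrow> 'b::comm_ring_1"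
  assumes noeth: "is_noetherian TYPE('a)" and hom: "is_ring_hom \<phi>" and flat: "is_almost_flat \<phi> \<pi>"
    and I: "is_ideal I" and u: "\<And>y. y \<in> J \<Longrightarrow> \<phi> y * u \<in> ideal_gen (\<phi> ` I)" and "k > 0"
  shows "\<pi> k * u \<in> ideal_gen (\<phi> ` colon I J)"
proof -
  have gens: "\<exists>f (n::nat). K = ideal_gen (f ` {..<n})" if "is_ideal K" for K :: "'a set"
  proof -
    obtain X where "finite X" "K = ideal_gen X" using noeth \<open>is_ideal K\<close> unfolding is_noetherian_def by blast
    moreover obtain f and n :: nat where "X = f ` {i. i < n}"
      using finite_imp_nat_seg_image_inj_on[OF \<open>finite X\<close>] by blast
    ultimately show ?thesis unfolding lessThan_def by blast
  qed
  obtain q r where q: "I = ideal_gen (q ` {..<r::nat})" using gens I by blast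
  obtain y l where y: "ideal_gen J = ideal_gen (y ` {..<l::nat})" using gens[OF is_ideal_gen] by blast
  have I': "ideal_gen (\<phi> ` q ` {..<r}) = ideal_gen (\<phi> ` I)"
    unfolding q ideal_gen_image_gen[OF hom] ..
  have "is_ideal {a. \<phi> a * u \<in> ideal_gen (\<phi> ` I)}"
    using ring_hom_simps[OF hom]
    by (intro is_idealI) (auto simp: distrib_right mult.assoc intro: ideal_add ideal_times ideal_0)
  then have "ideal_gen J \<subseteq> {a. \<phi> a * u \<in> ideal_gen (\<phi> ` I)}"
    using u by (intro ideal_gen_least) auto
  then have "\<phi> (y i) * u \<in> ideal_gen (\<phi> ` q ` {..<r})" if "i < l" for i
    using that ideal_gen_base[of "y i" "y ` {..<l}"] unfolding y I' by auto
  then have "\<pi> k * u \<in> ideal_gen (\<phi> ` colon I (y ` {..<l}))"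
    unfolding q by (rule almost_flat_colon_generators[OF noeth hom flat _ \<open>k > 0\<close>])
  also have "colon I (y ` {..<l}) = colon I J"
    using colon_ideal_gen[OF I] y by metis
  finally show ?thesis .
qed

section \<open>Top local cohomology\<close>

text \<open>Vanishing of the fraction with numerator \<open>v\<close> and denominator the
  \<open>n\<close>-th power of the product, computed in the direct limit of quotients by powers of
  the generators; \<open>cech_cohomologous_top\<close> relates it to coboundaries.\<close>

definition lc_vanishes :: "('a::comm_ring_1 \<Rightarrow> 'b::comm_ring_1) \<Rightarrow> 'a list \<Rightarrow> 'b \<Rightarrow> nat \<Rightarrow> bool" where
  "lc_vanishes \<phi> xs v n \<longleftrightarrow>
     (\<exists>k. (\<Prod>i<length xs. \<phi> (xs ! i)) ^ k * v \<in> ideal_gen ((\<lambda>i. \<phi> (xs ! i) ^ (n + k)) ` {..<length xs}))"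

lemma lc_vanishes_eventually:
  assumes "lc_vanishes \<phi> xs v n"
  shows "\<exists>k. \<forall>l\<ge>k. (\<Prod>i<length xs. \<phi> (xs ! i)) ^ l * v
    \<in> ideal_gen ((\<lambda>i. \<phi> (xs ! i) ^ (n + l)) ` {..<length xs})"
proof -
  let ?X = "\<Prod>i<length xs. \<phi> (xs ! i)"
  obtain k where k: "?X ^ k * v \<in> ideal_gen ((\<lambda>i. \<phi> (xs ! i) ^ (n + k)) ` {..<length xs})"
    using assms unfolding lc_vanishes_def by blast
  have "?X ^ l * v \<in> ideal_gen ((\<lambda>i. \<phi> (xs ! i) ^ (n + l)) ` {..<length xs})" if "l \<ge> k" for l
  proof -
    have "?X ^ (l - k) * (?X ^ k * v) = ?X ^ l * v" using that by (simp flip: power_add mult.assoc)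
    then show ?thesis using prod_power_shift[OF k, of "l - k"] that by simp
  qed
  then show ?thesis by blast
qed

lemma lc_vanishes_0: "lc_vanishes \<phi> xs 0 n"
  unfolding lc_vanishes_def by (simp add: ideal_0)

lemma lc_vanishes_times: "lc_vanishes \<phi> xs v n \<Longrightarrow> lc_vanishes \<phi> xs (b * v) n"
  unfolding lc_vanishes_def using ideal_times[OF is_ideal_gen] by (metis mult.left_commute)

lemma lc_vanishes_minus: "lc_vanishes \<phi> xs v n \<Longrightarrow> lc_vanishes \<phi> xs (- v) n"
  using lc_vanishes_times[of \<phi> xs v n "- 1"] by simp

lemma lc_vanishes_add:
  assumes "lc_vanishes \<phi> xs v n" and "lc_vanishes \<phi> xs w n"
  shows "lc_vanishes \<phi> xs (v + w) n"
proof -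
  obtain k l where "\<forall>i\<ge>k. (\<Prod>i<length xs. \<phi> (xs ! i)) ^ i * v \<in> ideal_gen ((\<lambda>j. \<phi> (xs ! j) ^ (n + i)) ` {..<length xs})"
    "\<forall>i\<ge>l. (\<Prod>i<length xs. \<phi> (xs ! i)) ^ i * w \<in> ideal_gen ((\<lambda>j. \<phi> (xs ! j) ^ (n + i)) ` {..<length xs})"
    using lc_vanishes_eventually assms by metis
  then show ?thesis
    unfolding lc_vanishes_def by (intro exI[of _ "k + l"]) (simp add: distrib_left ideal_add)
qed

lemma lc_vanishes_shift:
  "lc_vanishes \<phi> xs ((\<Prod>i<length xs. \<phi> (xs ! i)) ^ k * v) (n + k) \<longleftrightarrow> lc_vanishes \<phi> xs v n"
proof
  let ?X = "\<Prod>i<length xs. \<phi> (xs ! i)"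
  assume "lc_vanishes \<phi> xs (?X ^ k * v) (n + k)"
  then obtain l where "?X ^ l * (?X ^ k * v) \<in> ideal_gen ((\<lambda>i. \<phi> (xs ! i) ^ (n + k + l)) ` {..<length xs})"
    unfolding lc_vanishes_def by blast
  then have "?X ^ (k + l) * v \<in> ideal_gen ((\<lambda>i. \<phi> (xs ! i) ^ (n + (k + l))) ` {..<length xs})"
    by (simp add: power_add mult_ac)
  then show "lc_vanishes \<phi> xs v n" unfolding lc_vanishes_def by blast
next
  let ?X = "\<Prod>i<length xs. \<phi> (xs ! i)"
  assume "lc_vanishes \<phi> xs v n"
  then obtain l where "?X ^ (l + k) * v \<in> ideal_gen ((\<lambda>i. \<phi> (xs ! i) ^ (n + (l + k))) ` {..<length xs})"
    using lc_vanishes_eventually le_add1 by metis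
  then have "?X ^ l * (?X ^ k * v) \<in> ideal_gen ((\<lambda>i. \<phi> (xs ! i) ^ (n + k + l)) ` {..<length xs})"
    by (simp add: power_add mult_ac)
  then show "lc_vanishes \<phi> xs (?X ^ k * v) (n + k)" unfolding lc_vanishes_def by blast
qed

section \<open>Cech classes in top degree\<close>

context
  fixes \<phi> :: "'a::comm_ring_1 \<Rightarrow> 'b::comm_ring_1" and xs :: "'a list"
  assumes hom: "is_ring_hom \<phi>"
begin

lemma cech_cocycles_top: "cech_cocycles (\<lambda>a z. \<phi> a * z) xs (length xs) = UNIV"
proof -
  have False if "S \<subseteq> {..<length xs}" "card S = Suc (length xs)" for S
    using card_mono[OF _ that(1)] that(2) by simp
  then show ?thesis by (auto simp: cech_cocycles_def cech_eq_def split: prod.splits)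
qed

text \<open>Only the component at the full index set remains, and its coboundaries are sums of
  multiples of \<open>\<phi> (xs ! j) ^ k\<close> over a common denominator; clearing denominators
  gives membership in an ideal of powers.\<close>

lemma cech_cohomologous_top:
  "((c, n), (c', n')) \<in> cech_cohomologous (\<lambda>a z. \<phi> a * z) xs (length xs) \<longleftrightarrow>
   lc_vanishes \<phi> xs ((\<Prod>i<length xs. \<phi> (xs ! i)) ^ n' * c {..<length xs}
      - (\<Prod>i<length xs. \<phi> (xs ! i)) ^ n * c' {..<length xs}) (n + n')"
proof -
  note [simp] = ring_hom_simps[OF hom]
  let ?T = "{..<length xs}" and ?X = "\<Prod>i<length xs. \<phi> (xs ! i)"
  let ?w = "?X ^ n' * c ?T - ?X ^ n * c' ?T" and ?N = "n + n'"
  let ?sg = "\<lambda>j. (- 1) ^ card {l \<in> ?T. l < j} :: 'b"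
  have top: "S \<subseteq> ?T \<and> card S = length xs \<longleftrightarrow> S = ?T" for S
    using card_subset_eq[of ?T S] by auto
  have X: "\<phi> (cech_denom xs ?T) = ?X" by (simp add: cech_denom_def)
  have "((c, n), (c', n')) \<in> cech_cohomologous (\<lambda>a z. \<phi> a * z) xs (length xs) \<longleftrightarrow>
    (\<exists>b k l. ?X ^ l * (?X ^ k * ?w - ?X ^ ?N * (\<Sum>j<length xs. ?sg j * \<phi> (xs ! j) ^ k * b (?T - {j}))) = 0)"
    unfolding cech_cohomologous_def cech_cocycles_top cech_eq_def cech_minus_def cech_diff_def top
    by (auto simp: X mult.assoc)
  also have "\<dots> \<longleftrightarrow> lc_vanishes \<phi> xs ?w ?N"
  proof
    assume "\<exists>b k l. ?X ^ l * (?X ^ k * ?w - ?X ^ ?N * (\<Sum>j<length xs. ?sg j * \<phi> (xs ! j) ^ k * b (?T - {j}))) = 0"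
    then obtain b k l where
      "?X ^ l * (?X ^ k * ?w - ?X ^ ?N * (\<Sum>j<length xs. ?sg j * \<phi> (xs ! j) ^ k * b (?T - {j}))) = 0" by blast
    then have eq: "?X ^ (l + k) * ?w = ?X ^ (l + ?N) * (\<Sum>j<length xs. ?sg j * \<phi> (xs ! j) ^ k * b (?T - {j}))"
      by (simp add: right_diff_distrib power_add mult.assoc)
    have "(\<Sum>j<length xs. ?sg j * \<phi> (xs ! j) ^ k * b (?T - {j})) \<in> ideal_gen ((\<lambda>j. \<phi> (xs ! j) ^ k) ` ?T)"
      by (intro ideal_sum is_ideal_gen ideal_times_right ideal_times ideal_gen_base) auto
    then have "?X ^ (l + ?N) * (\<Sum>j<length xs. ?sg j * \<phi> (xs ! j) ^ k * b (?T - {j}))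
        \<in> ideal_gen ((\<lambda>j. \<phi> (xs ! j) ^ (k + (l + ?N))) ` ?T)"
      by (rule prod_power_shift)
    then have "?X ^ (l + k) * ?w \<in> ideal_gen ((\<lambda>j. \<phi> (xs ! j) ^ (?N + (l + k))) ` ?T)"
      unfolding eq by (simp add: add_ac)
    then show "lc_vanishes \<phi> xs ?w ?N" unfolding lc_vanishes_def by blast
  next
    assume "lc_vanishes \<phi> xs ?w ?N"
    then obtain k a where a: "?X ^ k * ?w = (\<Sum>j<length xs. a j * \<phi> (xs ! j) ^ (?N + k))"
      unfolding lc_vanishes_def by (auto simp: ideal_gen_image_finite)
    \<comment> \<open>For \<open>S\<close> missing only \<open>j\<close>, the minimum of the
      complement is \<open>j\<close>. The sign cancels the one in the differential, as its square is
      1.\<close>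
    define b where "b S = ?sg (Min (?T - S)) * a (Min (?T - S))" for S
    have b: "b (?T - {j}) = ?sg j * a j" if "j < length xs" for j
    proof -
      have "?T - (?T - {j}) = {j}" using that by auto
      then show ?thesis by (simp add: b_def)
    qed
    have "(\<Sum>j<length xs. ?sg j * \<phi> (xs ! j) ^ (?N + k) * b (?T - {j})) = ?X ^ k * ?w"
      unfolding a
    proof (rule sum.cong)
      fix j assume "j \<in> ?T"
      moreover have "?sg j * ?sg j = 1" by (simp flip: power_mult_distrib)
      ultimately show "?sg j * \<phi> (xs ! j) ^ (?N + k) * b (?T - {j}) = a j * \<phi> (xs ! j) ^ (?N + k)"
        by (simp add: b mult_ac)
    qed simp
    then have "?X ^ 0 * (?X ^ (?N + k) * ?w - ?X ^ ?N * (\<Sum>j<length xs. ?sg j * \<phi> (xs ! j) ^ (?N + k) * b (?T - {j}))) = 0"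
      by (simp add: power_add mult.assoc)
    then show "\<exists>b k l. ?X ^ l * (?X ^ k * ?w - ?X ^ ?N * (\<Sum>j<length xs. ?sg j * \<phi> (xs ! j) ^ k * b (?T - {j}))) = 0"
      by blast
  qed
  finally show ?thesis .
qed

lemma equiv_cech_cohomologous_top:
  "equiv UNIV (cech_cohomologous (\<lambda>a z. \<phi> a * z) xs (length xs))"
proof (rule equivI)
  let ?X = "\<Prod>i<length xs. \<phi> (xs ! i)"
  show "cech_cohomologous (\<lambda>a z. \<phi> a * z) xs (length xs) \<subseteq> UNIV \<times> UNIV" by simp
  show "refl_on UNIV (cech_cohomologous (\<lambda>a z. \<phi> a * z) xs (length xs))"
    by (auto simp: refl_on_def cech_cohomologous_top lc_vanishes_0)
  show "sym (cech_cohomologous (\<lambda>a z. \<phi> a * z) xs (length xs))"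
  proof (rule symI, safe)
    fix c n c' n'
    assume "((c, n), (c', n')) \<in> cech_cohomologous (\<lambda>a z. \<phi> a * z) xs (length xs)"
    then have "lc_vanishes \<phi> xs (- (?X ^ n' * c {..<length xs} - ?X ^ n * c' {..<length xs})) (n + n')"
      unfolding cech_cohomologous_top by (rule lc_vanishes_minus)
    then show "((c', n'), (c, n)) \<in> cech_cohomologous (\<lambda>a z. \<phi> a * z) xs (length xs)"
      unfolding cech_cohomologous_top by (simp add: add.commute)
  qed
  show "trans (cech_cohomologous (\<lambda>a z. \<phi> a * z) xs (length xs))"
  proof (rule transI, safe)
    fix c n c' n' c'' n''
    assume "((c, n), (c', n')) \<in> cech_cohomologous (\<lambda>a z. \<phi> a * z) xs (length xs)"
      "((c', n'), (c'', n'')) \<in> cech_cohomologous (\<lambda>a z. \<phi> a * z) xs (length xs)"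
    then have "lc_vanishes \<phi> xs (?X ^ n'' * (?X ^ n' * c {..<length xs} - ?X ^ n * c' {..<length xs})) (n + n' + n'')"
      "lc_vanishes \<phi> xs (?X ^ n * (?X ^ n'' * c' {..<length xs} - ?X ^ n' * c'' {..<length xs})) (n' + n'' + n)"
      by (simp_all add: cech_cohomologous_top lc_vanishes_shift)
    then have "lc_vanishes \<phi> xs (?X ^ n'' * (?X ^ n' * c {..<length xs} - ?X ^ n * c' {..<length xs})
      + ?X ^ n * (?X ^ n'' * c' {..<length xs} - ?X ^ n' * c'' {..<length xs})) (n + n' + n'')"
      by (intro lc_vanishes_add) (simp_all add: add_ac)
    then have "lc_vanishes \<phi> xs (?X ^ n' * (?X ^ n'' * c {..<length xs} - ?X ^ n * c'' {..<length xs})) (n + n'' + n')"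
      by (simp add: algebra_simps)
    then show "((c, n), (c'', n'')) \<in> cech_cohomologous (\<lambda>a z. \<phi> a * z) xs (length xs)"
      by (simp only: cech_cohomologous_top lc_vanishes_shift)
  qed
qed

lemma cech_class_eq_zero:
  "cech_cohomologous (\<lambda>a z. \<phi> a * z) xs (length xs) `` {(c, n)} = lc_zero (\<lambda>a z. \<phi> a * z) xs (length xs)
    \<longleftrightarrow> lc_vanishes \<phi> xs (c {..<length xs}) n"
  unfolding lc_zero_def cech_zero_def
  using equiv_class_eq_iff[OF equiv_cech_cohomologous_top, of "(c, n)" "((\<lambda>_. 0), 0)"]
  by (simp add: cech_cohomologous_top)

lemma lc_map_class:
  assumes r: "equiv UNIV r" and u: "\<And>c n c' n'. ((c, n), (c', n')) \<in> r \<Longrightarrow>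
    ((u \<circ> c, n), (u \<circ> c', n')) \<in> cech_cohomologous (\<lambda>a z. \<phi> a * z) xs (length xs)"
  shows "lc_map (\<lambda>a z. \<phi> a * z) xs (length xs) u (r `` {(c, n)}) =
    cech_cohomologous (\<lambda>a z. \<phi> a * z) xs (length xs) `` {(u \<circ> c, n)}"
proof -
  let ?r = "cech_cohomologous (\<lambda>a z. \<phi> a * z) xs (length xs)" and ?u = "\<lambda>(c, n). (u \<circ> c, n)"
  have "?r `` {?u z} = ?r `` {(u \<circ> c, n)}" if "z \<in> r `` {(c, n)}" for z
    using that u[of c n "fst z" "snd z"] equiv_class_eq[OF equiv_cech_cohomologous_top] by (cases z) auto
  moreover have "(c, n) \<in> r `` {(c, n)}" using r by (auto simp: equiv_def refl_on_def)
  ultimately show ?thesis unfolding lc_map_def by blast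
qed

lemma lc_map_times:
  "lc_map (\<lambda>a z. \<phi> a * z) xs (length xs) ((*) b)
     (cech_cohomologous (\<lambda>a z. \<phi> a * z) xs (length xs) `` {(c, n)}) =
   cech_cohomologous (\<lambda>a z. \<phi> a * z) xs (length xs) `` {((*) b \<circ> c, n)}"
proof (rule lc_map_class[OF equiv_cech_cohomologous_top])
  fix c :: "nat set \<Rightarrow> 'b" and n c' n'
  let ?X = "\<Prod>i<length xs. \<phi> (xs ! i)"
  assume "((c, n), (c', n')) \<in> cech_cohomologous (\<lambda>a z. \<phi> a * z) xs (length xs)"
  then have "lc_vanishes \<phi> xs (b * (?X ^ n' * c {..<length xs} - ?X ^ n * c' {..<length xs})) (n + n')"
    by (intro lc_vanishes_times) (simp add: cech_cohomologous_top)
  then show "(((*) b \<circ> c, n), ((*) b \<circ> c', n')) \<in> cech_cohomologous (\<lambda>a z. \<phi> a * z) xs (length xs)"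
    by (simp add: cech_cohomologous_top right_diff_distrib mult.left_commute)
qed

end

lemma is_ring_hom_id: "is_ring_hom (\<lambda>a. a)"
  by (simp add: is_ring_hom_def)

lemma lc_vanishes_hom:
  assumes hom: "is_ring_hom \<phi>" and "lc_vanishes (\<lambda>a. a) xs v n"
  shows "lc_vanishes \<phi> xs (\<phi> v) n"
proof -
  note [simp] = ring_hom_simps[OF hom]
  obtain k where k: "(\<Prod>i<length xs. xs ! i) ^ k * v \<in> ideal_gen ((\<lambda>i. (xs ! i) ^ (n + k)) ` {..<length xs})"
    using assms(2) unfolding lc_vanishes_def by blast
  have "\<phi> ((\<Prod>i<length xs. xs ! i) ^ k * v) \<in> ideal_gen (\<phi> ` ideal_gen ((\<lambda>i. (xs ! i) ^ (n + k)) ` {..<length xs}))"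
    by (rule ideal_gen_base[OF imageI[OF k]])
  then have "(\<Prod>i<length xs. \<phi> (xs ! i)) ^ k * \<phi> v \<in> ideal_gen ((\<lambda>i. \<phi> (xs ! i) ^ (n + k)) ` {..<length xs})"
    by (simp add: ideal_gen_image_gen[OF hom] image_image)
  then show ?thesis unfolding lc_vanishes_def by blast
qed

lemma lc_map_hom:
  assumes hom: "is_ring_hom \<phi>"
  shows "lc_map (\<lambda>a z. \<phi> a * z) xs (length xs) \<phi> (cech_cohomologous (*) xs (length xs) `` {(c, n)}) =
    cech_cohomologous (\<lambda>a z. \<phi> a * z) xs (length xs) `` {(\<phi> \<circ> c, n)}"
proof (rule lc_map_class[OF hom equiv_cech_cohomologous_top[OF is_ring_hom_id]])
  note [simp] = ring_hom_simps[OF hom]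
  fix c n c' n'
  assume "((c, n), (c', n')) \<in> cech_cohomologous (*) xs (length xs)"
  then show "((\<phi> \<circ> c, n), (\<phi> \<circ> c', n')) \<in> cech_cohomologous (\<lambda>a z. \<phi> a * z) xs (length xs)"
    unfolding cech_cohomologous_top[OF hom] cech_cohomologous_top[OF is_ring_hom_id]
    by (auto dest: lc_vanishes_hom[OF hom])
qed

lemma almost_kills_class:
  assumes hom: "is_ring_hom \<phi>"
  shows "almost_kills \<phi> \<pi> xs (length xs) b (cech_cohomologous (*) xs (length xs) `` {(c, n)}) \<longleftrightarrow>
    (\<forall>k>0. lc_vanishes \<phi> xs (\<pi> k * (b * \<phi> (c {..<length xs}))) n)"
  unfolding almost_kills_def Let_def lc_map_hom[OF hom] lc_map_times[OF hom] cech_class_eq_zero[OF hom]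
  by simp

lemma times_class_eq_zero:
  "lc_map (*) xs (length xs) ((*) a) (cech_cohomologous (*) xs (length xs) `` {(c, n)}) = lc_zero (*) xs (length xs)
    \<longleftrightarrow> lc_vanishes (\<lambda>a. a) xs (a * c {..<length xs}) n"
  unfolding lc_map_times[OF is_ring_hom_id] cech_class_eq_zero[OF is_ring_hom_id] by simp

lemma local_cohomology_top:
  "local_cohomology (*) xs (length xs) = range (\<lambda>z. cech_cohomologous (*) xs (length xs) `` {z})"
  unfolding local_cohomology_def cech_cocycles_top[OF is_ring_hom_id] by (auto simp: quotient_def)

section \<open>Products of roots\<close>

lemma root_products_0: "root_products F e 0 = {1}"
  by (auto simp: root_products_def)

lemma root_products_Suc:
  "b \<in> root_products F e (Suc a) \<longleftrightarrow> (\<exists>b'\<in>root_products F e a. \<exists>r\<in>F. b = b' * r e)"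
proof
  assume "b \<in> root_products F e (Suc a)"
  then obtain h where "b = (\<Prod>i<Suc a. h i e)" "\<forall>i<Suc a. h i \<in> F"
    by (auto simp: root_products_def)
  then have "b = (\<Prod>i<a. h i e) * h a e" "(\<Prod>i<a. h i e) \<in> root_products F e a" "h a \<in> F"
    unfolding root_products_def by auto
  then show "\<exists>b'\<in>root_products F e a. \<exists>r\<in>F. b = b' * r e" by blast
next
  assume "\<exists>b'\<in>root_products F e a. \<exists>r\<in>F. b = b' * r e"
  then obtain h r where h: "b = (\<Prod>i<a. h i e) * r e" "\<forall>i<a. h i \<in> F" "r \<in> F"
    by (auto simp: root_products_def)
  define h' where "h' = h(a := r)"
  have "(\<Prod>i<a. h i e) = (\<Prod>i<a. h' i e)" by (intro prod.cong) (auto simp: h'_def)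
  then have "b = (\<Prod>i<Suc a. h' i e)" using h by (simp add: h'_def)
  moreover have "\<forall>i<Suc a. h' i \<in> F" using h by (auto simp: h'_def less_Suc_eq)
  ultimately show "b \<in> root_products F e (Suc a)" unfolding root_products_def by blast
qed

lemma root_products_add:
  "b \<in> root_products F e (a + a') \<longleftrightarrow> (\<exists>b1\<in>root_products F e a. \<exists>b2\<in>root_products F e a'. b = b1 * b2)"
proof (induction a' arbitrary: b)
  case 0
  then show ?case by (simp add: root_products_0)
next
  case (Suc a')
  have "(\<exists>b'\<in>root_products F e (a + a'). P b') \<longleftrightarrow>
    (\<exists>b1\<in>root_products F e a. \<exists>b2\<in>root_products F e a'. P (b1 * b2))" for P
    unfolding Bex_def Suc by blast
  moreover have "(\<exists>b2\<in>root_products F e (Suc a'). P b2) \<longleftrightarrow>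
    (\<exists>b2\<in>root_products F e a'. \<exists>r\<in>F. P (b2 * r e))" for P
    unfolding Bex_def root_products_Suc by blast
  ultimately show ?case
    by (simp only: add_Suc_right root_products_Suc[of b] mult.assoc)
qed

lemma root_products_power: "r \<in> F \<Longrightarrow> r e ^ a \<in> root_products F e a"
proof (induction a)
  case (Suc a)
  then show ?case unfolding root_products_Suc power_Suc2 by blast
qed (simp add: root_products_0)

text \<open>Each root is the \<open>p\<close>-th power of the next one. Products can thus be
  rewritten at arbitrarily deep levels, where rounding of exponents costs little.\<close>

lemma root_products_lift:
  assumes F: "\<And>r e. r \<in> F \<Longrightarrow> r (Suc e) ^ p = r e"
  shows "root_products F e a \<subseteq> root_products F (e + k) (a * p ^ k)"
proof -
  have step: "root_products F e a \<subseteq> root_products F (Suc e) (a * p)" for e a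
  proof (induction a)
    case 0
    then show ?case by (simp add: root_products_0)
  next
    case (Suc a)
    show ?case
    proof
      fix b assume "b \<in> root_products F e (Suc a)"
      then obtain b' r where "b' \<in> root_products F (Suc e) (a * p)" "r \<in> F" "b = b' * r (Suc e) ^ p"
        using Suc F by (auto simp: root_products_Suc)
      then have "b \<in> root_products F (Suc e) (a * p + p)"
        unfolding root_products_add using root_products_power by blast
      then show "b \<in> root_products F (Suc e) (Suc a * p)" by (simp add: add.commute)
    qed
  qed
  show ?thesis
  proof (induction k)
    case (Suc k)
    then show ?case using step[of "e + k" "a * p ^ k"] by (auto simp: mult_ac)
  qed simp
qed

lemma root_products_bullet_power:
  "root_products (bullet_power F N) e a = root_products F e (a * N)"
proof (induction a)
  case 0
  then show ?case by (simp add: root_products_0)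
next
  case (Suc a)
  have "(\<exists>r\<in>bullet_power F N. b = b' * r e) \<longleftrightarrow> (\<exists>c\<in>root_products F e N. b = b' * c)" for b b'
    by (auto simp: bullet_power_def root_products_def)
  then have "b \<in> root_products (bullet_power F N) e (Suc a) \<longleftrightarrow> b \<in> root_products F e (a * N + N)" for b
    by (simp add: root_products_Suc Suc root_products_add)
  then show ?case by (auto simp: add.commute)
qed

text \<open>The ideals grow as \<open>\<epsilon>\<close> decreases, so a maximal one among them is
  the constant value near 0, and eventual equality determines it uniquely.\<close>

lemma stable_value:
  fixes g :: "real \<Rightarrow> 'a::comm_ring_1 set"
  assumes noeth: "is_noetherian TYPE('a)" and g: "\<And>\<epsilon>. is_ideal (g \<epsilon>)"
    and mono: "\<And>\<epsilon> \<epsilon>'. 0 < \<epsilon> \<Longrightarrow> \<epsilon> \<le> \<epsilon>' \<Longrightarrow> g \<epsilon>' \<subseteq> g \<epsilon>"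
  shows "\<exists>\<delta>>0. \<forall>\<epsilon>. 0 < \<epsilon> \<longrightarrow> \<epsilon> < \<delta> \<longrightarrow> g \<epsilon> = (THE J. \<forall>\<^sub>F \<epsilon> in at_right 0. g \<epsilon> = J)"
proof -
  obtain M where "M \<in> g ` {0<..}" and max: "\<And>I. I \<in> g ` {0<..} \<Longrightarrow> M \<subseteq> I \<Longrightarrow> I = M"
    by (rule noetherian_maximal[OF noeth, of "g ` {0<..}"]) (use g in auto)
  then obtain \<delta> where \<delta>: "\<delta> > 0" "M = g \<delta>" by auto
  have eq: "g \<epsilon> = M" if "0 < \<epsilon>" "\<epsilon> < \<delta>" for \<epsilon>
    using max[of "g \<epsilon>"] mono[of \<epsilon> \<delta>] that \<delta> by auto
  then have ev: "\<forall>\<^sub>F \<epsilon> in at_right 0. g \<epsilon> = M"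
    using \<delta> by (intro eventually_at_rightI[of 0 \<delta>]) auto
  have "(THE J. \<forall>\<^sub>F \<epsilon> in at_right 0. g \<epsilon> = J) = M"
  proof (rule the_equality[where P = "\<lambda>J. \<forall>\<^sub>F \<epsilon> in at_right 0. g \<epsilon> = J", OF ev])
    fix J assume "\<forall>\<^sub>F \<epsilon> in at_right 0. g \<epsilon> = J"
    with ev have "\<forall>\<^sub>F \<epsilon> in at_right (0::real). J = M" by eventually_elim simp
    then show "J = M" by simp
  qed
  then show ?thesis using eq \<delta> by auto
qed

section \<open>Subadditivity for sets of multipliers\<close>

locale perfectoid_regular = regular_local m "(!) xs" d
  for m :: "'a::comm_ring_1 set" and xs :: "'a list" and d :: nat +
  fixes \<phi> :: "'a \<Rightarrow> 'b::comm_ring_1" and \<pi> :: "nat \<Rightarrow> 'b" and p :: nat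
  assumes length_xs: "length xs = d"
    and complete: "adically_complete m"
    and hom: "is_ring_hom \<phi>"
    and flat: "is_almost_flat \<phi> \<pi>"
    and pi_power: "\<pi> (Suc k) ^ p = \<pi> k"
    and p_ge_2: "2 \<le> p"
begin

definition ext :: "'a set \<Rightarrow> 'b set" where
  "ext I = ideal_gen (\<phi> ` I)"

text \<open>\<open>killed W n\<close> consists of the numerators \<open>v\<close> of the classes of \<open>v / (\<Prod>i<d. xs ! i) ^ n\<close> whose
  multiples by all members of \<open>W\<close> are almost zero, and \<open>multiplier W\<close> is the annihilator of all these
  classes.\<close>

definition killed :: "'b set \<Rightarrow> nat \<Rightarrow> 'a set" where
  "killed W n = {v. \<forall>b\<in>W. \<forall>k>0. \<pi> k * (b * \<phi> v) \<in> ext (Q n)}"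

definition multiplier :: "'b set \<Rightarrow> 'a set" where
  "multiplier W = (\<Inter>n. colon (Q n) (killed W n))"

lemma is_ideal_ext [simp]: "is_ideal (ext I)"
  by (simp add: ext_def)

lemma ext_base: "v \<in> I \<Longrightarrow> \<phi> v \<in> ext I"
  unfolding ext_def by (intro ideal_gen_base imageI)

lemma ext_mono: "I \<subseteq> J \<Longrightarrow> ext I \<subseteq> ext J"
  unfolding ext_def by (intro ideal_gen_mono image_mono)

lemma ext_Q: "ext (Q n) = ideal_gen ((\<lambda>i. \<phi> (xs ! i) ^ n) ` {..<d})"
  unfolding ext_def Q_def pideal_def ideal_gen_image_gen[OF hom]
  by (simp add: image_image ring_hom_simps[OF hom])

text \<open>As \<open>p\<close> is at least 2, \<open>\<pi> k = \<pi> (Suc k) ^ p\<close> is a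
  multiple of the square of \<open>\<pi> (Suc k)\<close>.\<close>

lemma almost_almost:
  assumes I: "is_ideal I" and "\<And>i j. i > 0 \<Longrightarrow> j > 0 \<Longrightarrow> \<pi> j * (\<pi> i * z) \<in> I" and "k > 0"
  shows "\<pi> k * z \<in> I"
proof -
  obtain r where r: "p = r + 2" using p_ge_2 le_Suc_ex[of 2 p] by (metis add.commute)
  have "\<pi> k = \<pi> (Suc k) ^ (p - 2) * (\<pi> (Suc k) * \<pi> (Suc k))"
    unfolding pi_power[of k, symmetric] unfolding r by (simp add: power_add power2_eq_square)
  then have "\<pi> k * z = \<pi> (Suc k) ^ (p - 2) * (\<pi> (Suc k) * (\<pi> (Suc k) * z))"
    by (simp add: mult.assoc)
  then show ?thesis using assms(2)[of "Suc k" "Suc k"] ideal_times[OF I] by simp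
qed

lemma flat_colon:
  assumes "is_ideal I" and "\<And>y. y \<in> J \<Longrightarrow> \<phi> y * u \<in> ext I" and "k > 0"
  shows "\<pi> k * u \<in> ext (colon I J)"
  using almost_flat_colon[OF noetherian hom flat] assms unfolding ext_def by blast

text \<open>Over the perfectoid algebra the transition maps are still almost injective, because
  flatness transports the colon by a single element.\<close>

lemma flat_Q_cancel:
  assumes "\<phi> (\<Prod>i<d. xs ! i) ^ k * u \<in> ext (Q (n + k))" and "i > 0"
  shows "\<pi> i * u \<in> ext (Q n)"
proof -
  have "\<pi> i * u \<in> ext (colon (Q (n + k)) {(\<Prod>i<d. xs ! i) ^ k})"
    using assms by (intro flat_colon) (auto simp: ring_hom_simps[OF hom])
  moreover have "colon (Q (n + k)) {(\<Prod>i<d. xs ! i) ^ k} \<subseteq> Q n"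
    using Q_cancel by (auto simp: colon_def)
  ultimately show ?thesis using ext_mono by blast
qed

text \<open>The exponent in \<open>lc_vanishes\<close> may depend on \<open>k\<close>. Almost
  injectivity of the transition maps removes it at the price of a further factor
  \<open>\<pi> j\<close>, which \<open>almost_almost\<close> absorbs.\<close>

lemma lc_vanishes_almost:
  "(\<forall>k>0. lc_vanishes \<phi> xs (\<pi> k * u) n) \<longleftrightarrow> (\<forall>k>0. \<pi> k * u \<in> ext (Q n))"
proof
  assume "\<forall>k>0. \<pi> k * u \<in> ext (Q n)"
  then show "\<forall>k>0. lc_vanishes \<phi> xs (\<pi> k * u) n"
    unfolding lc_vanishes_def ext_Q by (auto simp: length_xs intro!: exI[of _ 0])
next
  assume *: "\<forall>k>0. lc_vanishes \<phi> xs (\<pi> k * u) n"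
  have "\<pi> j * (\<pi> i * u) \<in> ext (Q n)" if "i > 0" "j > 0" for i j
  proof -
    obtain k where "\<phi> (\<Prod>i<d. xs ! i) ^ k * (\<pi> i * u) \<in> ext (Q (n + k))"
      using * \<open>i > 0\<close> unfolding lc_vanishes_def ext_Q by (auto simp: length_xs ring_hom_simps[OF hom])
    then show ?thesis using \<open>j > 0\<close> by (rule flat_Q_cancel)
  qed
  then show "\<forall>k>0. \<pi> k * u \<in> ext (Q n)" using almost_almost[OF is_ideal_ext] by blast
qed

lemma lc_vanishes_id: "lc_vanishes (\<lambda>a. a) xs v n \<longleftrightarrow> v \<in> Q n"
proof -
  have "lc_vanishes (\<lambda>a. a) xs v n \<longleftrightarrow> (\<exists>k. (\<Prod>i<d. xs ! i) ^ k * v \<in> Q (n + k))"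
    by (simp add: lc_vanishes_def Q_def pideal_def length_xs)
  then show ?thesis using Q_cancel Q_shift by blast
qed

lemma is_ideal_killed: "is_ideal (killed W n)"
  by (rule is_idealI)
    (auto simp: killed_def ring_hom_simps[OF hom] distrib_left mult.left_commute[of _ "\<phi> _"]
      intro: ideal_0 ideal_add ideal_times)

lemma Q_subset_killed: "Q n \<subseteq> killed W n"
  by (auto simp: killed_def intro!: ideal_times[OF is_ideal_ext] ext_base)

lemma killed_shift: "(\<Prod>i<d. xs ! i) ^ k * v \<in> killed W (n + k) \<longleftrightarrow> v \<in> killed W n"
proof
  assume v: "(\<Prod>i<d. xs ! i) ^ k * v \<in> killed W (n + k)"
  have "\<pi> j * (\<pi> i * (b * \<phi> v)) \<in> ext (Q n)" if "b \<in> W" "i > 0" "j > 0" for b i j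
  proof (rule flat_Q_cancel[OF _ \<open>j > 0\<close>])
    show "\<phi> (\<Prod>i<d. xs ! i) ^ k * (\<pi> i * (b * \<phi> v)) \<in> ext (Q (n + k))"
      using v that by (simp add: killed_def ring_hom_simps[OF hom] mult.left_commute)
  qed
  then show "v \<in> killed W n" unfolding killed_def using almost_almost[OF is_ideal_ext] by blast
next
  assume v: "v \<in> killed W n"
  have "\<pi> i * (b * \<phi> ((\<Prod>i<d. xs ! i) ^ k * v)) \<in> ext (Q (n + k))" if "b \<in> W" "i > 0" for b i
  proof -
    have "\<pi> i * (b * \<phi> v) \<in> ideal_gen ((\<lambda>i. \<phi> (xs ! i) ^ n) ` {..<d})"
      using v that unfolding killed_def ext_Q by blast
    then show ?thesis
      using prod_power_shift[of "\<pi> i * (b * \<phi> v)" "\<lambda>i. \<phi> (xs ! i)" n d k]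
      unfolding ext_Q by (simp add: ring_hom_simps[OF hom] mult.left_commute)
  qed
  then show "(\<Prod>i<d. xs ! i) ^ k * v \<in> killed W (n + k)" by (simp add: killed_def)
qed

lemma is_ideal_multiplier: "is_ideal (multiplier W)"
  unfolding multiplier_def by (intro is_ideal_Inter is_ideal_colon is_ideal_Q)

text \<open>A class almost killed by \<open>b'\<close> is almost killed by all multiples of
  \<open>b'\<close>; hence passing to multiples enlarges \<open>killed\<close> and shrinks its
  annihilator. Inclusions of exponent sets and dropped factors are both instances.\<close>

lemma multiplier_refine:
  assumes "\<And>b. b \<in> W \<Longrightarrow> \<exists>b'\<in>W'. \<exists>c. b = c * b'"
  shows "multiplier W \<subseteq> multiplier W'"
proof -
  have "killed W' n \<subseteq> killed W n" for n
  proof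
    fix v assume v: "v \<in> killed W' n"
    show "v \<in> killed W n"
      unfolding killed_def
    proof (intro CollectI ballI allI impI)
      fix b k assume "b \<in> W" "(k::nat) > 0"
      then obtain b' c where "b' \<in> W'" "b = c * b'" using assms by blast
      moreover from this have "c * (\<pi> k * (b' * \<phi> v)) \<in> ext (Q n)"
        using v \<open>k > 0\<close> by (intro ideal_times[of _ "\<pi> k * (b' * \<phi> v)"]) (auto simp: killed_def)
      ultimately show "\<pi> k * (b * \<phi> v) \<in> ext (Q n)" by (simp add: mult_ac)
    qed
  qed
  then show ?thesis unfolding multiplier_def colon_def by blast
qed

text \<open>The half of Matlis duality that needs completeness.\<close>

lemma colon_multiplier: "colon (Q (Suc n)) (multiplier W) \<subseteq> killed W (Suc n)"
proof
  fix c assume c: "c \<in> colon (Q (Suc n)) (multiplier W)"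
  define I where "I k = colon (Q k) (killed W k)" for k
  \<comment> \<open>The annihilators of the levels decrease because each level embeds into the later
    ones.\<close>
  have step: "I (k + l) \<subseteq> I k" for k l
  proof
    fix a assume a: "a \<in> I (k + l)"
    have "v * a \<in> Q k" if "v \<in> killed W k" for v
    proof -
      have "(\<Prod>i<d. xs ! i) ^ l * v \<in> killed W (k + l)" using that by (simp add: killed_shift)
      then have "(\<Prod>i<d. xs ! i) ^ l * (v * a) \<in> Q (k + l)"
        using a by (simp add: I_def colon_def flip: mult.assoc)
      then show ?thesis by (rule Q_cancel)
    qed
    then show "a \<in> I k" by (simp add: I_def colon_def)
  qed
  have "\<exists>k\<ge>Suc n. I k \<subseteq> isum (\<Inter>k. I k) (Q (Suc n))"
  proof (rule chevalley[OF complete])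
    show "is_ideal (I k)" "Q k \<subseteq> I k" for k
      unfolding I_def by (simp_all add: is_ideal_colon colon_superset)
    show "I j \<subseteq> I i" if "i \<le> j" for i j using step[of i "j - i"] that by simp
  qed
  then obtain k where k: "k \<ge> Suc n" "I k \<subseteq> isum (multiplier W) (Q (Suc n))"
    unfolding multiplier_def I_def by blast
  then obtain k' where k': "k = Suc k'" by (cases k) auto
  \<comment> \<open>\<open>c\<close> is moved up to level \<open>k\<close>, where the double
    annihilator property is applied, and \<open>killed_shift\<close> brings the result back.\<close>
  define l where "l = k - Suc n"
  have l: "k = Suc n + l" using k by (simp add: l_def)
  have "y * ((\<Prod>i<d. xs ! i) ^ l * c) \<in> Q k" if y: "y \<in> I k" for y
  proof -
    obtain t q where tq: "y = t + q" "t \<in> multiplier W" "q \<in> Q (Suc n)"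
      using k y unfolding isum_def by blast
    have "t * c + q * c \<in> Q (Suc n)"
    proof (intro ideal_add is_ideal_Q)
      show "t * c \<in> Q (Suc n)" using tq c by (auto simp: colon_def)
      show "q * c \<in> Q (Suc n)" using tq by (intro ideal_times_right is_ideal_Q)
    qed
    then have "(\<Prod>i<d. xs ! i) ^ l * (y * c) \<in> Q (Suc n + l)"
      by (intro Q_shift) (simp add: tq distrib_right)
    then show ?thesis using l by (simp add: mult.left_commute)
  qed
  then have "(\<Prod>i<d. xs ! i) ^ l * c \<in> colon (Q k) (colon (Q k) (killed W k))"
    by (simp add: colon_def I_def)
  then have "(\<Prod>i<d. xs ! i) ^ l * c \<in> killed W k"
    unfolding k' using colon_colon_Q[OF is_ideal_killed Q_subset_killed] by simp
  then show "c \<in> killed W (Suc n)" unfolding l killed_shift .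
qed

theorem multiplier_subadditive:
  assumes W: "\<And>b. b \<in> W \<Longrightarrow> \<exists>b1\<in>W1. \<exists>b2\<in>W2. b = b1 * b2"
  shows "multiplier W \<subseteq> ideal_mult (multiplier W1) (multiplier W2)"
proof
  fix z assume z: "z \<in> multiplier W"
  let ?IJ = "ideal_mult (multiplier W1) (multiplier W2)"
  show "z \<in> ?IJ"
  proof (rule krull_intersection)
    fix n
    define M where "M = isum ?IJ (Q (Suc n))"
    have M: "is_ideal M" "Q (Suc n) \<subseteq> M" "?IJ \<subseteq> M"
      unfolding M_def by (simp_all add: is_ideal_isum isum_right isum_left)
    have "c * z \<in> Q (Suc n)" if "c \<in> colon (Q (Suc n)) M" for c
    proof -
      have c: "(y1 * y2) * c \<in> Q (Suc n)" if "y1 \<in> multiplier W1" "y2 \<in> multiplier W2" for y1 y2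
        using that M(3) ideal_mult_base[of y1 _ y2] \<open>c \<in> colon (Q (Suc n)) M\<close> by (auto simp: colon_def)
      have "c \<in> killed W (Suc n)"
        unfolding killed_def
      proof (intro CollectI ballI allI impI)
        fix b k assume "b \<in> W" and k: "(k::nat) > 0"
        then obtain b1 b2 where b: "b1 \<in> W1" "b2 \<in> W2" "b = b1 * b2" using W by blast
        \<comment> \<open>The factor \<open>\<pi> i\<close> comes from \<open>killed W1\<close>,
          \<open>\<pi> j\<close> from flatness and \<open>\<pi> l\<close> from
          \<open>killed W2\<close>.\<close>
        have "\<pi> l * (\<pi> j * (\<pi> i * (b1 * b2 * \<phi> c))) \<in> ext (Q (Suc n))"
          if ijl: "i > 0" "j > 0" "l > 0" for i j l
        proof -
          define u where "u = \<pi> i * (b1 * \<phi> c)"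
          have "\<phi> y * u \<in> ext (Q (Suc n))" if y: "y \<in> multiplier W2" for y
          proof -
            have "y * c \<in> colon (Q (Suc n)) (multiplier W1)"
              using c[OF _ y] by (auto simp: colon_def mult.assoc)
            then have "y * c \<in> killed W1 (Suc n)" using colon_multiplier by blast
            then show ?thesis
              using b ijl by (simp add: u_def killed_def ring_hom_simps[OF hom] mult_ac)
          qed
          then have "\<pi> j * u \<in> ext (colon (Q (Suc n)) (multiplier W2))"
            using ijl by (intro flat_colon) auto
          also have "\<dots> \<subseteq> ext (killed W2 (Suc n))" by (intro ext_mono colon_multiplier)
          also have "\<dots> \<subseteq> colon (ext (Q (Suc n))) {\<pi> l * b2}"
            unfolding ext_def[of "killed W2 (Suc n)"]
            using b ijl by (intro ideal_gen_least is_ideal_colon) (auto simp: colon_def killed_def mult.assoc)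
          finally show ?thesis by (simp add: u_def colon_def mult_ac)
        qed
        then have "\<pi> k * (b1 * b2 * \<phi> c) \<in> ext (Q (Suc n))"
          using almost_almost[OF is_ideal_ext] k by metis
        then show "\<pi> k * (b * \<phi> c) \<in> ext (Q (Suc n))" by (simp add: b)
      qed
      then show ?thesis using z by (auto simp: multiplier_def colon_def)
    qed
    then have "z \<in> colon (Q (Suc n)) (colon (Q (Suc n)) M)" by (simp add: colon_def)
    then show "z \<in> isum ?IJ (Q (Suc n))" using colon_colon_Q[OF M(1,2)] by (simp add: M_def)
  qed simp
qed

lemma annihilator_eq_multiplier:
  assumes "N = {\<eta> \<in> local_cohomology (*) xs d. \<forall>b\<in>W. almost_kills \<phi> \<pi> xs d b \<eta>}"
  shows "lc_annihilator xs d N = multiplier W"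
proof -
  let ?cls = "\<lambda>c n. cech_cohomologous (*) xs d `` {(c, n)}"
  have kills: "almost_kills \<phi> \<pi> xs d b (?cls c n) \<longleftrightarrow> (\<forall>k>0. \<pi> k * (b * \<phi> (c {..<d})) \<in> ext (Q n))" for b c n
    using almost_kills_class[OF hom, of \<pi> xs b c n] by (simp add: length_xs lc_vanishes_almost)
  have times: "lc_map (*) xs d ((*) a) (?cls c n) = lc_zero (*) xs d \<longleftrightarrow> a * c {..<d} \<in> Q n" for a c n
    using times_class_eq_zero[of xs a c n] by (simp add: length_xs lc_vanishes_id)
  have lc: "local_cohomology (*) xs d = {?cls c n | c n. True}"
    using local_cohomology_top[of xs] by (auto simp: length_xs)
  have "a \<in> lc_annihilator xs d N \<longleftrightarrow> (\<forall>c n. c {..<d} \<in> killed W n \<longrightarrow> a * c {..<d} \<in> Q n)" for a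
  proof -
    have "a \<in> lc_annihilator xs d N \<longleftrightarrow>
      (\<forall>c n. (\<forall>b\<in>W. almost_kills \<phi> \<pi> xs d b (?cls c n)) \<longrightarrow> lc_map (*) xs d ((*) a) (?cls c n) = lc_zero (*) xs d)"
      unfolding lc_annihilator_def assms lc by blast
    then show ?thesis unfolding kills times killed_def by simp
  qed
  moreover have "(\<forall>c n. c {..<d} \<in> killed W n \<longrightarrow> a * c {..<d} \<in> Q n) \<longleftrightarrow> (\<forall>v n. v \<in> killed W n \<longrightarrow> a * v \<in> Q n)" for a
  proof
    assume *: "\<forall>c n. c {..<d} \<in> killed W n \<longrightarrow> a * c {..<d} \<in> Q n"
    \<comment> \<open>Every numerator \<open>v\<close> occurs as the top component of a constant
      cochain.\<close>
    then show "\<forall>v n. v \<in> killed W n \<longrightarrow> a * v \<in> Q n"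
      using spec[OF *, of "\<lambda>_. v" for v] by simp
  qed simp
  ultimately show ?thesis by (auto simp: multiplier_def colon_def mult.commute)
qed

section \<open>Exponent sets, stabilization and powers\<close>

definition exponents :: "(nat \<Rightarrow> 'b) set \<Rightarrow> real \<Rightarrow> 'b set" where
  "exponents F t = {b. \<exists>e>0. \<exists>a. real a \<ge> t * real p ^ e \<and> b \<in> root_products F e a}"

definition mixed_exponents :: "(nat \<Rightarrow> 'b) set \<Rightarrow> real \<Rightarrow> (nat \<Rightarrow> 'b) set \<Rightarrow> real \<Rightarrow> 'b set" where
  "mixed_exponents F t G s = {b * b' | b b'. \<exists>e>0. \<exists>a a'. real a \<ge> t * real p ^ e \<and> real a' \<ge> s * real p ^ e \<and>
     b \<in> root_products F e a \<and> b' \<in> root_products G e a'}"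

lemma tau_sharp_eq: "tau_sharp p \<phi> \<pi> xs d F t = multiplier (exponents F t)"
  unfolding tau_sharp_def
  by (rule annihilator_eq_multiplier) (auto simp: zero_diamond_def exponents_def)

lemma tau_sharp_mixed_eq: "tau_sharp_mixed p \<phi> \<pi> xs d F t G s = multiplier (mixed_exponents F t G s)"
  unfolding tau_sharp_mixed_def
  by (rule annihilator_eq_multiplier) (unfold zero_diamond_mixed_def mixed_exponents_def, blast)

lemma tau_sharp_mixed_subset:
  "tau_sharp_mixed p \<phi> \<pi> xs d F t G s \<subseteq> ideal_mult (tau_sharp p \<phi> \<pi> xs d F t) (tau_sharp p \<phi> \<pi> xs d G s)"
  unfolding tau_sharp_eq tau_sharp_mixed_eq
  by (rule multiplier_subadditive) (auto simp: exponents_def mixed_exponents_def)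

lemma tau_sharp_antimono:
  "t \<le> t' \<Longrightarrow> tau_sharp p \<phi> \<pi> xs d F t' \<subseteq> tau_sharp p \<phi> \<pi> xs d F t"
proof -
  assume t: "t \<le> t'"
  have "b \<in> exponents F t" if "b \<in> exponents F t'" for b
    using that mult_right_mono[OF t, of "real p ^ e" for e] unfolding exponents_def
    by (auto intro: order_trans)
  then show ?thesis
    unfolding tau_sharp_eq by (intro multiplier_refine) (metis mult_1)
qed

lemma tau_sharp_mixed_antimono:
  "t \<le> t' \<Longrightarrow> s \<le> s' \<Longrightarrow> tau_sharp_mixed p \<phi> \<pi> xs d F t' G s' \<subseteq> tau_sharp_mixed p \<phi> \<pi> xs d F t G s"
proof -
  assume t: "t \<le> t'" "s \<le> s'"
  have "b \<in> mixed_exponents F t G s" if b: "b \<in> mixed_exponents F t' G s'" for b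
  proof -
    obtain b1 b2 e a a' where *: "b = b1 * b2" "e > 0" "real a \<ge> t' * real p ^ e" "real a' \<ge> s' * real p ^ e"
      "b1 \<in> root_products F e a" "b2 \<in> root_products G e a'"
      using b unfolding mixed_exponents_def by blast
    moreover have "t * real p ^ e \<le> t' * real p ^ e" "s * real p ^ e \<le> s' * real p ^ e"
      using t by (simp_all add: mult_right_mono)
    then have "real a \<ge> t * real p ^ e" "real a' \<ge> s * real p ^ e" using * by linarith+
    ultimately show ?thesis unfolding mixed_exponents_def by blast
  qed
  then show ?thesis
    unfolding tau_sharp_mixed_eq by (intro multiplier_refine) (metis mult_1)
qed

lemma tau_eventually:
  "\<exists>\<delta>>0. \<forall>\<epsilon>. 0 < \<epsilon> \<longrightarrow> \<epsilon> < \<delta> \<longrightarrow> tau_sharp p \<phi> \<pi> xs d F (t + \<epsilon>) = tau p \<phi> \<pi> xs d F t"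
  unfolding tau_def by (intro stable_value noetherian tau_sharp_antimono) (auto simp: tau_sharp_eq is_ideal_multiplier)

lemma tau_mixed_eventually:
  "\<exists>\<delta>>0. \<forall>\<epsilon>. 0 < \<epsilon> \<longrightarrow> \<epsilon> < \<delta> \<longrightarrow>
     tau_sharp_mixed p \<phi> \<pi> xs d F (t + \<epsilon>) G (s + \<epsilon>) = tau_mixed p \<phi> \<pi> xs d F t G s"
  unfolding tau_mixed_def
  by (intro stable_value noetherian tau_sharp_mixed_antimono) (auto simp: tau_sharp_mixed_eq is_ideal_multiplier)

lemma tau_mixed_subset:
  "tau_mixed p \<phi> \<pi> xs d F t G s \<subseteq> ideal_mult (tau p \<phi> \<pi> xs d F t) (tau p \<phi> \<pi> xs d G s)"
proof -
  obtain \<delta>1 \<delta>2 \<delta>3 where "\<delta>1 > 0" "\<delta>2 > 0" "\<delta>3 > 0"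
    and \<delta>: "\<And>\<epsilon>. 0 < \<epsilon> \<Longrightarrow> \<epsilon> < \<delta>1 \<Longrightarrow> tau_sharp_mixed p \<phi> \<pi> xs d F (t + \<epsilon>) G (s + \<epsilon>) = tau_mixed p \<phi> \<pi> xs d F t G s"
    "\<And>\<epsilon>. 0 < \<epsilon> \<Longrightarrow> \<epsilon> < \<delta>2 \<Longrightarrow> tau_sharp p \<phi> \<pi> xs d F (t + \<epsilon>) = tau p \<phi> \<pi> xs d F t"
    "\<And>\<epsilon>. 0 < \<epsilon> \<Longrightarrow> \<epsilon> < \<delta>3 \<Longrightarrow> tau_sharp p \<phi> \<pi> xs d G (s + \<epsilon>) = tau p \<phi> \<pi> xs d G s"
    using tau_mixed_eventually[of F t G s] tau_eventually[of F t] tau_eventually[of G s] by auto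
  define \<epsilon> where "\<epsilon> = min \<delta>1 (min \<delta>2 \<delta>3) / 2"
  have "0 < \<epsilon>" "\<epsilon> < \<delta>1" "\<epsilon> < \<delta>2" "\<epsilon> < \<delta>3"
    using \<open>\<delta>1 > 0\<close> \<open>\<delta>2 > 0\<close> \<open>\<delta>3 > 0\<close> by (auto simp: \<epsilon>_def)
  then show ?thesis using tau_sharp_mixed_subset[of F "t + \<epsilon>" G "s + \<epsilon>"] \<delta> by simp
qed

text \<open>Both sides of the exponent condition scale by \<open>p ^ k\<close> when each root is
  replaced by \<open>p ^ k\<close> deeper ones, so the level can be raised until a slack of
  \<open>\<epsilon>\<close> amounts to at least one root.\<close>

lemma exponents_lift:
  assumes F: "\<And>r e. r \<in> F \<Longrightarrow> r (Suc e) ^ p = r e" and b: "b \<in> exponents F t" and "\<epsilon> > 0"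
  obtains e a where "e > 0" and "real a \<ge> t * real p ^ e" and "b \<in> root_products F e a"
    and "\<epsilon> * real p ^ e \<ge> 1"
proof -
  obtain e a where e: "e > 0" "real a \<ge> t * real p ^ e" "b \<in> root_products F e a"
    using b unfolding exponents_def by blast
  obtain k where k: "1 / \<epsilon> < real p ^ k" using real_arch_pow[of "real p" "1 / \<epsilon>"] p_ge_2 by auto
  have "real p ^ k \<le> real p ^ (e + k)" using p_ge_2 by (intro power_increasing) auto
  then have "1 / \<epsilon> \<le> real p ^ (e + k)" using k by linarith
  then have "\<epsilon> * real p ^ (e + k) \<ge> 1" using \<open>\<epsilon> > 0\<close> by (simp add: field_simps)
  moreover have "real (a * p ^ k) \<ge> t * real p ^ (e + k)"
    using mult_right_mono[OF e(2), of "real p ^ k"] by (simp add: power_add mult.assoc)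
  moreover have "b \<in> root_products F (e + k) (a * p ^ k)"
    using root_products_lift[OF F] e(3) by blast
  ultimately show ?thesis using e(1) that[of "e + k" "a * p ^ k"] by simp
qed

text \<open>Of the three \<open>\<epsilon>\<close>, two go to the two exponents and the third pays
  for rounding \<open>(t + \<epsilon>) * q\<close> up to an integer.\<close>

lemma exponents_split:
  assumes F: "\<And>r e. r \<in> F \<Longrightarrow> r (Suc e) ^ p = r e" and "0 \<le> t" "0 \<le> s" "\<epsilon> > 0"
  shows "exponents F (t + s + 3 * \<epsilon>) \<subseteq> mixed_exponents F (t + \<epsilon>) F (s + \<epsilon>)"
proof
  fix b assume "b \<in> exponents F (t + s + 3 * \<epsilon>)"
  then obtain e a where e: "e > 0" "real a \<ge> (t + s + 3 * \<epsilon>) * real p ^ e"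
    "b \<in> root_products F e a" "\<epsilon> * real p ^ e \<ge> 1"
    using exponents_lift[OF F _ \<open>\<epsilon> > 0\<close>] by metis
  define q where "q = real p ^ e"
  define a1 where "a1 = nat \<lceil>(t + \<epsilon>) * q\<rceil>"
  have q: "q \<ge> 0" by (simp add: q_def)
  then have "(t + \<epsilon>) * q \<ge> 0" "s * q \<ge> 0" using assms by auto
  then have a1: "real a1 \<ge> (t + \<epsilon>) * q" "real a1 \<le> (t + \<epsilon>) * q + 1" unfolding a1_def by linarith+
  have "real a \<ge> t * q + s * q + 3 * (\<epsilon> * q)" using e(2) by (simp add: q_def algebra_simps)
  moreover have "(t + \<epsilon>) * q = t * q + \<epsilon> * q" "\<epsilon> * q \<ge> 1" using e(4) by (simp_all add: q_def algebra_simps)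
  ultimately have le: "real a1 + (s * q + \<epsilon> * q) \<le> real a" using a1 by linarith
  then have "a1 \<le> a" using \<open>s * q \<ge> 0\<close> \<open>\<epsilon> * q \<ge> 1\<close> by linarith
  then have a: "a = a1 + (a - a1)" by simp
  then obtain b1 b2 where b: "b1 \<in> root_products F e a1" "b2 \<in> root_products F e (a - a1)" "b = b1 * b2"
    using e(3) root_products_add by metis
  moreover have "real (a - a1) \<ge> (s + \<epsilon>) * q"
    using le \<open>a1 \<le> a\<close> by (simp add: of_nat_diff algebra_simps)
  ultimately show "b \<in> mixed_exponents F (t + \<epsilon>) F (s + \<epsilon>)"
    unfolding mixed_exponents_def using e(1) a1(1) unfolding q_def by blast
qed

lemma tau_add_subset:
  assumes F: "\<And>r e. r \<in> F \<Longrightarrow> r (Suc e) ^ p = r e" and "0 \<le> t" "0 \<le> s"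
  shows "tau p \<phi> \<pi> xs d F (t + s) \<subseteq> ideal_mult (tau p \<phi> \<pi> xs d F t) (tau p \<phi> \<pi> xs d F s)"
proof -
  obtain \<delta>1 \<delta>2 where "\<delta>1 > 0" "\<delta>2 > 0"
    and \<delta>: "\<And>\<epsilon>. 0 < \<epsilon> \<Longrightarrow> \<epsilon> < \<delta>1 \<Longrightarrow> tau_sharp_mixed p \<phi> \<pi> xs d F (t + \<epsilon>) F (s + \<epsilon>) = tau_mixed p \<phi> \<pi> xs d F t F s"
    "\<And>\<epsilon>. 0 < \<epsilon> \<Longrightarrow> \<epsilon> < \<delta>2 \<Longrightarrow> tau_sharp p \<phi> \<pi> xs d F ((t + s) + \<epsilon>) = tau p \<phi> \<pi> xs d F (t + s)"
    using tau_mixed_eventually[of F t F s] tau_eventually[of F "t + s"] by auto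
  \<comment> \<open>Division by 6 keeps \<open>3 * \<epsilon>\<close> strictly below
    \<open>\<delta>2\<close>.\<close>
  define \<epsilon> where "\<epsilon> = min \<delta>1 \<delta>2 / 6"
  have \<epsilon>: "0 < \<epsilon>" "\<epsilon> < \<delta>1" "0 < 3 * \<epsilon>" "3 * \<epsilon> < \<delta>2"
    using \<open>\<delta>1 > 0\<close> \<open>\<delta>2 > 0\<close> by (auto simp: \<epsilon>_def)
  have "tau p \<phi> \<pi> xs d F (t + s) = multiplier (exponents F (t + s + 3 * \<epsilon>))"
    using \<delta>(2)[OF \<epsilon>(3,4)] by (simp add: tau_sharp_eq)
  also have "\<dots> \<subseteq> multiplier (mixed_exponents F (t + \<epsilon>) F (s + \<epsilon>))"
    using exponents_split[OF F assms(2,3) \<epsilon>(1)] by (intro multiplier_refine) (metis mult_1 subsetD)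
  also have "\<dots> = tau_mixed p \<phi> \<pi> xs d F t F s"
    using \<delta>(1)[OF \<epsilon>(1,2)] by (simp add: tau_sharp_mixed_eq)
  also have "\<dots> \<subseteq> ideal_mult (tau p \<phi> \<pi> xs d F t) (tau p \<phi> \<pi> xs d F s)" by (rule tau_mixed_subset)
  finally show ?thesis .
qed

lemma tau_multiple_subset:
  assumes F: "\<And>r e. r \<in> F \<Longrightarrow> r (Suc e) ^ p = r e" and t: "0 \<le> t"
  shows "tau p \<phi> \<pi> xs d F (t * real N) \<subseteq> ideal_pow (tau p \<phi> \<pi> xs d F t) N"
proof (induction N)
  case (Suc N)
  have "tau p \<phi> \<pi> xs d F (t * real (Suc N)) = tau p \<phi> \<pi> xs d F (t + t * real N)"
    by (simp add: distrib_left)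
  also have "\<dots> \<subseteq> ideal_mult (tau p \<phi> \<pi> xs d F t) (tau p \<phi> \<pi> xs d F (t * real N))"
    using t by (intro tau_add_subset F) auto
  also have "\<dots> \<subseteq> ideal_mult (tau p \<phi> \<pi> xs d F t) (ideal_pow (tau p \<phi> \<pi> xs d F t) N)"
    using Suc by (intro ideal_mult_least is_ideal_ideal_mult ideal_mult_base) auto
  finally show ?case unfolding ideal_pow.simps .
qed simp

lemma tau_sharp_bullet_power_subset:
  "tau_sharp p \<phi> \<pi> xs d (bullet_power F N) t \<subseteq> tau_sharp p \<phi> \<pi> xs d F (t * real N)"
proof -
  have "b \<in> exponents F (t * real N)" if b: "b \<in> exponents (bullet_power F N) t" for b
  proof -
    obtain e a where e: "e > 0" "real a \<ge> t * real p ^ e" "b \<in> root_products F e (a * N)"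
      using b unfolding exponents_def root_products_bullet_power by blast
    have "t * real p ^ e * real N \<le> real a * real N" using e(2) by (intro mult_right_mono) auto
    then have "t * real N * real p ^ e \<le> real (a * N)" by (simp add: mult_ac)
    then show ?thesis unfolding exponents_def using e by blast
  qed
  then show ?thesis unfolding tau_sharp_eq by (intro multiplier_refine) (metis mult_1)
qed

text \<open>Grouping \<open>a\<close> roots into blocks of \<open>N\<close> leaves fewer than
  \<open>N\<close> roots over. These become the cofactor \<open>c\<close>, and the loss of less than
  one block is covered by \<open>\<epsilon> * p ^ e \<ge> 1\<close>.\<close>

lemma tau_sharp_subset_bullet_power:
  assumes F: "\<And>r e. r \<in> F \<Longrightarrow> r (Suc e) ^ p = r e" and "\<epsilon> > 0" and N: "N > 0"
  shows "tau_sharp p \<phi> \<pi> xs d F ((t + \<epsilon>) * real N) \<subseteq> tau_sharp p \<phi> \<pi> xs d (bullet_power F N) t"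
  unfolding tau_sharp_eq
proof (rule multiplier_refine)
  fix b assume "b \<in> exponents F ((t + \<epsilon>) * real N)"
  then obtain e a where e: "e > 0" "real a \<ge> (t + \<epsilon>) * real N * real p ^ e"
    "b \<in> root_products F e a" "\<epsilon> * real p ^ e \<ge> 1"
    using exponents_lift[OF F _ \<open>\<epsilon> > 0\<close>] by metis
  have "b \<in> root_products F e ((a div N) * N + a mod N)" using e(3) by simp
  then obtain b1 b2 where b: "b1 \<in> root_products F e ((a div N) * N)" "b = b1 * b2"
    using root_products_add by metis
  have "a < (a div N + 1) * N" 
    using mod_less_divisor[OF N, of a] div_mult_mod_eq[of a N] unfolding distrib_right by linarith
  then have "real a \<le> real (a div N + 1) * real N"
    by (metis less_imp_le of_nat_le_iff of_nat_mult)
  then have "(t + \<epsilon>) * real p ^ e * real N \<le> real (a div N + 1) * real N"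
    using e(2) by (simp add: mult_ac)
  then have "(t + \<epsilon>) * real p ^ e \<le> real (a div N + 1)" using N by simp
  then have "t * real p ^ e \<le> real (a div N)" using e(4) by (simp add: distrib_right)
  then have "b1 \<in> exponents (bullet_power F N) t"
    unfolding exponents_def root_products_bullet_power using e(1) b(1) by blast
  then show "\<exists>b'\<in>exponents (bullet_power F N) t. \<exists>c. b = c * b'"
    using b(2) by (metis mult.commute)
qed

text \<open>A sandwich between exponents slightly above \<open>t * N\<close>; the side on which
  roots are grouped into blocks spends a second \<open>\<epsilon>\<close>.\<close>

lemma tau_bullet_power:
  assumes F: "\<And>r e. r \<in> F \<Longrightarrow> r (Suc e) ^ p = r e" and N: "N > 0"
  shows "tau p \<phi> \<pi> xs d (bullet_power F N) t = tau p \<phi> \<pi> xs d F (t * real N)"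
proof -
  obtain \<delta>1 \<delta>2 where "\<delta>1 > 0" "\<delta>2 > 0"
    and \<delta>: "\<And>\<epsilon>. 0 < \<epsilon> \<Longrightarrow> \<epsilon> < \<delta>1 \<Longrightarrow>
      tau_sharp p \<phi> \<pi> xs d (bullet_power F N) (t + \<epsilon>) = tau p \<phi> \<pi> xs d (bullet_power F N) t"
    "\<And>\<epsilon>. 0 < \<epsilon> \<Longrightarrow> \<epsilon> < \<delta>2 \<Longrightarrow> tau_sharp p \<phi> \<pi> xs d F (t * real N + \<epsilon>) = tau p \<phi> \<pi> xs d F (t * real N)"
    using tau_eventually[of "bullet_power F N" t] tau_eventually[of F "t * real N"] by auto
  define \<epsilon> where "\<epsilon> = min \<delta>1 (\<delta>2 / real N) / 4"
  have \<epsilon>: "0 < \<epsilon>" "\<epsilon> < \<delta>1" "\<epsilon> < \<delta>2 / real N" "2 * \<epsilon> < \<delta>2 / real N"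
    using \<open>\<delta>1 > 0\<close> \<open>\<delta>2 > 0\<close> N by (auto simp: \<epsilon>_def min_def divide_simps)
  have "tau p \<phi> \<pi> xs d (bullet_power F N) t \<subseteq> tau_sharp p \<phi> \<pi> xs d F ((t + \<epsilon>) * real N)"
    using tau_sharp_bullet_power_subset[of F N "t + \<epsilon>"] \<delta>(1)[OF \<epsilon>(1,2)] by simp
  also have "\<dots> = tau p \<phi> \<pi> xs d F (t * real N)"
    using \<delta>(2)[of "\<epsilon> * real N"] \<epsilon> N by (simp add: field_simps)
  finally have "tau p \<phi> \<pi> xs d (bullet_power F N) t \<subseteq> tau p \<phi> \<pi> xs d F (t * real N)" .
  moreover have "tau p \<phi> \<pi> xs d F (t * real N) = tau_sharp p \<phi> \<pi> xs d F ((t + \<epsilon> + \<epsilon>) * real N)"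
    using \<delta>(2)[of "2 * \<epsilon> * real N"] \<epsilon> N by (simp add: field_simps)
  moreover have "tau_sharp p \<phi> \<pi> xs d F ((t + \<epsilon> + \<epsilon>) * real N) \<subseteq> tau_sharp p \<phi> \<pi> xs d (bullet_power F N) (t + \<epsilon>)"
    by (rule tau_sharp_subset_bullet_power[OF _ \<epsilon>(1) N]) (rule F)
  ultimately show ?thesis using \<delta>(1)[OF \<epsilon>(1,2)] by blast
qed

end

theorem theorem4p4:
  fixes p d n n' :: nat
    and h :: "'z::comm_ring_1 \<Rightarrow> 'r::idom" and w :: "nat \<Rightarrow> 'r"
    and j :: "'r \<Rightarrow> 'k::comm_ring_1"
    and \<kappa> :: "'k \<Rightarrow> 'b::comm_ring_1" and \<pi> :: "nat \<Rightarrow> 'b"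
    and m :: "'a::comm_ring_1 set" and xs :: "'a list"
    and \<phi> :: "'a \<Rightarrow> 'b"
    and f g :: "nat \<Rightarrow> 'a"
    and rf rg :: "nat \<Rightarrow> nat \<Rightarrow> 'b" and F G :: "(nat \<Rightarrow> 'b) set"
    and t s :: real
  assumes "prime p"
    \<comment> \<open>\<open>'z\<close> is \<open>\<int>\<^sub>p\<close>, \<open>'r\<close> is \<open>\<int>\<^sub>p[p\<^bsup>1/p^\<infinity>\<^esup>]\<close> and \<open>'k\<close> is \<open>K\<degree>\<close>\<close>
    and "is_p_completion p (of_int :: int \<Rightarrow> 'z)"
    and "is_p_root_extension p h w"
    and "is_p_completion p j"
    \<comment> \<open>the complete regular local ring \<open>A\<close>, with a minimal system \<open>xs\<close> of generators of \<open>m\<close>\<close>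
    and "is_regular_local_ring m d"
    and "adically_complete m"
    and "mixed_char p m"
    and "length xs = d" and "ideal_gen (set xs) = m"
    \<comment> \<open>the integral perfectoid \<open>K\<degree>\<close>-algebra with its map from \<open>A\<close>\<close>
    and "is_ring_hom \<kappa>"
    and "\<pi> = (\<lambda>k. \<kappa> (j (w k)))"
    and "is_integral_perfectoid p \<pi>"
    and "is_ring_hom \<phi>"
    and "\<forall>a. \<exists>r. compatible_roots p r (\<phi> a)"
    and "is_almost_flat \<phi> \<pi>"
    and "almost_zero_tensor_imp_zero \<phi> \<pi>"
    and "\<forall>i<n. compatible_roots p (rf i) (\<phi> (f i))"
    and "\<forall>i<n'. compatible_roots p (rg i) (\<phi> (g i))"
    and "t \<ge> 0" and "s \<ge> 0"
    and "F = rf ` {..<n}" and "G = rg ` {..<n'}"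
  shows "tau_sharp_mixed p \<phi> \<pi> xs d F t G s
           \<subseteq> ideal_mult (tau_sharp p \<phi> \<pi> xs d F t) (tau_sharp p \<phi> \<pi> xs d G s) \<and>
         tau_mixed p \<phi> \<pi> xs d F t G s
           \<subseteq> ideal_mult (tau p \<phi> \<pi> xs d F t) (tau p \<phi> \<pi> xs d G s) \<and>
         (\<forall>t'\<ge>0. \<forall>N>0.
            tau p \<phi> \<pi> xs d (bullet_power F N) t' = tau p \<phi> \<pi> xs d F (t' * real N) \<and>
            tau p \<phi> \<pi> xs d F (t' * real N) \<subseteq> ideal_pow (tau p \<phi> \<pi> xs d F t') N)"
proof -
  have hom_j: "is_ring_hom j" using assms(4) by (simp add: is_p_completion_def)
  have roots_w: "w (Suc e) ^ p = w e" for e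
    using assms(3) by (simp add: is_p_root_extension_def compatible_roots_def)
  interpret perfectoid_regular m xs d \<phi> \<pi> p
  proof
    show "is_noetherian TYPE('a)" "is_local_ring m" "krull_dim TYPE('a) = enat d"
      using assms(5) by (simp_all add: is_regular_local_ring_def)
    have "(!) xs ` {..<d} = set xs"
      using assms(8) by (auto simp: set_conv_nth)
    then show "ideal_gen ((!) xs ` {..<d}) = m" using assms(9) by simp
    show "length xs = d" "adically_complete m" "is_ring_hom \<phi>" "is_almost_flat \<phi> \<pi>" by fact+
    \<comment> \<open>The compatible system of roots of \<open>p\<close> is carried along the two
      ring maps \<open>j\<close> and \<open>\<kappa>\<close>.\<close>
    show "\<pi> (Suc k) ^ p = \<pi> k" for k
      using ring_hom_simps(7)[OF hom_j, of "w (Suc k)" p] ring_hom_simps(7)[OF assms(10), of "j (w (Suc k))" p]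
      by (simp add: assms(11) roots_w)
    show "2 \<le> p" using assms(1) by (rule prime_ge_2_nat)
  qed
  have F: "r (Suc e) ^ p = r e" if "r \<in> F" for r e
    using that assms(17) unfolding assms(21) compatible_roots_def by auto
  show ?thesis
  proof (intro conjI allI impI)
    fix t' :: real and N :: nat assume "t' \<ge> 0" and "N > 0"
    show "tau p \<phi> \<pi> xs d (bullet_power F N) t' = tau p \<phi> \<pi> xs d F (t' * real N)"
      by (rule tau_bullet_power[OF _ \<open>N > 0\<close>]) (rule F)
    show "tau p \<phi> \<pi> xs d F (t' * real N) \<subseteq> ideal_pow (tau p \<phi> \<pi> xs d F t') N"
      by (rule tau_multiple_subset[OF _ \<open>t' \<ge> 0\<close>]) (rule F)
  qed (rule tau_sharp_mixed_subset tau_mixed_subset)+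
qed

end
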